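(* Let $n\ge1$, $M\ge0$ be integers, $\nu_1,\ldots,\nu_M$ non-negative integers, and $b_1,\ldots,b_n\in\mathbb{R}$. Consider the point process of $n$ points on $\mathbb{R}\setminus\{0\}$ with joint probability density function proportional to $$\Delta_n(x)\,\det\big[g_M(x_i,b_j)\big]_{i,j=1}^n,\qquad x_1,\ldots,x_n\in\mathbb{R}\setminus\{0\}$$ (understood as a limit, via L'Hospital's rule, if some $b_j$ coincide). Then this is a determinantal point process whose correlation kernel is given by $$K_n(\mathbf{b};x,y)=\frac{1}{2(\pi i)^2}\int_{\mathcal{L}}du\int_{\mathcal{C}_{\mathbf{b}}}dv\, f_M(x,u)\,g_M(y,v)\,e^{u^2-v^2}\,\frac{1}{u-v}\prod_{l=1}^n\frac{u-b_l}{v-b_l},$$ where $\mathcal{C}_{\mathbf{b}}$ is a closed contour encircling $b_1,\ldots,b_n$ in the anticlockwise direction, and $\mathcal{L}$ is a path from $-i\infty$ to $i\infty$ not crossing $\mathcal{C}_{\mathbf{b}}$.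
   Context: $\Delta_n(x)=\prod_{1\le i<j\le n}(x_j-x_i)$. For $(y,v)\in(\mathbb{R}\setminus\{0\})\times\mathbb{C}$, $$g_M(y,v)=\int_0^\infty\frac{dt_1}{t_1}\cdots\int_0^\infty\frac{dt_M}{t_M}\,\prod_{l=1}^M t_l^{\nu_l}e^{-t_l}\,\exp\Big\{-\frac{y^2}{(t_1\cdots t_M)^2}+\frac{2yv}{t_1\cdots t_M}\Big\},$$ and for $(x,u)\in\mathbb{R}\times\mathbb{C}$, $$f_M(x,u)=\frac{1}{(2\pi i)^M}\int_{\mathcal{C}_0}\frac{ds_1}{s_1}\cdots\int_{\mathcal{C}_0}\frac{ds_M}{s_M}\,\prod_{l=1}^M s_l^{-\nu_l}e^{s_l}\,\exp\Big\{\frac{x^2}{(s_1\cdots s_M)^2}-\frac{2xu}{s_1\cdots s_M}\Big\},$$ where $\mathcal{C}_0$ is an anticlockwise loop around the origin. By convention $f_0(x,u)=e^{x^2-2xu}$ and $g_0(y,v)=e^{-y^2+2yv}$. That $K_n$ is a correlation kernel of the process means that for every $1\le k\le n$ the $k$-point correlation function is $\det[K_n(\mathbf{b};x_i,x_j)]_{i,j=1}^k$. (The density above is that of the non-zero eigenvalues of $G_M^*\cdots G_1^*HG_1\cdots G_M$, with $G_m$ independent standard complex Gaussian matrices of size $(\nu_{m-1}+n)\times(\nu_m+n)$, $\nu_0=0$, and $H$ an independent $n\times n$ Hermitian matrix with density proportional to $e^{-\mathrm{tr}(H-B)^2}$, where $B$ is Hermitian with eigenvalues $b_1,\dots,b_n$.)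 *)

theory Defs
  imports
    "HOL-Complex_Analysis.Complex_Analysis"
    "Jordan_Normal_Form.Determinant"
begin

text \<open>
  All finite families are indexed from 0: the parameters \<open>\<nu>\<^sub>1, \<dots>, \<nu>\<^sub>M\<close> are the values of
  \<open>\<nu>\<close> on \<open>{..<M}\<close>, and \<open>b\<^sub>1, \<dots>, b\<^sub>n\<close> and \<open>x\<^sub>1, \<dots>, x\<^sub>n\<close> are the values of \<open>b\<close> and \<open>x\<close>
  on \<open>{..<n}\<close>.
\<close>

definition vandermonde :: "nat \<Rightarrow> (nat \<Rightarrow> real) \<Rightarrow> real" where
  "vandermonde n x = (\<Prod>j<n. \<Prod>i<j. (x j - x i))"

text \<open>
  \<open>iterated_integral I m F t\<close> applies the integral operator \<open>I\<close> in each of the variables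
  \<open>t 0, \<dots>, t (m - 1)\<close>, with \<open>t 0\<close> outermost; the values of \<open>t\<close> on \<open>{..<m}\<close> are overwritten.
\<close>

primrec iterated_integral ::
  "(('a \<Rightarrow> complex) \<Rightarrow> complex) \<Rightarrow> nat \<Rightarrow> ((nat \<Rightarrow> 'a) \<Rightarrow> complex) \<Rightarrow> (nat \<Rightarrow> 'a) \<Rightarrow> complex" where
  "iterated_integral I 0 F t = F t"
| "iterated_integral I (Suc m) F t = iterated_integral I m (\<lambda>t. I (\<lambda>a. F (t(m := a)))) t"

definition g_fun :: "nat \<Rightarrow> (nat \<Rightarrow> nat) \<Rightarrow> real \<Rightarrow> complex \<Rightarrow> complex" where
  "g_fun M \<nu> y v =
     iterated_integral (\<lambda>h. LBINT t:{0<..}. h t / of_real t) M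
       (\<lambda>t. (\<Prod>l<M. of_real (t l ^ \<nu> l * exp (- t l))) *
            exp (- (of_real y)\<^sup>2 / (of_real (\<Prod>l<M. t l))\<^sup>2
                 + 2 * of_real y * v / of_real (\<Prod>l<M. t l)))
       (\<lambda>_. 0)"

definition f_fun ::
  "(real \<Rightarrow> complex) \<Rightarrow> nat \<Rightarrow> (nat \<Rightarrow> nat) \<Rightarrow> real \<Rightarrow> complex \<Rightarrow> complex" where
  "f_fun C\<^sub>0 M \<nu> x u =
     1 / (2 * of_real pi * \<i>) ^ M *
     iterated_integral (\<lambda>h. contour_integral C\<^sub>0 (\<lambda>s. h s / s)) M
       (\<lambda>s. (\<Prod>l<M. s l powi (- int (\<nu> l)) * exp (s l)) *
            exp ((of_real x)\<^sup>2 / (\<Prod>l<M. s l)\<^sup>2 - 2 * of_real x * u / (\<Prod>l<M. s l)))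
       (\<lambda>_. 0)"

definition encircles_anticlockwise :: "(real \<Rightarrow> complex) \<Rightarrow> complex set \<Rightarrow> bool" where
  "encircles_anticlockwise C A \<longleftrightarrow>
     valid_path C \<and> pathfinish C = pathstart C \<and> path_image C \<inter> A = {} \<and>
     (\<forall>a\<in>A. winding_number C a = 1)"

text \<open>
  A path from \<open>-\<i>\<infinity>\<close> to \<open>\<i>\<infinity>\<close> is parametrised by the whole real line; its two ends are
  asymptotic to the negative and the positive imaginary direction.
\<close>

definition path_between_imaginary_infinities :: "(real \<Rightarrow> complex) \<Rightarrow> bool" where
  "path_between_imaginary_infinities L \<longleftrightarrow>
     (\<forall>a b. L piecewise_C1_differentiable_on {a..b}) \<and>
     filterlim (\<lambda>t. Im (L t)) at_bot at_bot \<and> filterlim (\<lambda>t. Im (L t)) at_top at_top \<and>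
     ((\<lambda>t. Re (L t) / Im (L t)) \<longlongrightarrow> 0) at_bot \<and> ((\<lambda>t. Re (L t) / Im (L t)) \<longlongrightarrow> 0) at_top"

text \<open>
  The Henstock--Kurzweil integral over \<open>UNIV\<close> is the limit of the integrals over \<open>{a..b}\<close>
  as \<open>a\<close> and \<open>b\<close> tend independently to \<open>-\<infinity>\<close> and \<open>\<infinity>\<close>, so this is the improper contour
  integral along \<open>L\<close>.
\<close>

definition infinite_contour_integral :: "(real \<Rightarrow> complex) \<Rightarrow> (complex \<Rightarrow> complex) \<Rightarrow> complex" where
  "infinite_contour_integral L F = integral UNIV (\<lambda>t. F (L t) * vector_derivative L (at t))"

definition K_kernel ::
  "(real \<Rightarrow> complex) \<Rightarrow> (real \<Rightarrow> complex) \<Rightarrow> (real \<Rightarrow> complex) \<Rightarrow> nat \<Rightarrow> nat \<Rightarrow> (nat \<Rightarrow> nat) \<Rightarrow>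
   (nat \<Rightarrow> real) \<Rightarrow> real \<Rightarrow> real \<Rightarrow> complex" where
  "K_kernel C\<^sub>0 C\<^sub>b L n M \<nu> b x y =
     1 / (2 * (of_real pi * \<i>)\<^sup>2) *
     infinite_contour_integral L (\<lambda>u. contour_integral C\<^sub>b (\<lambda>v.
       f_fun C\<^sub>0 M \<nu> x u * g_fun M \<nu> y v * exp (u\<^sup>2 - v\<^sup>2) * (1 / (u - v)) *
       (\<Prod>l<n. (u - of_real (b l)) / (v - of_real (b l)))))"

definition biorthogonal_weight ::
  "nat \<Rightarrow> nat \<Rightarrow> (nat \<Rightarrow> nat) \<Rightarrow> (nat \<Rightarrow> real) \<Rightarrow> (nat \<Rightarrow> real) \<Rightarrow> complex" where
  "biorthogonal_weight n M \<nu> b x =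
     of_real (vandermonde n x) *
     Determinant.det (mat n n (\<lambda>(i, j). g_fun M \<nu> (x i) (of_real (b j))))"

text \<open>
  When some of the \<open>b j\<close> coincide the determinant vanishes identically. As the density is only
  specified up to a factor independent of \<open>x\<close>, one divides by \<open>vandermonde n b'\<close> and lets
  pairwise distinct \<open>b'\<close> tend to \<open>b\<close>. The limit is in the product topology on sequences;
  the entries of \<open>b'\<close> outside \<open>{..<n}\<close> play no role.
\<close>

definition ensemble_weight ::
  "nat \<Rightarrow> nat \<Rightarrow> (nat \<Rightarrow> nat) \<Rightarrow> (nat \<Rightarrow> real) \<Rightarrow> (nat \<Rightarrow> real) \<Rightarrow> complex" where
  "ensemble_weight n M \<nu> b x =
     (if inj_on b {..<n} then biorthogonal_weight n M \<nu> b x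
      else Lim (at b within {b'. inj_on b' {..<n}})
             (\<lambda>b'. biorthogonal_weight n M \<nu> b' x / of_real (vandermonde n b')))"

definition punctured_lebesgue :: "nat set \<Rightarrow> (nat \<Rightarrow> real) measure" where
  "punctured_lebesgue I = PiM I (\<lambda>_. restrict_space lborel (- {0}))"

definition joint_pdf :: "nat \<Rightarrow> ((nat \<Rightarrow> real) \<Rightarrow> real) \<Rightarrow> bool" where
  "joint_pdf n p \<longleftrightarrow>
     p \<in> borel_measurable (punctured_lebesgue {..<n}) \<and>
     (\<forall>x\<in>space (punctured_lebesgue {..<n}). 0 \<le> p x) \<and>
     (\<integral>\<^sup>+x. ennreal (p x) \<partial>punctured_lebesgue {..<n}) = 1"

text \<open>
  The \<open>k\<close>-point correlation function
  \<open>n! / (n - k)! \<integral> p (x\<^sub>1, \<dots>, x\<^sub>n) dx\<^bsub>k+1\<^esub> \<cdots> dx\<^sub>n\<close> of \<open>n\<close> points with symmetric joint density \<open>p\<close>.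
\<close>

definition correlation_function ::
  "nat \<Rightarrow> ((nat \<Rightarrow> real) \<Rightarrow> real) \<Rightarrow> nat \<Rightarrow> (nat \<Rightarrow> real) \<Rightarrow> real" where
  "correlation_function n p k x =
     fact n / fact (n - k) *
     (LINT z|punctured_lebesgue {k..<n}. p (merge {..<k} {k..<n} (x, z)))"

definition determinantal_with_kernel ::
  "nat \<Rightarrow> ((nat \<Rightarrow> real) \<Rightarrow> real) \<Rightarrow> (real \<Rightarrow> real \<Rightarrow> complex) \<Rightarrow> bool" where
  "determinantal_with_kernel n p K \<longleftrightarrow>
     (\<forall>k\<in>{1..n}. \<forall>x\<in>space (punctured_lebesgue {..<k}).
        complex_of_real (correlation_function n p k x) =
        Determinant.det (mat k k (\<lambda>(i, j). K (x i) (x j))))"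

end

theory Submission
  imports Defs "HOL-Probability.Distributions" "HOL-Real_Asymp.Real_Asymp"
begin

text \<open>
  Let \<open>\<omega>\<^sub>j(u) = \<Prod>l<j. (u - b l)\<close>. The telescoping identity
  \<open>\<omega>\<^sub>n(u) / (\<omega>\<^sub>n(v) (u - v)) = 1 / (u - v) + (\<Sum>j<n. \<omega>\<^sub>j(u) / \<omega>\<^bsub>j+1\<^esub>(v))\<close> splits the kernel into
  \<open>\<Sum>j<n. P\<^sub>j(x) Q\<^sub>j(y)\<close>: the term \<open>1 / (u - v)\<close> drops out because \<open>L\<close> is connected and unbounded,
  hence lies outside \<open>C\<^sub>b\<close>. Here \<open>Q\<^sub>j\<close> is the divided difference at \<open>b 0, \<dots>, b j\<close> of
  \<open>v \<mapsto> g(y, v) exp (- v\<^sup>2)\<close>, up to the factor \<open>1 / sqrt pi\<close>, and \<open>P\<^sub>j\<close> is the integral of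
  \<open>f(x, u) exp (u\<^sup>2) \<omega>\<^sub>j(u)\<close> along \<open>L\<close>, up to a constant, a polynomial in \<open>x\<close> of degree \<open>j\<close>.

  With \<open>G\<^sub>k = \<Prod>l<M. (\<nu> l + k)!\<close>, the loops in \<open>f\<close> divide the coefficient of \<open>x\<^sup>k\<close> by \<open>G\<^sub>k\<close>, whereas the
  \<open>k\<close>-th moment in \<open>y\<close> of \<open>g\<close> is \<open>G\<^sub>k\<close> times its value for \<open>M = 0\<close>. So the pairing
  \<open>\<integral> P\<^sub>i Q\<^sub>j\<close> does not depend on \<open>M\<close>, and for \<open>M = 0\<close> Hermite duality turns it into the divided
  difference of \<open>\<omega>\<^sub>i\<close> at \<open>b 0, \<dots>, b j\<close>, which is \<open>\<delta>\<^sub>i\<^sub>j\<close>. Newton interpolation shows that the weight is a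
  constant multiple of \<open>det P\<^sub>j(x\<^sub>i) det Q\<^sub>j(x\<^sub>i)\<close>; since divided differences are continuous in the
  nodes, this persists when some \<open>b j\<close> coincide. The correlation functions follow by integrating
  out one point at a time (Dyson's argument), which also fixes the normalisation.
\<close>

section \<open>Gaussian integrals along paths between the imaginary infinities\<close>

text \<open>Two obstacles shape the development. A path that is merely asymptotic to the imaginary
  directions carries no bound on its speed, so integrals along it are evaluated through primitives,
  and the factors beside \<open>exp (u^2)\<close> may grow at most exponentially in
  \<open>norm u\<close>; hence \<open>exp_type\<close>. On the other side, the convolutions in
  \<open>g_fun\<close> destroy Gaussian bounds in \<open>y\<close>. So \<open>g_fun\<close> is
  treated as a power series in \<open>v\<close> whose coefficients lie in a class stable under each
  convolution, and contour integrals act on it coefficient by coefficient.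

  The duality works as follows. Averaging \<open>u ^ j\<close> against the Taylor coefficients of
  \<open>exp (x^2 - 2 x u)\<close> in \<open>x\<close> yields the coefficients of the monic Hermite
  polynomial of degree \<open>j\<close>. Its moments of order \<open>m\<close> against
  \<open>exp (- z^2)\<close>, multiplied by \<open>2 ^ m / m!\<close>, are \<open>sqrt pi\<close>
  times the Taylor coefficients of \<open>v ^ j * exp (v^2)\<close>. The factor
  \<open>exp (- v^2)\<close> of the kernel cancels exactly this exponential, and a functional of the
  polynomial \<open>v ^ j\<close> remains.\<close>

definition exp_type :: "(complex \<Rightarrow> complex) \<Rightarrow> bool" where
  "exp_type F \<longleftrightarrow> F holomorphic_on UNIV \<and> (\<exists>C c. \<forall>u. norm (F u) \<le> C * exp (c * norm u))"

lemma exp_typeE: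
  assumes "exp_type F"
  obtains C c where "C > 0" "c > 0" "\<And>u. norm (F u) \<le> C * exp (c * norm u)"
proof -
  obtain C c where *: "\<And>u. norm (F u) \<le> C * exp (c * norm u)"
    using assms unfolding exp_type_def by blast
  have "norm (F u) \<le> (\<bar>C\<bar> + 1) * exp ((\<bar>c\<bar> + 1) * norm u)" for u
    by (rule order_trans[OF *]) (intro mult_mono, auto intro: mult_right_mono)
  then show ?thesis
    by (intro that[of "\<bar>C\<bar> + 1" "\<bar>c\<bar> + 1"]) auto
qed

lemma exp_type_mult:
  assumes "exp_type F" "exp_type G"
  shows "exp_type (\<lambda>u. F u * G u)"
proof -
  obtain C c where F: "C > 0" "c > 0" "\<And>u. norm (F u) \<le> C * exp (c * norm u)"
    using exp_typeE[OF assms(1)] by metis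
  obtain D d where G: "D > 0" "d > 0" "\<And>u. norm (G u) \<le> D * exp (d * norm u)"
    using exp_typeE[OF assms(2)] by metis
  have "norm (F u * G u) \<le> (C * D) * exp ((c + d) * norm u)" for u
  proof -
    have "norm (F u * G u) \<le> (C * exp (c * norm u)) * (D * exp (d * norm u))"
      unfolding norm_mult using F G by (intro mult_mono) auto
    then show ?thesis by (simp add: exp_add algebra_simps)
  qed
  with assms show ?thesis
    unfolding exp_type_def by (auto intro!: holomorphic_intros)
qed

lemma exp_type_add:
  assumes "exp_type F" "exp_type G"
  shows "exp_type (\<lambda>u. F u + G u)"
proof -
  obtain C c where F: "C > 0" "c > 0" "\<And>u. norm (F u) \<le> C * exp (c * norm u)"
    using exp_typeE[OF assms(1)] by metis
  obtain D d where G: "D > 0" "d > 0" "\<And>u. norm (G u) \<le> D * exp (d * norm u)"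
    using exp_typeE[OF assms(2)] by metis
  have "norm (F u + G u) \<le> (C + D) * exp ((c + d) * norm u)" for u
  proof -
    have "norm (F u + G u) \<le> C * exp (c * norm u) + D * exp (d * norm u)"
      using F G by (intro norm_triangle_mono)
    also have "\<dots> \<le> C * exp ((c + d) * norm u) + D * exp ((c + d) * norm u)"
      using F G by (intro add_mono mult_left_mono) (auto intro!: mult_right_mono)
    finally show ?thesis by (simp add: algebra_simps)
  qed
  with assms show ?thesis
    unfolding exp_type_def by (auto intro!: holomorphic_intros)
qed

lemma exp_type_const: "exp_type (\<lambda>_. c)"
  unfolding exp_type_def by (intro conjI exI[of _ "norm c"] exI[of _ 0]) (auto intro!: holomorphic_intros)

lemma exp_type_id: "exp_type (\<lambda>u. u)"
  unfolding exp_type_def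
  by (intro conjI exI[of _ 1] allI)
    (auto intro!: holomorphic_intros intro: order_trans[OF _ exp_ge_add_one_self])

lemma exp_type_power: "exp_type (\<lambda>u. u ^ k)"
  by (induction k) (auto intro: exp_type_const exp_type_mult exp_type_id)

lemma exp_type_sum: "(\<And>i. i \<in> I \<Longrightarrow> exp_type (F i)) \<Longrightarrow> exp_type (\<lambda>u. \<Sum>i\<in>I. F i u)"
  by (induction I rule: infinite_finite_induct) (auto intro: exp_type_const exp_type_add)

lemma exp_type_prod: "(\<And>i. i \<in> I \<Longrightarrow> exp_type (F i)) \<Longrightarrow> exp_type (\<lambda>u. \<Prod>i\<in>I. F i u)"
  by (induction I rule: infinite_finite_induct) (auto intro: exp_type_const exp_type_mult)

section \<open>Gaussian averages over the imaginary axis\<close>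

lemma has_bochner_integral_gaussian:
  "has_bochner_integral lborel (\<lambda>x::real. exp (- x\<^sup>2)) (sqrt pi)"
  using has_bochner_integral_even_function[OF gaussian_moment_0] by simp

lemma gaussian_exp_integrable:
  fixes c :: real
  shows "integrable lborel (\<lambda>x::real. exp (c * \<bar>x\<bar> - x\<^sup>2))"
proof -
  \<comment> \<open>Completing the square in \<open>c * x - x^2\<close> and in
    \<open>- c * x - x^2\<close>; the two shifted Gaussians take care of the two signs of
    \<open>x\<close>.\<close>
  have bound: "exp (c * \<bar>x\<bar> - x\<^sup>2) \<le> exp (c\<^sup>2 / 4) * (exp (- (x - c/2)\<^sup>2) + exp (- (x + c/2)\<^sup>2))" for x :: real
  proof -
    have 1: "exp (c\<^sup>2 / 4) * exp (- (x - c/2)\<^sup>2) = exp (c * x - x\<^sup>2)"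
      unfolding exp_add[symmetric] by (rule arg_cong[of _ _ exp]) (simp add: power2_eq_square field_simps)
    have 2: "exp (c\<^sup>2 / 4) * exp (- (x + c/2)\<^sup>2) = exp (- c * x - x\<^sup>2)"
      unfolding exp_add[symmetric] by (rule arg_cong[of _ _ exp]) (simp add: power2_eq_square field_simps)
    show ?thesis
      unfolding distrib_left 1 2 by (cases "x \<ge> 0") (auto simp: add_increasing add_increasing2)
  qed
  have i: "integrable lborel (\<lambda>x::real. exp (- (x + a)\<^sup>2))" for a
  proof -
    have "integrable lborel (\<lambda>x::real. exp (- (a + 1 * x)\<^sup>2))"
      by (rule lborel_integrable_real_affine)
        (use has_bochner_integral_gaussian in \<open>auto simp: integrable.simps\<close>)
    then show ?thesis by (simp add: add.commute)
  qed
  have "integrable lborel (\<lambda>x. exp (c\<^sup>2 / 4) * (exp (- (x - c/2)\<^sup>2) + exp (- (x + c/2)\<^sup>2)))"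
    using i[of "- (c/2)"] i[of "c/2"] by (intro integrable_mult_right Bochner_Integration.integrable_add) simp_all
  then show ?thesis
    by (rule Bochner_Integration.integrable_bound) (use bound in auto)
qed

lemma exp_type_gaussian_integrable:
  assumes "exp_type F"
  shows "integrable lborel (\<lambda>t::real. of_real (exp (- t\<^sup>2)) * F (\<i> * of_real t))"
proof -
  obtain C c where C: "C > 0" "c > 0" "\<And>u. norm (F u) \<le> C * exp (c * norm u)"
    using exp_typeE[OF assms] by metis
  have "continuous_on UNIV F"
    using assms unfolding exp_type_def by (auto intro: holomorphic_on_imp_continuous_on)
  then have "continuous_on UNIV (\<lambda>t::real. of_real (exp (- t\<^sup>2)) * F (\<i> * of_real t))"
    by (auto intro!: continuous_intros continuous_on_compose2[of UNIV F])
  then have m: "(\<lambda>t::real. of_real (exp (- t\<^sup>2)) * F (\<i> * of_real t)) \<in> borel_measurable lborel"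
    using borel_measurable_continuous_onI by auto
  have "integrable lborel (\<lambda>t. C * exp (c * \<bar>t\<bar> - t\<^sup>2))"
    by (intro integrable_mult_right gaussian_exp_integrable)
  then show ?thesis
  proof (rule Bochner_Integration.integrable_bound[OF _ m], intro AE_I2)
    fix t :: real
    have "exp (- t\<^sup>2) * norm (F (\<i> * of_real t)) \<le> exp (- t\<^sup>2) * (C * exp (c * \<bar>t\<bar>))"
      using C(3)[of "\<i> * of_real t"] by (intro mult_left_mono) (auto simp: norm_mult)
    also have "\<dots> = norm (C * exp (c * \<bar>t\<bar> - t\<^sup>2))"
      using C(1) by (simp add: exp_diff exp_minus field_simps)
    finally show "norm (of_real (exp (- t\<^sup>2)) * F (\<i> * of_real t)) \<le> norm (C * exp (c * \<bar>t\<bar> - t\<^sup>2))"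
      by (simp only: norm_mult norm_of_real abs_exp_cancel)
  qed
qed

text \<open>Since \<open>exp (u^2) = exp (- t^2)\<close> at \<open>u = \<i> * t\<close>, this is the
  integral of \<open>exp (u^2) * F u\<close> up the imaginary axis, divided by
  \<open>\<i> * sqrt pi\<close> so that constants are their own mean.\<close>

definition gauss_mean :: "(complex \<Rightarrow> complex) \<Rightarrow> complex" where
  "gauss_mean F = (LINT t|lborel. of_real (exp (- t\<^sup>2)) * F (\<i> * of_real t)) / of_real (sqrt pi)"

lemma gauss_mean_cmult: "gauss_mean (\<lambda>u. c * F u) = c * gauss_mean F"
proof -
  have "(\<lambda>t. of_real (exp (- t\<^sup>2)) * (c * F (\<i> * of_real t))) =
        (\<lambda>t. c * (of_real (exp (- t\<^sup>2)) * F (\<i> * of_real t)))"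
    by (auto simp: algebra_simps)
  then show ?thesis unfolding gauss_mean_def by simp
qed

lemma gauss_mean_add:
  assumes "exp_type F" "exp_type G"
  shows "gauss_mean (\<lambda>u. F u + G u) = gauss_mean F + gauss_mean G"
  using exp_type_gaussian_integrable[OF assms(1)] exp_type_gaussian_integrable[OF assms(2)]
  unfolding gauss_mean_def by (simp add: distrib_left add_divide_distrib)

lemma gauss_mean_sum:
  assumes "\<And>i. i \<in> I \<Longrightarrow> exp_type (F i)"
  shows "gauss_mean (\<lambda>u. \<Sum>i\<in>I. F i u) = (\<Sum>i\<in>I. gauss_mean (F i))"
  using assms
proof (induction I rule: infinite_finite_induct)
  case (insert x A)
  then show ?case by (simp add: gauss_mean_add exp_type_sum)
qed (auto simp: gauss_mean_def)

lemma gauss_mean_one: "gauss_mean (\<lambda>_. 1) = 1"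
proof -
  have "(LINT t|lborel. complex_of_real (exp (- t\<^sup>2))) = of_real (sqrt pi)"
    using has_bochner_integral_gaussian
    by (metis has_bochner_integral_integral_eq integral_complex_of_real)
  then show ?thesis unfolding gauss_mean_def by simp
qed

text \<open>The integrand has an entire primitive, and on horizontal segments inside the sector
  \<open>\<bar>Re u\<bar> \<le> \<bar>Im u\<bar> / 2\<close> the primitive varies by a quantity tending to 0; so the path may be
  replaced by the imaginary axis although the integral along it need not converge absolutely.\<close>

lemma has_integral_gaussian_along_path:
  assumes L: "path_between_imaginary_infinities L" and F: "exp_type F"
  shows "((\<lambda>t. exp ((L t)\<^sup>2) * F (L t) * vector_derivative L (at t))
           has_integral (\<i> * of_real (sqrt pi) * gauss_mean F)) UNIV"
proof -
  let ?int = "\<lambda>t. exp ((L t)\<^sup>2) * F (L t) * vector_derivative L (at t)"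
  let ?ax = "\<lambda>t::real. exp ((\<i> * of_real t)\<^sup>2) * F (\<i> * of_real t) * \<i>"
  obtain C c where C: "C > 0" "c > 0" "\<And>u. norm (F u) \<le> C * exp (c * norm u)"
    using exp_typeE[OF F] by metis
  have hol: "(\<lambda>u. exp (u\<^sup>2) * F u) holomorphic_on UNIV"
    using F unfolding exp_type_def by (auto intro!: holomorphic_intros)
  obtain \<Phi> where \<Phi>: "\<And>u. (\<Phi> has_field_derivative exp (u\<^sup>2) * F u) (at u)"
    by (rule holomorphic_convex_primitive'[OF convex_UNIV open_UNIV hol]) auto
  have \<Phi>cont: "continuous_on S \<Phi>" for S
    by (meson DERIV_isCont \<Phi> continuous_at_imp_continuous_on)
  \<comment> \<open>Piecewise smoothness suffices: the composite with the primitive is continuous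
    throughout, and the finitely many points without a derivative may be left out.\<close>
  have FTC: "((\<lambda>t. exp ((\<gamma> t)\<^sup>2) * F (\<gamma> t) * vector_derivative \<gamma> (at t)) has_integral
      \<Phi> (\<gamma> b) - \<Phi> (\<gamma> a)) {a..b}"
    if "\<gamma> piecewise_C1_differentiable_on {a..b}" "a \<le> b" for \<gamma> a b
  proof -
    obtain S where S: "continuous_on {a..b} \<gamma>" "finite S" "\<gamma> C1_differentiable_on ({a..b} - S)"
      using \<open>\<gamma> piecewise_C1_differentiable_on {a..b}\<close> unfolding piecewise_C1_differentiable_on_def by blast
    have "((\<lambda>t. \<Phi> (\<gamma> t)) has_vector_derivative exp ((\<gamma> t)\<^sup>2) * F (\<gamma> t) * vector_derivative \<gamma> (at t)) (at t)"
      if "t \<in> {a<..<b} - S" for t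
    proof -
      have "(\<gamma> has_vector_derivative vector_derivative \<gamma> (at t)) (at t)"
        using S(3) that unfolding C1_differentiable_on_def
        by (metis DiffE DiffI greaterThanLessThan_iff atLeastAtMost_iff less_imp_le vector_derivative_at)
      then show ?thesis
        using field_vector_diff_chain_at[OF _ \<Phi>, of \<gamma> "vector_derivative \<gamma> (at t)" t]
        by (simp add: o_def mult.commute)
    qed
    moreover have "continuous_on {a..b} (\<lambda>t. \<Phi> (\<gamma> t))"
      by (rule continuous_on_compose2[OF \<Phi>cont S(1) order_refl])
    ultimately show ?thesis
      by (rule fundamental_theorem_of_calculus_interior_strong[OF S(2) \<open>a \<le> b\<close>])
  qed
  define I where "I = \<i> * of_real (sqrt pi) * gauss_mean F"
  have Iax: "(?ax has_integral I) UNIV"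
  proof -
    have "((\<lambda>t. of_real (exp (- t\<^sup>2)) * F (\<i> * of_real t)) has_integral
        (LINT t|lborel. of_real (exp (- t\<^sup>2)) * F (\<i> * of_real t))) UNIV"
      using exp_type_gaussian_integrable[OF F] by (rule has_integral_integral_lborel)
    from has_integral_mult_left[OF this, of \<i>] show ?thesis
      unfolding I_def gauss_mean_def
      by (simp add: power_mult_distrib exp_of_real mult_ac flip: of_real_power of_real_minus)
  qed
  have ax: "(?ax has_integral
      \<Phi> (\<i> * of_real b) - \<Phi> (\<i> * of_real a)) {a..b}" if "a \<le> b" for a b :: real
  proof -
    have "(\<lambda>t. \<i> * complex_of_real t) C1_differentiable_on {a..b}"
      by (auto simp: C1_differentiable_on_def intro!: exI[of _ "\<lambda>_. \<i>"] derivative_eq_intros)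
    then have "((\<lambda>t. \<i> * complex_of_real t)) piecewise_C1_differentiable_on {a..b}"
      by (rule C1_differentiable_imp_piecewise)
    moreover have "vector_derivative (\<lambda>t. \<i> * complex_of_real t) (at t) = \<i>" for t
      by (rule vector_derivative_at) (auto intro!: derivative_eq_intros)
    ultimately show ?thesis using FTC[of "\<lambda>t. \<i> * of_real t" a b] that by simp
  qed
  \<comment> \<open>The error made by moving a point of the path horizontally onto the imaginary
    axis.\<close>
  define \<delta> where "\<delta> u = \<Phi> u - \<Phi> (\<i> * of_real (Im u))" for u
  \<comment> \<open>On the segment \<open>Im w = Im u\<close> and
    \<open>(Re w)^2 <= (Im u)^2 / 4\<close>, so \<open>Re (w^2) <= - 3/4 * (Im u)^2\<close>. With
    \<open>norm w <= 2 * \<bar>Im u\<bar>\<close> the factor \<open>F\<close> contributes only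
    \<open>exp (2 * c * \<bar>Im u\<bar>)\<close>, and the Gaussian wins.\<close>
  have \<delta>_bound: "norm (\<delta> u) \<le> C * \<bar>Im u\<bar> * exp (2 * c * \<bar>Im u\<bar> - 3/4 * (Im u)\<^sup>2)"
    if u: "\<bar>Re u\<bar> \<le> \<bar>Im u\<bar> / 2" for u
  proof -
    let ?y = "Im u" and ?B = "C * exp (2 * c * \<bar>Im u\<bar> - 3/4 * (Im u)\<^sup>2)"
    have "norm (\<Phi> u - \<Phi> (\<i> * of_real ?y)) \<le> ?B * norm (u - \<i> * of_real ?y)"
    proof (rule field_differentiable_bound[of "closed_segment (\<i> * of_real ?y) u" _ "\<lambda>w. exp (w\<^sup>2) * F w"])
      fix w assume w: "w \<in> closed_segment (\<i> * of_real ?y) u"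
      then obtain s where s: "0 \<le> s" "s \<le> 1" "w = (1 - s) *\<^sub>R (\<i> * of_real ?y) + s *\<^sub>R u"
        by (auto simp: in_segment)
      have im: "Im w = ?y" and re: "Re w = s * Re u"
        by (simp_all add: s(3) algebra_simps)
      have "\<bar>Re w\<bar> \<le> \<bar>Re u\<bar>"
        unfolding re abs_mult using s mult_left_le_one_le[of "\<bar>Re u\<bar>" "\<bar>s\<bar>"] by auto
      then have rw: "\<bar>Re w\<bar> \<le> \<bar>?y\<bar> / 2" using u by simp
      have "norm w \<le> \<bar>Re w\<bar> + \<bar>Im w\<bar>" by (rule cmod_le)
      then have nw: "norm w \<le> 2 * \<bar>?y\<bar>" using rw im by simp
      have "(Re w)\<^sup>2 \<le> (\<bar>?y\<bar> / 2)\<^sup>2"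
        using rw power_mono[of "\<bar>Re w\<bar>" "\<bar>?y\<bar> / 2" 2] by simp
      then have "Re (w\<^sup>2) \<le> - 3/4 * ?y\<^sup>2"
        using im by (simp add: power2_eq_square field_simps)
      then have "norm (exp (w\<^sup>2)) \<le> exp (- 3/4 * ?y\<^sup>2)" by simp
      moreover have "norm (F w) \<le> C * exp (2 * c * \<bar>?y\<bar>)"
      proof (rule order_trans[OF C(3)])
        have "c * norm w \<le> 2 * c * \<bar>?y\<bar>"
          using mult_left_mono[OF nw, of c] C(2) by (simp add: mult_ac)
        then show "C * exp (c * norm w) \<le> C * exp (2 * c * \<bar>?y\<bar>)" using C(1) by simp
      qed
      ultimately have "norm (exp (w\<^sup>2) * F w) \<le> exp (- 3/4 * ?y\<^sup>2) * (C * exp (2 * c * \<bar>?y\<bar>))"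
        unfolding norm_mult by (intro mult_mono) auto
      also have "\<dots> = ?B" by (simp add: mult.left_commute flip: exp_add)
      finally show "norm (exp (w\<^sup>2) * F w) \<le> ?B" .
      show "(\<Phi> has_field_derivative exp (w\<^sup>2) * F w) (at w within closed_segment (\<i> * of_real ?y) u)"
        using \<Phi> has_field_derivative_at_within by blast
    qed auto
    also have "norm (u - \<i> * of_real ?y) = \<bar>Re u\<bar>"
      by (simp add: cmod_def)
    also have "?B * \<bar>Re u\<bar> \<le> ?B * \<bar>?y\<bar>" using u C(1) by (intro mult_left_mono) auto
    finally show ?thesis unfolding \<delta>_def by (simp add: mult_ac)
  qed
  have small: "((\<lambda>y::real. C * \<bar>y\<bar> * exp (2 * c * \<bar>y\<bar> - 3/4 * y\<^sup>2)) \<longlongrightarrow> 0) at_top"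
      "((\<lambda>y::real. C * \<bar>y\<bar> * exp (2 * c * \<bar>y\<bar> - 3/4 * y\<^sup>2)) \<longlongrightarrow> 0) at_bot"
    using C(1,2) by real_asymp+
  have \<delta>_lim: "((\<lambda>t. \<delta> (L t)) \<longlongrightarrow> 0) G"
    if G: "filterlim (\<lambda>t. Im (L t)) G' G" "((\<lambda>t. Re (L t) / Im (L t)) \<longlongrightarrow> 0) G"
      and G': "((\<lambda>y::real. C * \<bar>y\<bar> * exp (2 * c * \<bar>y\<bar> - 3/4 * y\<^sup>2)) \<longlongrightarrow> 0) G'"
        "eventually (\<lambda>y. y \<noteq> 0) G'" for G G'
  proof (rule Lim_null_comparison[OF _ filterlim_compose[OF G'(1) G(1)]])
    have "eventually (\<lambda>t. dist (Re (L t) / Im (L t)) 0 < 1/2) G"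
      using G(2) by (rule tendstoD) simp
    \<comment> \<open>A quotient with denominator 0 is 0 and would say nothing about
      \<open>Re (L t)\<close>.\<close>
    moreover have "eventually (\<lambda>t. Im (L t) \<noteq> 0) G"
      using eventually_compose_filterlim[OF G'(2) G(1)] .
    ultimately show "eventually (\<lambda>t. norm (\<delta> (L t)) \<le>
        C * \<bar>Im (L t)\<bar> * exp (2 * c * \<bar>Im (L t)\<bar> - 3/4 * (Im (L t))\<^sup>2)) G"
    proof eventually_elim
      case (elim t)
      then have "\<bar>Re (L t)\<bar> \<le> \<bar>Im (L t)\<bar> / 2"
        by (simp add: abs_divide divide_less_eq split: if_splits)
      then show ?case by (rule \<delta>_bound)
    qed
  qed
  have Lp: "L piecewise_C1_differentiable_on {a..b}" for a b
    using L unfolding path_between_imaginary_infinities_def by blast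
  have "((\<lambda>t. \<delta> (L t)) \<longlongrightarrow> 0) at_top" "((\<lambda>t. \<delta> (L t)) \<longlongrightarrow> 0) at_bot"
    using L small unfolding path_between_imaginary_infinities_def
    by (auto intro!: \<delta>_lim[of at_top at_top] \<delta>_lim[of at_bot at_bot]
        eventually_at_top_not_equal eventually_at_bot_not_equal)
  note \<delta>lims = this
  show ?thesis
    unfolding I_def[symmetric] has_integral_alt'
  proof (intro conjI allI impI)
    fix a b :: real
    show "(\<lambda>t. if t \<in> UNIV then ?int t else 0)
        integrable_on cbox a b"
      using FTC[OF Lp, of a b] by (cases "a \<le> b") (auto simp: integrable_on_def)
  next
    fix e :: real assume "e > 0"
    then have "e / 3 > 0" by simp
    have "\<forall>e>0. \<exists>B>0. \<forall>a b. ball 0 B \<subseteq> cbox a b \<longrightarrow>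
        norm (integral (cbox a b) ?ax - I) < e"
      using conjunct2[OF Iax[unfolded has_integral_alt']] by (simp only: UNIV_I if_True)
    then obtain B where B: "B > 0" "\<And>a b. ball 0 B \<subseteq> cbox a b \<Longrightarrow>
        norm (integral (cbox a b) ?ax - I) < e / 3"
      using \<open>e / 3 > 0\<close> by blast
    have ax': "norm (\<Phi> (\<i> * of_real b) - \<Phi> (\<i> * of_real a) - I) < e / 3" if "b \<ge> B" "a \<le> - B" for a b
    proof -
      have "a \<le> b" using that B(1) by linarith
      have "ball 0 B \<subseteq> cbox a b" using that by (auto simp: dist_norm)
      from B(2)[OF this] integral_unique[OF ax[OF \<open>a \<le> b\<close>]] show ?thesis by simp
    qed
    have "eventually (\<lambda>t. norm (\<delta> (L t)) < e / 3 \<and> Im (L t) \<ge> B) at_top"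
      using tendstoD[OF \<delta>lims(1) \<open>e / 3 > 0\<close>] L
      unfolding path_between_imaginary_infinities_def filterlim_at_top
      by (auto intro: eventually_conj)
    then obtain T where T: "\<And>t. t \<ge> T \<Longrightarrow> norm (\<delta> (L t)) < e / 3 \<and> Im (L t) \<ge> B"
      by (auto simp: eventually_at_top_linorder)
    have "eventually (\<lambda>t. norm (\<delta> (L t)) < e / 3 \<and> Im (L t) \<le> - B) at_bot"
      using tendstoD[OF \<delta>lims(2) \<open>e / 3 > 0\<close>] L
      unfolding path_between_imaginary_infinities_def filterlim_at_bot
      by (auto intro: eventually_conj)
    then obtain T' where T': "\<And>t. t \<le> T' \<Longrightarrow> norm (\<delta> (L t)) < e / 3 \<and> Im (L t) \<le> - B"
      by (auto simp: eventually_at_bot_linorder)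
    define B' where "B' = max 1 (max T (- T'))"
    have "norm (integral (cbox a b) ?int - I) < e"
      if sub: "ball 0 B' \<subseteq> cbox a b" for a b
    proof -
      \<comment> \<open>A positive radius makes the closure of the open ball the closed ball; its
        points \<open>B'\<close> and \<open>- B'\<close> then bound \<open>b\<close> and
        \<open>a\<close>.\<close>
      have "B' \<ge> 1" unfolding B'_def by simp
      then have cb: "cball 0 B' \<subseteq> cbox a b"
        using closure_mono[OF sub] by (simp add: closure_closed)
      have ab: "b \<ge> B'" "a \<le> - B'"
        using subsetD[OF cb, of B'] subsetD[OF cb, of "- B'"] \<open>B' \<ge> 1\<close> by auto
      then have "a \<le> b" "b \<ge> T" "a \<le> T'" using \<open>B' \<ge> 1\<close> unfolding B'_def by linarith+
      have eq: "\<Phi> (L b) - \<Phi> (L a) - I = (\<Phi> (\<i> * of_real (Im (L b))) - \<Phi> (\<i> * of_real (Im (L a))) - I) +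
          \<delta> (L b) - \<delta> (L a)"
        unfolding \<delta>_def by simp
      have "norm (\<Phi> (\<i> * of_real (Im (L b))) - \<Phi> (\<i> * of_real (Im (L a))) - I) < e / 3"
        using T[OF \<open>b \<ge> T\<close>] T'[OF \<open>a \<le> T'\<close>] by (intro ax') auto
      moreover have "norm (\<delta> (L b)) < e / 3" "norm (\<delta> (L a)) < e / 3"
        using T[OF \<open>b \<ge> T\<close>] T'[OF \<open>a \<le> T'\<close>] by auto
      moreover have "norm (z + w - w') \<le> norm z + norm w + norm w'" for z w w' :: complex
        using norm_triangle_ineq4[of "z + w" w'] norm_triangle_ineq[of z w] by linarith
      note this[of "\<Phi> (\<i> * of_real (Im (L b))) - \<Phi> (\<i> * of_real (Im (L a))) - I" "\<delta> (L b)" "\<delta> (L a)"]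
      ultimately have "norm (\<Phi> (L b) - \<Phi> (L a) - I) < e"
        unfolding eq by linarith
      then show ?thesis using integral_unique[OF FTC[OF Lp \<open>a \<le> b\<close>]] by simp
    qed
    then show "\<exists>B>0. \<forall>a b. ball 0 B \<subseteq> cbox a b \<longrightarrow>
        norm (integral (cbox a b) (\<lambda>t. if t \<in> UNIV then ?int t else 0) - I) < e"
      by (intro exI[of _ B']) (auto simp: B'_def)
  qed
qed

section \<open>Hermite coefficients\<close>

definition sq_exp_coeff :: "nat \<Rightarrow> 'a :: real_normed_field" where
  "sq_exp_coeff i = (if even i then 1 / fact (i div 2) else 0)"

lemma sq_exp_coeff_sums:
  fixes z :: "'a :: {real_normed_field,banach}"
  shows "(\<lambda>i. sq_exp_coeff i * z ^ i) sums exp (z\<^sup>2)"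
proof -
  have "(\<lambda>n. (z\<^sup>2) ^ n /\<^sub>R fact n) sums exp (z\<^sup>2)"
    by (rule exp_converges)
  also have "(\<lambda>n. (z\<^sup>2) ^ n /\<^sub>R fact n) = (\<lambda>n. sq_exp_coeff (2 * n) * z ^ (2 * n))"
    by (auto simp: sq_exp_coeff_def scaleR_conv_of_real field_simps simp flip: power_mult)
  finally show ?thesis
    by (subst (asm) sums_mono_reindex[of "\<lambda>n. 2 * n"])
      (auto simp: strict_mono_def sq_exp_coeff_def elim!: evenE)
qed

lemma norm_sq_exp_coeff: "norm (sq_exp_coeff i :: 'a :: real_normed_field) = sq_exp_coeff i"
  by (simp add: sq_exp_coeff_def norm_divide)

lemma sq_exp_coeff_nonneg: "sq_exp_coeff i \<ge> (0 :: real)"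
  by (simp add: sq_exp_coeff_def)

text \<open>Coefficient of \<open>z ^ i\<close> in the differential equation
  \<open>E' = 2 * z * E\<close> for \<open>E = exp (z^2)\<close>.\<close>

lemma sq_exp_coeff_Suc:
  "of_nat (Suc i) * sq_exp_coeff (Suc i) = (if i = 0 then 0 else 2 * sq_exp_coeff (i - 1) :: 'a :: real_normed_field)"
proof (cases "odd i")
  case True
  then obtain j where i: "i = 2 * j + 1" by (auto elim: oddE)
  have "of_nat (Suc i) * sq_exp_coeff (Suc i) = of_nat (2 * Suc j) / (fact (Suc j) :: 'a)"
    by (simp add: sq_exp_coeff_def i del: of_nat_Suc fact_Suc)
  also have "\<dots> = 2 / fact j"
    unfolding of_nat_mult fact_Suc by (simp del: of_nat_Suc)
  finally show ?thesis by (simp add: sq_exp_coeff_def i)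
qed (auto simp: sq_exp_coeff_def)

text \<open>The Taylor coefficients of \<open>z \<mapsto> exp (z\<^sup>2 - 2 z u)\<close>, which are Hermite polynomials of
  imaginary argument up to normalisation.\<close>

definition herm :: "nat \<Rightarrow> 'a \<Rightarrow> 'a :: real_normed_field" where
  "herm k u = (\<Sum>i\<le>k. sq_exp_coeff i * ((- 2 * u) ^ (k - i) / fact (k - i)))"

lemma herm_0 [simp]: "herm 0 u = 1"
  by (simp add: herm_def sq_exp_coeff_def)

lemma herm_sums:
  fixes u z :: "'a :: {real_normed_field,banach}"
  shows "(\<lambda>k. herm k u * z ^ k) sums exp (z\<^sup>2 - 2 * z * u)"
proof -
  have e: "(\<lambda>j. (- 2 * u * z) ^ j / fact j) sums exp (- 2 * u * z)"
    using exp_converges[of "- 2 * u * z"] by (simp add: scaleR_conv_of_real field_simps)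
  have "summable (\<lambda>i. norm (sq_exp_coeff i * z ^ i))"
    using sums_summable[OF sq_exp_coeff_sums[of "norm z"]]
    by (simp add: norm_mult norm_power norm_sq_exp_coeff)
  moreover have "summable (\<lambda>j. norm ((- 2 * u * z) ^ j / fact j))"
    using summable_norm_exp[of "- 2 * u * z"] by (simp add: norm_divide norm_power field_simps)
  ultimately have "(\<lambda>k. \<Sum>i\<le>k. (sq_exp_coeff i * z ^ i) * ((- 2 * u * z) ^ (k - i) / fact (k - i)))
      sums ((\<Sum>k. sq_exp_coeff k * z ^ k) * (\<Sum>k. (- 2 * u * z) ^ k / fact k))"
    by (rule Cauchy_product_sums)
  also have "(\<Sum>k. sq_exp_coeff k * z ^ k) * (\<Sum>k. (- 2 * u * z) ^ k / fact k) = exp (z\<^sup>2 - 2 * z * u)"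
    unfolding sums_unique[OF sq_exp_coeff_sums, symmetric] sums_unique[OF e, symmetric] mult_exp_exp
    by (simp add: algebra_simps)
  also have "(\<lambda>k. \<Sum>i\<le>k. (sq_exp_coeff i * z ^ i) * ((- 2 * u * z) ^ (k - i) / fact (k - i))) =
      (\<lambda>k. herm k u * z ^ k)"
  proof
    fix k
    have "(sq_exp_coeff i * z ^ i) * ((- 2 * u * z) ^ (k - i) / fact (k - i)) =
        sq_exp_coeff i * ((- 2 * u) ^ (k - i) / fact (k - i)) * z ^ k" if "i \<le> k" for i
    proof -
      have "z ^ k = z ^ i * z ^ (k - i)" using that by (simp flip: power_add)
      then show ?thesis by (simp only: power_mult_distrib times_divide_eq_left times_divide_eq_right mult_ac)
    qed
    then show "(\<Sum>i\<le>k. (sq_exp_coeff i * z ^ i) * ((- 2 * u * z) ^ (k - i) / fact (k - i))) = herm k u * z ^ k"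
      unfolding herm_def sum_distrib_right by (intro sum.cong) auto
  qed
  finally show ?thesis .
qed

text \<open>For \<open>r >= 0\<close> all terms of \<open>herm k (- r)\<close> are non-negative, so
  it majorises \<open>herm k u\<close> on the disc \<open>norm u <= r\<close>, and its generating
  function is still an explicit exponential.\<close>

lemma herm_minus_nonneg: "r \<ge> 0 \<Longrightarrow> herm k (- r) \<ge> (0 :: real)"
  by (auto simp: herm_def sq_exp_coeff_nonneg intro!: sum_nonneg)

lemma herm_minus_mono: "0 \<le> r \<Longrightarrow> r \<le> s \<Longrightarrow> herm k (- r) \<le> (herm k (- s) :: real)"
  by (auto simp: herm_def sq_exp_coeff_nonneg intro!: sum_mono mult_left_mono divide_right_mono power_mono)

lemma norm_herm_le: "norm (herm k u) \<le> herm k (- norm u)"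
  unfolding herm_def
  by (rule order_trans[OF norm_sum])
    (simp add: norm_mult norm_divide norm_power norm_sq_exp_coeff)

text \<open>The generating function satisfies \<open>dH/dz = (2 z - 2 u) H\<close>; this compares
  coefficients of \<open>z ^ k\<close>. Splitting \<open>Suc k\<close> as
  \<open>i + (Suc k - i)\<close> inside the convolution is the product rule.\<close>

lemma herm_Suc:
  fixes u :: "'a :: {real_normed_field}"
  shows "of_nat (Suc k) * herm (Suc k) u = 2 * (if k = 0 then 0 else herm (k - 1) u) - 2 * u * herm k u"
proof -
  define c where "c j = (- 2 * u) ^ j / fact j" for j
  have c_Suc: "of_nat (Suc j) * c (Suc j) = - 2 * u * c j" for j
    by (simp add: c_def del: of_nat_Suc)
  have "of_nat (Suc k) * herm (Suc k) u =
      (\<Sum>i\<le>Suc k. of_nat i * sq_exp_coeff i * c (Suc k - i)) +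
      (\<Sum>i\<le>Suc k. sq_exp_coeff i * (of_nat (Suc k - i) * c (Suc k - i)))"
    unfolding herm_def c_def[symmetric] sum_distrib_left sum.distrib[symmetric]
    by (intro sum.cong) (auto simp: of_nat_diff algebra_simps)
  also have "(\<Sum>i\<le>Suc k. sq_exp_coeff i * (of_nat (Suc k - i) * c (Suc k - i))) = - 2 * u * herm k u"
  proof -
    have "(\<Sum>i\<le>Suc k. sq_exp_coeff i * (of_nat (Suc k - i) * c (Suc k - i))) =
        (\<Sum>i\<le>k. sq_exp_coeff i * (of_nat (Suc (k - i)) * c (Suc (k - i))))"
      by (subst sum.atMost_Suc) (auto simp: Suc_diff_le simp del: of_nat_Suc of_nat_diff intro!: sum.cong)
    also have "\<dots> = - 2 * u * herm k u"
      unfolding c_Suc herm_def c_def[symmetric] sum_distrib_left by (simp add: algebra_simps)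
    finally show ?thesis .
  qed
  also have "(\<Sum>i\<le>Suc k. of_nat i * sq_exp_coeff i * c (Suc k - i)) = 2 * (if k = 0 then 0 else herm (k - 1) u)"
  proof -
    have "(\<Sum>i\<le>Suc k. of_nat i * sq_exp_coeff i * c (Suc k - i)) =
        (\<Sum>i\<le>k. of_nat (Suc i) * sq_exp_coeff (Suc i) * c (k - i))"
      by (subst sum.atMost_Suc_shift) (simp del: of_nat_Suc)
    also have "\<dots> = (\<Sum>i\<le>k. (if i = 0 then 0 else 2 * sq_exp_coeff (i - 1)) * c (k - i))"
      unfolding sq_exp_coeff_Suc ..
    also have "\<dots> = 2 * (if k = 0 then 0 else herm (k - 1) u)"
    proof (cases k)
      case (Suc m)
      show ?thesis
        unfolding Suc by (subst sum.atMost_Suc_shift) (simp add: herm_def c_def sum_distrib_left mult.assoc)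
    qed auto
    finally show ?thesis .
  qed
  finally show ?thesis by (simp add: algebra_simps)
qed

text \<open>Differentiating the generating function in \<open>u\<close> multiplies it by
  \<open>- 2 * z\<close>, which shifts the index by one.\<close>

lemma herm_has_field_derivative:
  fixes u :: "'a :: {real_normed_field}"
  shows "(herm k has_field_derivative - 2 * (if k = 0 then 0 else herm (k - 1) u)) (at u)"
proof (cases k)
  case 0
  then have "herm k = (\<lambda>_::'a. 1)" by auto
  then show ?thesis using 0 by simp
next
  case (Suc m)
  have d: "((\<lambda>u. (- 2 * u) ^ Suc j / fact (Suc j)) has_field_derivative - 2 * ((- 2 * u) ^ j / fact j)) (at u)" for j
  proof -
    have "((\<lambda>u. (- 2 * u) ^ Suc j / fact (Suc j)) has_field_derivative
        of_nat (Suc j) * (- 2 * u) ^ j * (- 2) / fact (Suc j)) (at u)"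
      by (auto intro!: derivative_eq_intros simp del: power_Suc fact_Suc of_nat_Suc simp: algebra_simps)
    also have "of_nat (Suc j) * (- 2 * u) ^ j * (- 2) / fact (Suc j) = - 2 * ((- 2 * u) ^ j / fact j)"
      by (simp del: of_nat_Suc)
    finally show ?thesis .
  qed
  have "((\<lambda>u. (\<Sum>i\<le>m. sq_exp_coeff i * ((- 2 * u) ^ Suc (m - i) / fact (Suc (m - i)))) + sq_exp_coeff (Suc m))
      has_field_derivative (\<Sum>i\<le>m. sq_exp_coeff i * (- 2 * ((- 2 * u) ^ (m - i) / fact (m - i)))) + 0) (at u)"
    by (intro DERIV_add DERIV_sum DERIV_cmult d) auto
  also have "(\<lambda>u::'a. (\<Sum>i\<le>m. sq_exp_coeff i * ((- 2 * u) ^ Suc (m - i) / fact (Suc (m - i)))) + sq_exp_coeff (Suc m)) = herm k"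
    unfolding herm_def Suc by (auto simp: Suc_diff_le simp del: power_Suc fact_Suc intro!: sum.cong)
  also have "(\<Sum>i\<le>m. sq_exp_coeff i * (- 2 * ((- 2 * u) ^ (m - i) / fact (m - i)))) + 0 =
      - 2 * (if k = 0 then 0 else herm (k - 1) u)"
    unfolding herm_def Suc by (simp add: sum_distrib_left algebra_simps sum_negf)
  finally show ?thesis .
qed

lemma exp_type_herm: "exp_type (herm k)"
proof -
  have "herm k = (\<lambda>u::complex. \<Sum>i\<le>k. (sq_exp_coeff i * (- 2) ^ (k - i) / fact (k - i)) * u ^ (k - i))"
    unfolding herm_def power_mult_distrib by (auto intro!: ext sum.cong)
  then show ?thesis
    by (rule ssubst) (intro exp_type_sum exp_type_mult exp_type_const exp_type_power)
qed

text \<open>\<open>- (k + 1) exp (u\<^sup>2) herm (k + 1) u\<close> is the derivative of \<open>exp (u\<^sup>2) herm k u\<close>.\<close>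

lemma gauss_mean_herm: "gauss_mean (herm k) = (if k = 0 then 1 else 0)"
proof (cases k)
  case 0
  have "herm 0 = (\<lambda>_::complex. 1)" by (rule ext) simp
  then show ?thesis using gauss_mean_one 0 by simp
next
  case (Suc m)
  let ?h = "\<lambda>t. if m = 0 then 0 else herm (m - 1) (\<i> * complex_of_real t)"
  define \<Psi> where "\<Psi> t = of_real (exp (- t\<^sup>2)) * herm m (\<i> * of_real t)" for t :: real
  \<comment> \<open>The derivative of \<open>\<Psi>\<close>: the chain rule for
    \<open>u = \<i> * t\<close> contributes the factor \<open>\<i>\<close>.\<close>
  define \<psi> where "\<psi> t = of_real (exp (- t\<^sup>2)) * (- \<i> * of_nat (Suc m) * herm (Suc m) (\<i> * of_real t))" for t :: real
  have h: "exp_type (\<lambda>u. - \<i> * of_nat (Suc m) * herm (Suc m) u)"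
    by (intro exp_type_mult exp_type_const exp_type_herm)
  have int: "integrable lborel \<psi>"
    unfolding \<psi>_def by (rule exp_type_gaussian_integrable[OF h])
  have deriv: "(\<Psi> has_vector_derivative \<psi> t) (at t)" for t
  proof -
    have e: "((\<lambda>t. complex_of_real (exp (- t\<^sup>2))) has_vector_derivative of_real (- 2 * t * exp (- t\<^sup>2))) (at t)"
      by (intro has_vector_derivative_of_real) (auto intro!: derivative_eq_intros)
    have "((\<lambda>t. \<i> * complex_of_real t) has_vector_derivative \<i>) (at t)"
      by (auto intro!: derivative_eq_intros)
    from field_vector_diff_chain_at[OF this herm_has_field_derivative[of m]]
    have "((\<lambda>t. herm m (\<i> * complex_of_real t)) has_vector_derivative
        \<i> * (- 2 * ?h t)) (at t)"
      by (simp only: o_def)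
    from has_vector_derivative_mult[OF e this]
    have "(\<Psi> has_vector_derivative of_real (exp (- t\<^sup>2)) * (\<i> * (- 2 * ?h t)) +
        of_real (- 2 * t * exp (- t\<^sup>2)) * herm m (\<i> * of_real t)) (at t)"
      unfolding \<Psi>_def .
    also have "of_real (exp (- t\<^sup>2)) * (\<i> * (- 2 * ?h t)) +
        of_real (- 2 * t * exp (- t\<^sup>2)) * herm m (\<i> * of_real t) =
        of_real (exp (- t\<^sup>2)) * (- \<i> * (2 * ?h t - 2 * (\<i> * of_real t) * herm m (\<i> * of_real t)))"
      by (simp add: algebra_simps)
    also have "\<dots> = \<psi> t"
      unfolding herm_Suc[symmetric] \<psi>_def by (simp only: mult.assoc)
    finally show ?thesis .
  qed
  obtain C c where C: "C > 0" "c > 0" "\<And>u :: complex. norm (herm m u) \<le> C * exp (c * norm u)"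
    using exp_typeE[OF exp_type_herm[of m]] by metis
  have bound: "norm (\<Psi> t) \<le> C * exp (c * \<bar>t\<bar> - t\<^sup>2)" for t
  proof -
    have "norm (\<Psi> t) \<le> exp (- t\<^sup>2) * (C * exp (c * \<bar>t\<bar>))"
      unfolding \<Psi>_def norm_mult norm_of_real abs_exp_cancel
      using C(3)[of "\<i> * of_real t"] by (intro mult_left_mono) (auto simp: norm_mult)
    also have "\<dots> = C * exp (c * \<bar>t\<bar> - t\<^sup>2)"
      by (simp add: mult.left_commute flip: exp_add)
    finally show ?thesis .
  qed
  have lim: "(\<Psi> \<longlongrightarrow> 0) at_top" "(\<Psi> \<longlongrightarrow> 0) at_bot"
  proof -
    have "((\<lambda>t::real. C * exp (c * \<bar>t\<bar> - t\<^sup>2)) \<longlongrightarrow> 0) at_top"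
      "((\<lambda>t::real. C * exp (c * \<bar>t\<bar> - t\<^sup>2)) \<longlongrightarrow> 0) at_bot"
      using C(1,2) by real_asymp+
    then show "(\<Psi> \<longlongrightarrow> 0) at_top" "(\<Psi> \<longlongrightarrow> 0) at_bot"
      by (auto intro!: Lim_null_comparison[where f = \<Psi>] always_eventually bound)
  qed
  have cont: "isCont \<psi> t" for t
  proof -
    have "continuous_on UNIV (herm (Suc m) :: complex \<Rightarrow> complex)"
      using exp_type_herm[of "Suc m"] unfolding exp_type_def by (auto intro: holomorphic_on_imp_continuous_on)
    then have "continuous_on UNIV (\<lambda>t. herm (Suc m) (\<i> * complex_of_real t))"
      by (rule continuous_on_compose2) (auto intro!: continuous_intros)
    then have "continuous_on UNIV \<psi>"
      unfolding \<psi>_def by (intro continuous_intros)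
    then show ?thesis by (simp add: continuous_on_eq_continuous_at)
  qed
  have "(LBINT t=-\<infinity>..\<infinity>. \<psi> t) = 0 - 0"
  proof (rule interval_integral_FTC_integrable)
    show "set_integrable lborel (einterval (- \<infinity>) \<infinity>) \<psi>"
      using int by (simp add: set_integrable_def einterval_def)
    show "((\<Psi> \<circ> real_of_ereal) \<longlongrightarrow> 0) (at_right (- \<infinity>))" "((\<Psi> \<circ> real_of_ereal) \<longlongrightarrow> 0) (at_left \<infinity>)"
      using lim by (simp_all add: ereal_tendsto_simps)
  qed (use deriv cont in auto)
  then have "(LINT t|lborel. \<psi> t) = 0"
    by (simp add: interval_lebesgue_integral_def einterval_def set_lebesgue_integral_def)
  then have "gauss_mean (\<lambda>u. - \<i> * of_nat (Suc m) * herm (Suc m) u) = 0"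
    unfolding gauss_mean_def \<psi>_def by simp
  then show ?thesis
    unfolding gauss_mean_cmult Suc by (simp del: of_nat_Suc)
qed

text \<open>The mean of \<open>u ^ j * herm k u\<close>, by the recursion that results from solving
  \<open>herm_Suc\<close> for \<open>u * herm k u\<close>. For fixed \<open>j\<close> these are the
  coefficients of the monic Hermite polynomial \<open>h_j\<close>, since the recursion reads
  \<open>h_(j+1) = x h_j - h_j' / 2\<close>.\<close>

fun herm_pairing :: "nat \<Rightarrow> nat \<Rightarrow> real" where
  "herm_pairing 0 k = (if k = 0 then 1 else 0)"
| "herm_pairing (Suc j) k =
     (if k = 0 then 0 else herm_pairing j (k - 1)) - real (Suc k) / 2 * herm_pairing j (Suc k)"

text \<open>This triangularity cuts the average of \<open>f_fun\<close> against \<open>u ^ j\<close>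
  down to a polynomial in \<open>x\<close> of degree at most \<open>j\<close>.\<close>

lemma herm_pairing_eq_0: "j < k \<Longrightarrow> herm_pairing j k = 0"
  by (induction j arbitrary: k) auto

lemma herm_pairing_diag: "herm_pairing j j = 1"
  by (induction j) (auto simp: herm_pairing_eq_0)

lemma gauss_mean_herm_power:
  "gauss_mean (\<lambda>u. u ^ j * herm k u) = of_real (herm_pairing j k)"
proof (induction j arbitrary: k)
  case 0
  then show ?case by (simp add: gauss_mean_herm)
next
  case (Suc j)
  have t: "exp_type (\<lambda>u. u ^ j * herm k u)" for k
    by (intro exp_type_mult exp_type_power exp_type_herm)
  \<comment> \<open>\<open>herm_Suc\<close> solved for \<open>u * herm k u\<close>. At
    \<open>k = 0\<close> a factor 0 stands for the missing lower term, so that both summands have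
    the form of the induction hypothesis.\<close>
  have id: "u ^ Suc j * herm k u = (if k = 0 then 0 else 1) * (u ^ j * herm (k - 1) u) + (- of_real (real (Suc k) / 2)) * (u ^ j * herm (Suc k) u)"
    for u :: complex
  proof -
    have "u * herm k u = (if k = 0 then 0 else herm (k - 1) u) - of_nat (Suc k) / 2 * herm (Suc k) u"
      using herm_Suc[of k u] by (simp add: field_simps)
    then have "u ^ j * (u * herm k u) = u ^ j * ((if k = 0 then 0 else herm (k - 1) u) - of_nat (Suc k) / 2 * herm (Suc k) u)"
      by (rule arg_cong)
    then show ?thesis by (simp add: algebra_simps)
  qed
  show ?case
    unfolding id
    by (subst gauss_mean_add, intro exp_type_mult[OF exp_type_const t], intro exp_type_mult[OF exp_type_const t],
        unfold gauss_mean_cmult Suc) auto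
qed

section \<open>Series expansion of \<open>f_fun\<close>\<close>

lemma encircles_circlepath:
  assumes "A \<subseteq> ball 0 R" "R > 0"
  shows "encircles_anticlockwise (circlepath 0 R) A"
proof -
  have "winding_number (circlepath 0 R) a = 1" if "a \<in> A" for a
    using that assms by (intro winding_number_circlepath) auto
  then show ?thesis
    using assms unfolding encircles_anticlockwise_def by (auto simp: path_image_circlepath)
qed

text \<open>With all winding numbers equal to 1, the residue theorem expresses the integral through
  the residues at \<open>A\<close> alone, whatever the shape of the loop. This lets arbitrary loops
  be traded for circles.\<close>

lemma contour_integral_encircles_eq:
  assumes "encircles_anticlockwise C A" "encircles_anticlockwise C' A" "finite A"
    and "f holomorphic_on - A"
  shows "contour_integral C f = contour_integral C' f"
proof -
  have "contour_integral \<gamma> f = 2 * pi * \<i> * (\<Sum>p\<in>A. residue f p)"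
    if "encircles_anticlockwise \<gamma> A" for \<gamma>
  proof -
    have "contour_integral \<gamma> f = 2 * pi * \<i> * (\<Sum>p\<in>A. winding_number \<gamma> p * residue f p)"
      using that assms unfolding encircles_anticlockwise_def
      by (intro Residue_theorem[of UNIV]) (auto simp: Compl_eq_Diff_UNIV)
    also have "\<dots> = 2 * pi * \<i> * (\<Sum>p\<in>A. residue f p)"
      using that unfolding encircles_anticlockwise_def by simp
    finally show ?thesis .
  qed
  then show ?thesis using assms by simp
qed

section \<open>Entire power series under loop integrals\<close>

definition entire_coeffs :: "(nat \<Rightarrow> complex) \<Rightarrow> bool" where
  "entire_coeffs a \<longleftrightarrow> (\<forall>R\<ge>0. summable (\<lambda>k. norm (a k) * R ^ k))"

lemma entire_coeffs_sums:
  assumes "entire_coeffs a"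
  shows "(\<lambda>k. a k * z ^ k) sums (\<Sum>k. a k * z ^ k)"
proof -
  have "summable (\<lambda>k. norm (a k * z ^ k))"
    using assms unfolding entire_coeffs_def by (simp add: norm_mult norm_power)
  then show ?thesis by (rule summable_sums[OF summable_norm_cancel])
qed

lemma entire_coeffs_holomorphic:
  assumes "entire_coeffs a"
  shows "(\<lambda>z. \<Sum>k. a k * z ^ k) holomorphic_on S"
proof -
  have "(\<lambda>z. \<Sum>k. a k * z ^ k) holomorphic_on ball 0 R" for R
    by (rule power_series_holomorphic[where a = a]) (use entire_coeffs_sums[OF assms] in simp)
  then have "(\<lambda>z. \<Sum>k. a k * z ^ k) holomorphic_on (\<Union>R. ball 0 R)"
    by (intro holomorphic_on_UN_open) auto
  moreover have "x \<in> (\<Union>R. ball 0 R)" for x :: complex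
    by (auto intro!: exI[of _ "norm x + 1"])
  ultimately show ?thesis by (elim holomorphic_on_subset) blast
qed

lemma entire_coeffs_bounded:
  assumes "entire_coeffs a" "\<And>k. norm (c k) \<le> norm (a k)"
  shows "entire_coeffs c"
  unfolding entire_coeffs_def
proof (intro allI impI)
  fix R :: real assume "R \<ge> 0"
  have "summable (\<lambda>k. norm (a k) * R ^ k)" using assms(1) \<open>R \<ge> 0\<close> unfolding entire_coeffs_def by blast
  then show "summable (\<lambda>k. norm (c k) * R ^ k)"
    by (rule summable_comparison_test'[of _ 0]) (use assms(2) \<open>R \<ge> 0\<close> in \<open>auto intro: mult_right_mono\<close>)
qed

lemma entire_coeffs_cmult:
  assumes "entire_coeffs a"
  shows "entire_coeffs (\<lambda>k. c * a k)"
  using assms unfolding entire_coeffs_def norm_mult mult.assoc by (intro allI impI summable_mult) blast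

text \<open>The residue at a pole of order \<open>m + 1\<close>; this is Hankel's loop integral for
  \<open>1 / Gamma\<close> at a positive integer.\<close>

lemma contour_integral_exp_over_power:
  assumes "encircles_anticlockwise C {0}"
  shows "contour_integral C (\<lambda>s. exp s / s ^ Suc m) = 2 * pi * \<i> / fact m"
proof -
  have "contour_integral C (\<lambda>s. exp s / s ^ Suc m) = 2 * pi * \<i> * (\<Sum>p\<in>{0}. winding_number C p * residue (\<lambda>s. exp s / s ^ Suc m) p)"
    using assms unfolding encircles_anticlockwise_def
    by (intro Residue_theorem[of UNIV]) (auto intro!: holomorphic_intros)
  moreover have "residue (\<lambda>s. exp s / s ^ Suc m) (0::complex) = (deriv ^^ m) exp 0 / fact m"
    by (rule residue_holomorphic_over_power'[of UNIV]) (auto intro!: holomorphic_intros)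
  moreover have "(deriv ^^ m) exp = (exp :: complex \<Rightarrow> complex)"
    by (induction m) (auto simp: DERIV_imp_deriv[OF DERIV_exp])
  ultimately show ?thesis using assms unfolding encircles_anticlockwise_def by simp
qed

lemma contour_integral_mellin_series:
  assumes C: "encircles_anticlockwise C {0}" and a: "entire_coeffs a"
  shows "contour_integral C (\<lambda>s. s powi (- int \<nu>) * exp s * (\<Sum>k. a k * (z / s) ^ k) / s) =
      2 * pi * \<i> * (\<Sum>k. a k / fact (\<nu> + k) * z ^ k)"
proof -
  let ?g = "\<lambda>s. s powi (- int \<nu>) * exp s * (\<Sum>k. a k * (z / s) ^ k) / s"
  let ?C = "circlepath 0 1"
  have circ: "encircles_anticlockwise ?C {0}"
    by (rule encircles_circlepath) auto
  define F where "F k s = a k * z ^ k * (exp s / s ^ Suc (\<nu> + k))" for k and s :: complex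
  have F_eq: "s powi (- int \<nu>) * exp s * (a k * (z / s) ^ k) / s = F k s" if "s \<noteq> 0" for k s
    using that by (simp add: F_def power_int_minus power_add power_divide field_simps)
  have F_sum: "?g s = (\<Sum>k. F k s)" if "s \<noteq> 0" for s
  proof -
    have "(\<lambda>k. s powi (- int \<nu>) * exp s * (a k * (z / s) ^ k) / s) sums
        (?g s)"
      by (intro sums_divide sums_mult entire_coeffs_sums a)
    then show ?thesis using F_eq[OF that] by (simp add: sums_iff)
  qed
  have hol: "?g holomorphic_on - {0}"
  proof -
    have "(\<lambda>s. \<Sum>k. a k * (z / s) ^ k) holomorphic_on - {0}"
    proof -
      have "(\<lambda>s. z / s) holomorphic_on - {0}" by (auto intro!: holomorphic_intros)
      from holomorphic_on_compose_gen[OF this entire_coeffs_holomorphic[OF a], of UNIV]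
      show ?thesis by (simp add: o_def)
    qed
    then show ?thesis by (auto intro!: holomorphic_intros)
  qed
  have Fint: "F k contour_integrable_on ?C" for k
    unfolding F_def
    by (intro contour_integrable_holomorphic_simple[of _ "- {0}"])
      (auto intro!: holomorphic_intros simp: path_image_circlepath)
  \<comment> \<open>On the unit circle \<open>norm s = 1\<close>, so the terms are dominated by the
    series of \<open>a\<close> at radius \<open>norm z\<close> and may be integrated one by
    one.\<close>
  have "contour_integral C ?g =
      contour_integral ?C ?g"
    by (rule contour_integral_encircles_eq[OF C circ _ hol]) auto
  also have "\<dots> = contour_integral ?C (\<lambda>s. \<Sum>k. F k s)"
    by (intro contour_integral_eq F_sum) (auto simp: path_image_circlepath)
  also have "\<dots> = 2 * pi * \<i> * (\<Sum>k. a k / fact (\<nu> + k) * z ^ k)"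
  proof -
    have "uniform_limit (sphere 0 1) (\<lambda>n s. \<Sum>k<n. F k s) (\<lambda>s. \<Sum>k. F k s) sequentially"
    proof (rule Weierstrass_m_test)
      show "norm (F k s) \<le> exp 1 * (norm (a k) * norm z ^ k)" if "s \<in> sphere 0 1" for k s
      proof -
        have "norm (exp s) \<le> exp 1"
          using that complex_Re_le_cmod[of s] by simp
        moreover have "norm (F k s) = norm (exp s) * (norm (a k) * norm z ^ k)"
          using that by (simp add: F_def norm_mult norm_divide norm_power)
        ultimately show ?thesis by (simp only: mult_right_mono mult_nonneg_nonneg norm_ge_zero zero_le_power)
      qed
      show "summable (\<lambda>k. exp 1 * (norm (a k) * norm z ^ k))"
        using a unfolding entire_coeffs_def by (intro summable_mult) auto
    qed
    then have "(\<lambda>n. contour_integral ?C (\<lambda>s. \<Sum>k<n. F k s)) \<longlonglongrightarrow> contour_integral ?C (\<lambda>s. \<Sum>k. F k s)"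
      by (intro contour_integral_uniform_limit_circlepath)
        (auto intro!: always_eventually contour_integrable_sum Fint)
    moreover have "contour_integral ?C (\<lambda>s. \<Sum>k<n. F k s) = (\<Sum>k<n. 2 * pi * \<i> * (a k / fact (\<nu> + k) * z ^ k))" for n
    proof -
      have "contour_integral ?C (F k) = 2 * pi * \<i> * (a k / fact (\<nu> + k) * z ^ k)" for k
      proof -
        have "(\<lambda>s. exp s / s ^ Suc (\<nu> + k)) contour_integrable_on ?C"
          by (intro contour_integrable_holomorphic_simple[of _ "- {0}"])
            (auto intro!: holomorphic_intros simp: path_image_circlepath)
        then have "contour_integral ?C (F k) = a k * z ^ k * (2 * pi * \<i> / fact (\<nu> + k))"
          unfolding F_def by (subst contour_integral_lmul) (simp_all only: contour_integral_exp_over_power[OF circ])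
        then show ?thesis by simp
      qed
      then show ?thesis by (subst contour_integral_sum) (auto intro: Fint)
    qed
    ultimately have "(\<lambda>k. 2 * pi * \<i> * (a k / fact (\<nu> + k) * z ^ k)) sums contour_integral ?C (\<lambda>s. \<Sum>k. F k s)"
      unfolding sums_def by simp
    moreover have "(\<lambda>k. 2 * pi * \<i> * (a k / fact (\<nu> + k) * z ^ k)) sums (2 * pi * \<i> * (\<Sum>k. a k / fact (\<nu> + k) * z ^ k))"
      by (intro sums_mult entire_coeffs_sums entire_coeffs_bounded[OF a])
        (auto simp: norm_divide divide_le_eq mult_le_cancel_left1 fact_ge_1)
    ultimately show ?thesis by (rule sums_unique2)
  qed
  finally show ?thesis .
qed

text \<open>Peels off the innermost variable. Because \<open>\<phi>\<close> sees the variables only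
  through their product, the remaining integrand has the same shape with \<open>\<phi>\<close>
  replaced by a one-variable transform. Shared by the loops of \<open>f_fun\<close> and the
  half-lines of \<open>g_fun\<close>.\<close>

lemma iterated_integral_Suc_product:
  fixes I :: "('a \<Rightarrow> complex) \<Rightarrow> complex" and \<phi> :: "'b::field \<Rightarrow> complex"
  assumes I: "\<And>c h. I (\<lambda>a. c * h a) = c * I h"
  shows "iterated_integral I (Suc m) (\<lambda>t. (\<Prod>l<Suc m. w l (t l)) * \<phi> (x / (\<Prod>l<Suc m. e (t l)))) t =
    iterated_integral I m (\<lambda>t. (\<Prod>l<m. w l (t l)) * I (\<lambda>a. w m a * \<phi> (x / (\<Prod>l<m. e (t l)) / e a))) t"
proof -
  have "I (\<lambda>a. (\<Prod>l<Suc m. w l ((t(m := a)) l)) * \<phi> (x / (\<Prod>l<Suc m. e ((t(m := a)) l)))) =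
      (\<Prod>l<m. w l (t l)) * I (\<lambda>a. w m a * \<phi> (x / (\<Prod>l<m. e (t l)) / e a))" for t
    by (simp add: mult.assoc I)
  then show ?thesis by simp
qed

definition gamma_weight :: "nat \<Rightarrow> (nat \<Rightarrow> nat) \<Rightarrow> nat \<Rightarrow> real" where
  "gamma_weight M \<nu> k = (\<Prod>l<M. fact (\<nu> l + k))"

lemma gamma_weight_ge_1: "gamma_weight M \<nu> k \<ge> 1"
  unfolding gamma_weight_def by (intro prod_ge_1 fact_ge_1)

lemma gamma_weight_pos: "gamma_weight M \<nu> k > 0"
  using gamma_weight_ge_1[of M \<nu> k] by linarith

lemma iterated_contour_integral_mellin:
  assumes C: "encircles_anticlockwise C {0}" and a: "entire_coeffs a"
  shows "iterated_integral (\<lambda>h. contour_integral C (\<lambda>s. h s / s)) M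
      (\<lambda>s. (\<Prod>l<M. s l powi (- int (\<nu> l)) * exp (s l)) * (\<Sum>k. a k * (x / (\<Prod>l<M. s l)) ^ k)) t =
    (2 * pi * \<i>) ^ M * (\<Sum>k. a k / of_real (gamma_weight M \<nu> k) * x ^ k)"
  using a
proof (induction M arbitrary: a)
  case 0
  then show ?case by (simp add: gamma_weight_def)
next
  case (Suc M)
  let ?I = "\<lambda>h. contour_integral C (\<lambda>s. h s / s)"
  have I: "?I (\<lambda>a. c * h a) = c * ?I h" for c h
    by (simp add: contour_integral_integral mult.assoc flip: times_divide_eq_right integral_mult_right)
  \<comment> \<open>The factor \<open>2 * pi * \<i>\<close> of one loop is absorbed into the
    coefficients, so that the induction hypothesis applies to a series of the same form.\<close>
  have a': "entire_coeffs (\<lambda>k. 2 * pi * \<i> * (a k / fact (\<nu> M + k)))"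
    by (intro entire_coeffs_cmult entire_coeffs_bounded[OF Suc.prems])
      (auto simp: norm_divide divide_le_eq mult_le_cancel_left1 fact_ge_1)
  have inner: "?I (\<lambda>s. s powi (- int (\<nu> M)) * exp s * (\<Sum>k. a k * (z / s) ^ k)) =
      (\<Sum>k. 2 * pi * \<i> * (a k / fact (\<nu> M + k)) * z ^ k)" for z
  proof -
    have "entire_coeffs (\<lambda>k. a k / fact (\<nu> M + k))"
      by (intro entire_coeffs_bounded[OF Suc.prems])
        (auto simp: norm_divide divide_le_eq mult_le_cancel_left1 fact_ge_1)
    then have "summable (\<lambda>k. a k / fact (\<nu> M + k) * z ^ k)"
      using entire_coeffs_sums sums_summable by blast
    then show ?thesis
      unfolding contour_integral_mellin_series[OF C Suc.prems]
      by (subst suminf_mult[symmetric]) (auto simp: mult.assoc)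
  qed
  have "iterated_integral ?I (Suc M) (\<lambda>s. (\<Prod>l<Suc M. s l powi (- int (\<nu> l)) * exp (s l)) *
        (\<Sum>k. a k * (x / (\<Prod>l<Suc M. s l)) ^ k)) t =
      iterated_integral ?I M (\<lambda>s. (\<Prod>l<M. s l powi (- int (\<nu> l)) * exp (s l)) *
        (\<Sum>k. 2 * pi * \<i> * (a k / fact (\<nu> M + k)) * (x / (\<Prod>l<M. s l)) ^ k)) t"
    using iterated_integral_Suc_product[of ?I M "\<lambda>l s. s powi (- int (\<nu> l)) * exp s" "\<lambda>z. \<Sum>k. a k * z ^ k" x "\<lambda>s. s" t, OF I]
    unfolding inner .
  also have "\<dots> = (2 * pi * \<i>) ^ M * (\<Sum>k. 2 * pi * \<i> * (a k / fact (\<nu> M + k)) / of_real (gamma_weight M \<nu> k) * x ^ k)"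
    by (rule Suc.IH[OF a'])
  also have "(\<Sum>k. 2 * pi * \<i> * (a k / fact (\<nu> M + k)) / of_real (gamma_weight M \<nu> k) * x ^ k) =
      (\<Sum>k. 2 * pi * \<i> * (a k / of_real (gamma_weight (Suc M) \<nu> k) * x ^ k))"
    by (intro suminf_cong) (simp add: gamma_weight_def mult_ac)
  also have "\<dots> = 2 * pi * \<i> * (\<Sum>k. a k / of_real (gamma_weight (Suc M) \<nu> k) * x ^ k)"
  proof (intro suminf_mult sums_summable[OF entire_coeffs_sums] entire_coeffs_bounded[OF Suc.prems])
    fix k show "norm (a k / of_real (gamma_weight (Suc M) \<nu> k)) \<le> norm (a k)"
      using gamma_weight_ge_1[of "Suc M" \<nu> k] by (simp add: norm_divide divide_le_eq mult_le_cancel_left1)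
  qed
  finally show ?case by (simp only: power_Suc mult_ac)
qed

lemma summable_herm: "summable (\<lambda>k. herm k (- r) * R ^ k :: real)"
  by (rule sums_summable[OF herm_sums])

lemma entire_coeffs_herm: "entire_coeffs (\<lambda>k. herm k u)"
  unfolding entire_coeffs_def
proof (intro allI impI)
  fix R :: real assume "R \<ge> 0"
  then show "summable (\<lambda>k. norm (herm k u) * R ^ k)"
    by (intro summable_comparison_test'[OF summable_herm[of "norm u" R], of 0])
      (auto intro!: mult_right_mono norm_herm_le)
qed

lemma f_fun_sums:
  assumes C: "encircles_anticlockwise C {0}"
  shows "(\<lambda>k. herm k u / of_real (gamma_weight M \<nu> k) * of_real x ^ k) sums f_fun C M \<nu> x u"
proof -
  have "f_fun C M \<nu> x u = 1 / (2 * of_real pi * \<i>) ^ M *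
     iterated_integral (\<lambda>h. contour_integral C (\<lambda>s. h s / s)) M
      (\<lambda>s. (\<Prod>l<M. s l powi (- int (\<nu> l)) * exp (s l)) * (\<Sum>k. herm k u * (of_real x / (\<Prod>l<M. s l)) ^ k)) (\<lambda>_. 0)"
    unfolding f_fun_def sums_unique[OF herm_sums, symmetric] by (simp add: power_divide)
  also have "\<dots> = (\<Sum>k. herm k u / of_real (gamma_weight M \<nu> k) * of_real x ^ k)"
    unfolding iterated_contour_integral_mellin[OF C entire_coeffs_herm] by simp
  finally have f: "f_fun C M \<nu> x u = (\<Sum>k. herm k u / of_real (gamma_weight M \<nu> k) * of_real x ^ k)" .
  have "entire_coeffs (\<lambda>k. herm k u / of_real (gamma_weight M \<nu> k))"
  proof (rule entire_coeffs_bounded[OF entire_coeffs_herm[of u]])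
    fix k show "norm (herm k u / of_real (gamma_weight M \<nu> k)) \<le> norm (herm k u)"
      using gamma_weight_ge_1[of M \<nu> k] by (simp add: norm_divide divide_le_eq mult_le_cancel_left1)
  qed
  then show ?thesis unfolding f by (rule entire_coeffs_sums)
qed

lemma f_fun_term_bound:
  "norm (herm k u / of_real (gamma_weight M \<nu> k) * of_real x ^ k :: complex) \<le> herm k (- norm u) * \<bar>x\<bar> ^ k"
proof -
  have "norm (herm k u / of_real (gamma_weight M \<nu> k) :: complex) \<le> norm (herm k u)"
    using gamma_weight_ge_1[of M \<nu> k] by (simp add: norm_divide divide_le_eq mult_le_cancel_left1)
  then have "norm (herm k u / of_real (gamma_weight M \<nu> k) :: complex) \<le> herm k (- norm u)"
    using norm_herm_le order_trans by blast
  then show ?thesis unfolding norm_mult norm_power norm_of_real by (rule mult_right_mono) simp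
qed

text \<open>The bound is independent of \<open>N\<close>, the majorants
  \<open>herm k (- norm u)\<close> having an explicit generating function. It yields both the
  exponential type of \<open>f_fun\<close> in \<open>u\<close> and the dominating function for
  averaging its series termwise.\<close>

lemma f_fun_partial_sum_bound:
  "norm (\<Sum>k<N. herm k u / of_real (gamma_weight M \<nu> k) * of_real x ^ k :: complex) \<le> exp (x\<^sup>2 + 2 * \<bar>x\<bar> * norm u)"
proof -
  have s: "(\<lambda>k. herm k (- norm u) * \<bar>x\<bar> ^ k) sums exp (x\<^sup>2 + 2 * \<bar>x\<bar> * norm u)"
    using herm_sums[of "- norm u" "\<bar>x\<bar>"] by simp
  have "norm (\<Sum>k<N. herm k u / of_real (gamma_weight M \<nu> k) * of_real x ^ k :: complex) \<le>
      (\<Sum>k<N. herm k (- norm u) * \<bar>x\<bar> ^ k)"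
    by (intro sum_norm_le f_fun_term_bound)
  also have "\<dots> \<le> exp (x\<^sup>2 + 2 * \<bar>x\<bar> * norm u)"
    unfolding sums_unique[OF s]
    by (intro sum_le_suminf sums_summable[OF s]) (auto intro!: mult_nonneg_nonneg herm_minus_nonneg)
  finally show ?thesis .
qed

lemma exp_type_f_fun:
  assumes C: "encircles_anticlockwise C {0}"
  shows "exp_type (f_fun C M \<nu> x)"
proof -
  let ?F = "\<lambda>k u. herm k u / of_real (gamma_weight M \<nu> k) * of_real x ^ k :: complex"
  have f: "f_fun C M \<nu> x u = (\<Sum>k. ?F k u)" for u
    using sums_unique[OF f_fun_sums[OF C]] .
  have "f_fun C M \<nu> x holomorphic_on UNIV"
  proof (rule holomorphic_uniform_sequence[of UNIV "\<lambda>n u. \<Sum>k<n. ?F k u"])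
    show "(\<lambda>u. \<Sum>k<n. ?F k u) holomorphic_on UNIV" for n
      using exp_type_herm gamma_weight_ge_1 unfolding exp_type_def
      by (intro holomorphic_intros) (auto simp: less_le_trans[OF zero_less_one] less_imp_neq[symmetric])
    show "\<exists>d>0. cball w d \<subseteq> UNIV \<and> uniform_limit (cball w d) (\<lambda>n u. \<Sum>k<n. ?F k u) (f_fun C M \<nu> x) sequentially"
      for w
    proof (intro exI[of _ 1] conjI)
      show "uniform_limit (cball w 1) (\<lambda>n u. \<Sum>k<n. ?F k u) (f_fun C M \<nu> x) sequentially"
        unfolding f
      proof (rule Weierstrass_m_test)
        fix k u assume "u \<in> cball w 1"
        then have "norm u \<le> norm w + 1"
          by (smt (verit) dist_norm mem_cball norm_minus_commute norm_triangle_sub)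
        then show "norm (?F k u) \<le> herm k (- (norm w + 1)) * \<bar>x\<bar> ^ k"
          by (intro order_trans[OF f_fun_term_bound] mult_right_mono herm_minus_mono) auto
      qed (rule summable_herm)
    qed auto
  qed auto
  moreover have "norm (f_fun C M \<nu> x u) \<le> exp (x\<^sup>2) * exp (2 * \<bar>x\<bar> * norm u)" for u
    using LIMSEQ_le_const2[OF tendsto_norm[OF f_fun_sums[OF C, unfolded sums_def]]]
      f_fun_partial_sum_bound by (metis exp_add)
  ultimately show ?thesis unfolding exp_type_def by blast
qed

text \<open>Averaging the series of \<open>f_fun\<close> term by term, by dominated convergence; the
  terms with \<open>k > j\<close> have mean 0.\<close>

lemma gauss_mean_f_fun_power:
  assumes C: "encircles_anticlockwise C {0}"
  shows "gauss_mean (\<lambda>u. f_fun C M \<nu> x u * u ^ j) =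
    (\<Sum>k\<le>j. of_real (herm_pairing j k / gamma_weight M \<nu> k) * of_real x ^ k)"
proof -
  let ?F = "\<lambda>k u. herm k u / of_real (gamma_weight M \<nu> k) * of_real x ^ k :: complex"
  let ?e = "\<lambda>t::real. complex_of_real (exp (- t\<^sup>2))"
  let ?s = "\<lambda>n t. ?e t * (\<Sum>k<n. ?F k (\<i> * of_real t) * (\<i> * of_real t) ^ j)"
  let ?l = "\<lambda>t. ?e t * (f_fun C M \<nu> x (\<i> * of_real t) * (\<i> * of_real t) ^ j)"
  \<comment> \<open>The power of \<open>u\<close> is absorbed by
    \<open>\<bar>t\<bar> ^ j <= exp (j * \<bar>t\<bar>)\<close>, the rest is the bound on the
    partial sums.\<close>
  let ?w = "\<lambda>t. exp (x\<^sup>2) * exp ((2 * \<bar>x\<bar> + j) * \<bar>t\<bar> - t\<^sup>2)"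
  have F_exp: "exp_type (\<lambda>u. \<Sum>k<n. ?F k u * u ^ j)" for n
  proof (intro exp_type_sum exp_type_mult exp_type_power exp_type_const)
    fix k
    show "exp_type (\<lambda>u. herm k u / of_real (gamma_weight M \<nu> k))"
      unfolding divide_inverse by (intro exp_type_mult exp_type_const exp_type_herm)
  qed
  have mean: "gauss_mean (\<lambda>u. \<Sum>k<n. ?F k u * u ^ j) =
      (\<Sum>k<n. of_real (herm_pairing j k / gamma_weight M \<nu> k) * of_real x ^ k)" for n
  proof -
    have eq: "(\<lambda>u. ?F k u * u ^ j) = (\<lambda>u. of_real x ^ k / of_real (gamma_weight M \<nu> k) * (u ^ j * herm k u))" for k
      by (auto simp: field_simps)
    have "gauss_mean (\<lambda>u. \<Sum>k<n. ?F k u * u ^ j) = (\<Sum>k<n. gauss_mean (\<lambda>u. ?F k u * u ^ j))"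
      by (rule gauss_mean_sum, unfold eq) (intro exp_type_mult exp_type_power exp_type_herm exp_type_const)
    also have "\<dots> = (\<Sum>k<n. of_real (herm_pairing j k / gamma_weight M \<nu> k) * of_real x ^ k)"
      unfolding eq gauss_mean_cmult gauss_mean_herm_power by (simp add: mult_ac)
    finally show ?thesis .
  qed
  have "(\<lambda>n. LINT t|lborel. ?s n t) \<longlonglongrightarrow>
      (LINT t|lborel. ?l t)"
  proof (rule integral_dominated_convergence[where w = ?w])
    show "?l \<in> borel_measurable lborel"
      by (rule borel_measurable_integrable[OF exp_type_gaussian_integrable])
        (intro exp_type_mult exp_type_f_fun[OF C] exp_type_power)
    show "(?s n) \<in> borel_measurable lborel" for n
      by (rule borel_measurable_integrable[OF exp_type_gaussian_integrable[OF F_exp]])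
    show "integrable lborel ?w"
      by (intro integrable_mult_right gaussian_exp_integrable)
    show "AE t in lborel. (\<lambda>n. ?s n t) \<longlonglongrightarrow>
        ?l t"
      unfolding sum_distrib_right[symmetric]
      by (intro AE_I2 tendsto_intros f_fun_sums[OF C, unfolded sums_def])
    show "AE t in lborel. norm (?s n t) \<le>
        ?w t" for n
    proof (intro AE_I2)
      fix t :: real
      have "\<bar>t\<bar> ^ j \<le> exp \<bar>t\<bar> ^ j"
        using exp_ge_add_one_self[of "\<bar>t\<bar>"] by (intro power_mono abs_ge_zero) linarith
      then have tj: "\<bar>t\<bar> ^ j \<le> exp (j * \<bar>t\<bar>)" by (simp add: exp_of_nat_mult)
      have "norm (?s n t) =
          exp (- t\<^sup>2) * (norm (\<Sum>k<n. ?F k (\<i> * of_real t)) * \<bar>t\<bar> ^ j)"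
        unfolding sum_distrib_right[symmetric] by (simp add: norm_mult norm_power)
      also have "\<dots> \<le> exp (- t\<^sup>2) * (exp (x\<^sup>2 + 2 * \<bar>x\<bar> * \<bar>t\<bar>) * exp (j * \<bar>t\<bar>))"
        using f_fun_partial_sum_bound[of "\<i> * of_real t" M \<nu> x n] tj
        by (intro mult_left_mono mult_mono) (auto simp: norm_mult)
      also have "\<dots> = ?w t"
        unfolding mult_exp_exp by (simp add: algebra_simps)
      finally show "norm (?s n t) \<le>
          ?w t" .
    qed
  qed
  then have "(\<lambda>n. gauss_mean (\<lambda>u. \<Sum>k<n. ?F k u * u ^ j)) \<longlonglongrightarrow> gauss_mean (\<lambda>u. f_fun C M \<nu> x u * u ^ j)"
    unfolding gauss_mean_def by (intro tendsto_divide tendsto_const) auto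
  then have "(\<lambda>k. of_real (herm_pairing j k / gamma_weight M \<nu> k) * of_real x ^ k) sums
      gauss_mean (\<lambda>u. f_fun C M \<nu> x u * u ^ j)"
    unfolding mean sums_def .
  moreover have "(\<lambda>k. complex_of_real (herm_pairing j k / gamma_weight M \<nu> k) * of_real x ^ k) sums
      (\<Sum>k\<le>j. of_real (herm_pairing j k / gamma_weight M \<nu> k) * of_real x ^ k)"
    by (intro sums_finite) (auto simp: herm_pairing_eq_0)
  ultimately show ?thesis by (rule sums_unique2)
qed

section \<open>Mellin convolutions of rapidly decaying series\<close>

lemma Gamma_has_bochner_integral:
  assumes "s > 0"
  shows "has_bochner_integral lborel (\<lambda>t::real. indicator {0<..} t * (t powr (s - 1) * exp (- t))) (Gamma s)"
proof -
  have i: "((\<lambda>t. t powr (s - 1) / exp t) has_integral Gamma s) {0..}"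
    by (rule Gamma_integral_real[OF assms])
  have "(\<integral>\<^sup>+t. ennreal (indicator {0..} t * (t powr (s - 1) / exp t)) \<partial>lborel) = ennreal (Gamma s)"
    by (rule nn_integral_has_integral_lebesgue[OF _ i]) simp
  also have "(\<integral>\<^sup>+t. ennreal (indicator {0..} t * (t powr (s - 1) / exp t)) \<partial>lborel) =
      (\<integral>\<^sup>+t. ennreal (indicator {0<..} t * (t powr (s - 1) * exp (- t))) \<partial>lborel)"
    \<comment> \<open>The integrands agree at 0 as well, because
      \<open>0 powr (s - 1) = 0\<close>.\<close>
    by (intro nn_integral_cong) (auto simp: indicator_def exp_minus field_simps)
  finally show ?thesis
    using Gamma_real_pos[OF assms] by (intro has_bochner_integral_nn_integral) auto
qed

text \<open>Includes the \<open>1 / t\<close> of the measure and is extended by 0, so that integrals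
  run over the whole line. For \<open>\<nu> = 0\<close> it is not integrable at 0; it becomes so
  after multiplication by a positive power of \<open>t\<close>, which is the reason for such powers
  in the estimates below.\<close>

definition mellin_kernel :: "nat \<Rightarrow> real \<Rightarrow> real" where
  "mellin_kernel \<nu> t = indicator {0<..} t * (t ^ \<nu> * exp (- t) / t)"

lemma mellin_kernel_measurable [measurable]: "mellin_kernel \<nu> \<in> borel_measurable borel"
  unfolding mellin_kernel_def by measurable

lemma mellin_kernel_nonneg: "mellin_kernel \<nu> t \<ge> 0"
  by (simp add: mellin_kernel_def indicator_def)

lemma mellin_kernel_powr:
  assumes "s > 0"
  shows "has_bochner_integral lborel (\<lambda>t. mellin_kernel \<nu> t * t powr s) (Gamma (\<nu> + s))"
proof -
  have "(\<lambda>t. mellin_kernel \<nu> t * t powr s) = (\<lambda>t. indicator {0<..} t * (t powr (\<nu> + s - 1) * exp (- t)))"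
    by (auto simp: mellin_kernel_def indicator_def powr_add powr_diff powr_realpow powr_minus field_simps)
  then show ?thesis using Gamma_has_bochner_integral[of "\<nu> + s"] assms by simp
qed

lemma mellin_kernel_power:
  "has_bochner_integral lborel (\<lambda>t. mellin_kernel \<nu> t * t ^ Suc k) (fact (\<nu> + k))"
proof -
  have "(\<lambda>t. mellin_kernel \<nu> t * t ^ Suc k) = (\<lambda>t. mellin_kernel \<nu> t * t powr real (Suc k))"
    by (auto simp: mellin_kernel_def indicator_def powr_realpow simp del: power_Suc of_nat_Suc)
  moreover have "Gamma (real \<nu> + real (Suc k)) = fact (\<nu> + k)"
    using Gamma_fact[of "\<nu> + k", where ?'a = real] by (simp add: add_ac)
  ultimately show ?thesis using mellin_kernel_powr[of "real (Suc k)" \<nu>] by simp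
qed

definition mellin :: "nat \<Rightarrow> (real \<Rightarrow> real) \<Rightarrow> real \<Rightarrow> real" where
  "mellin \<nu> a y = (LINT t|lborel. mellin_kernel \<nu> t * a (y / t))"

lemma mellin_measurable [measurable]:
  assumes [measurable]: "a \<in> borel_measurable borel"
  shows "mellin \<nu> a \<in> borel_measurable borel"
  unfolding mellin_def by measurable

text \<open>Fubini and the substitution \<open>y = t * z\<close>, which contributes
  \<open>t ^ Suc k\<close>; the remaining integral in \<open>t\<close> is
  \<open>Gamma (\<nu> + k + 1)\<close>. Here the factorials arise that the loops of
  \<open>f_fun\<close> divide out.\<close>

lemma mellin_moment:
  assumes [measurable]: "a \<in> borel_measurable borel" and int: "integrable lborel (\<lambda>z. z ^ k * a z)"
  shows "has_bochner_integral lborel (\<lambda>y. y ^ k * mellin \<nu> a y) (fact (\<nu> + k) * (LINT z|lborel. z ^ k * a z))"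
proof -
  define H where "H t y = mellin_kernel \<nu> t * (y ^ k * a (y / t))" for t y
  have [measurable]: "case_prod H \<in> borel_measurable (lborel \<Otimes>\<^sub>M lborel)"
    unfolding H_def by measurable
  have scale: "has_bochner_integral lborel (\<lambda>y. y ^ k * c (y / t)) (t ^ Suc k * (LINT z|lborel. z ^ k * c z))"
    if "t > 0" "integrable lborel (\<lambda>z. z ^ k * c z)" for t :: real and c
  proof -
    have eq: "(\<lambda>x. (0 + t * x) ^ k * c ((0 + t * x) / t)) = (\<lambda>x. t ^ k * (x ^ k * c x))"
      using that by (auto simp: power_mult_distrib)
    have "integrable lborel (\<lambda>y. y ^ k * c (y / t))"
      using lborel_integrable_real_affine_iff[of t "\<lambda>y. y ^ k * c (y / t)" 0] that unfolding eq by simp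
    moreover have "(LINT y|lborel. y ^ k * c (y / t)) = t ^ Suc k * (LINT z|lborel. z ^ k * c z)"
      using lborel_integral_real_affine[of t "\<lambda>y. y ^ k * c (y / t)" 0] that unfolding eq by simp
    ultimately show ?thesis by (simp add: has_bochner_integral_iff)
  qed
  have pos: "has_bochner_integral lborel (H t) (mellin_kernel \<nu> t * t ^ Suc k * (LINT z|lborel. z ^ k * a z))" for t
  proof (cases "t > 0")
    case True
    from has_bochner_integral_mult_right[OF scale[OF True int], of "mellin_kernel \<nu> t"]
    show ?thesis unfolding H_def by (simp add: mult.assoc)
  next
    case False
    then have "H t = (\<lambda>_. 0)" by (auto simp: H_def mellin_kernel_def)
    then show ?thesis using False by (simp add: mellin_kernel_def has_bochner_integral_zero)
  qed
  have norm_pos: "(LINT y|lborel. norm (H t y)) = mellin_kernel \<nu> t * t ^ Suc k * (LINT z|lborel. \<bar>z ^ k * a z\<bar>)" for t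
  proof (cases "t > 0")
    case True
    have eq: "(\<lambda>x. norm (H t (0 + t * x))) = (\<lambda>x. mellin_kernel \<nu> t * t ^ k * \<bar>x ^ k * a x\<bar>)"
      using True mellin_kernel_nonneg[of \<nu> t] by (auto simp: H_def power_mult_distrib abs_mult)
    show ?thesis
      using lborel_integral_real_affine[of t "\<lambda>y. norm (H t y)" 0] True unfolding eq by simp
  qed (auto simp: H_def mellin_kernel_def)
  have "integrable (lborel \<Otimes>\<^sub>M lborel) (case_prod H)"
  proof (rule lborel_pair.Fubini_integrable)
    show "integrable lborel (\<lambda>x. LINT y|lborel. norm (case_prod H (x, y)))"
      unfolding prod.case norm_pos
      using mellin_kernel_power by (intro integrable_mult_left) (auto simp: has_bochner_integral_iff)
    show "AE x in lborel. integrable lborel (\<lambda>y. case_prod H (x, y))"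
      using pos by (auto simp: has_bochner_integral_iff)
  qed measurable
  note F = lborel_pair.integrable_snd[OF this] lborel_pair.Fubini_integral[OF this]
  have in_t: "(LINT t|lborel. H t y) = y ^ k * mellin \<nu> a y" for y
  proof -
    have "(\<lambda>t. H t y) = (\<lambda>t. y ^ k * (mellin_kernel \<nu> t * a (y / t)))"
      by (auto simp: H_def)
    then show ?thesis unfolding mellin_def by simp
  qed
  have "(LINT t|lborel. LINT y|lborel. H t y) = fact (\<nu> + k) * (LINT z|lborel. z ^ k * a z)"
  proof -
    have "(LINT y|lborel. H t y) = mellin_kernel \<nu> t * t ^ Suc k * (LINT z|lborel. z ^ k * a z)" for t
      using pos[of t] by (simp add: has_bochner_integral_iff)
    then show ?thesis
      using has_bochner_integral_integral_eq[OF mellin_kernel_power[of \<nu> k]] by simp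
  qed
  with F show ?thesis unfolding in_t by (simp add: has_bochner_integral_iff)
qed

text \<open>The bound by arbitrary negative powers, both near 0 and near infinity, is what survives
  the logarithmic singularities at 0 created by \<^const>\<open>mellin\<close>.\<close>

definition rapid :: "(nat \<Rightarrow> real \<Rightarrow> real) \<Rightarrow> bool" where
  "rapid A \<longleftrightarrow> (\<forall>m. A m \<in> borel_measurable borel) \<and>
     (\<forall>R>0. \<forall>s>0. \<exists>C. \<forall>z N. z \<noteq> 0 \<longrightarrow> (\<Sum>m<N. \<bar>A m z\<bar> * R ^ m) \<le> C * \<bar>z\<bar> powr (- s))"

lemma rapid_measurable: "rapid A \<Longrightarrow> A m \<in> borel_measurable borel"
  by (simp add: rapid_def)

lemma rapidE:
  assumes "rapid A" "R > 0" "s > 0"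
  obtains C where "C > 0" "\<And>z N. z \<noteq> 0 \<Longrightarrow> (\<Sum>m<N. \<bar>A m z\<bar> * R ^ m) \<le> C * \<bar>z\<bar> powr (- s)"
proof -
  obtain C where C: "\<And>z N. z \<noteq> 0 \<Longrightarrow> (\<Sum>m<N. \<bar>A m z\<bar> * R ^ m) \<le> C * \<bar>z\<bar> powr (- s)"
    using assms unfolding rapid_def by meson
  have "C * \<bar>z\<bar> powr (- s) \<le> (\<bar>C\<bar> + 1) * \<bar>z\<bar> powr (- s)" for z
    by (intro mult_right_mono) auto
  with C show ?thesis
    by (intro that[of "\<bar>C\<bar> + 1"]) (auto intro: order_trans)
qed

lemma rapid_entire_coeffs:
  assumes "rapid A" "z \<noteq> 0"
  shows "entire_coeffs (\<lambda>m. of_real (A m z))"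
  unfolding entire_coeffs_def
proof (intro allI impI)
  fix R :: real assume "R \<ge> 0"
  \<comment> \<open>\<open>rapid\<close> speaks of positive radii only, whereas \<open>R = 0\<close>
    is allowed here; enlarging the radius covers it.\<close>
  then have R1: "R + 1 > 0" by simp
  obtain C where "C > 0" and C: "\<And>z N. z \<noteq> 0 \<Longrightarrow> (\<Sum>m<N. \<bar>A m z\<bar> * (R + 1) ^ m) \<le> C * \<bar>z\<bar> powr (- 1)"
    using rapidE[OF assms(1) R1, of 1] by auto
  have "summable (\<lambda>m. \<bar>A m z\<bar> * (R + 1) ^ m)"
    using C[OF assms(2)] R1 by (intro summableI_nonneg_bounded) auto
  then show "summable (\<lambda>m. norm (complex_of_real (A m z)) * R ^ m)"
    by (rule summable_comparison_test'[of _ 0]) (use \<open>R \<ge> 0\<close> in \<open>auto intro!: mult_left_mono power_mono\<close>)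
qed

text \<open>A power of \<open>y / t\<close> separates into a power of \<open>y\<close> and one of
  \<open>t\<close>, and the latter is integrable against the kernel.\<close>

lemma mellin_kernel_rapid_bound:
  assumes "y \<noteq> 0" "C > 0" "\<And>z N. z \<noteq> 0 \<Longrightarrow> (\<Sum>m<N. \<bar>A m z\<bar> * R ^ m) \<le> C * \<bar>z\<bar> powr (- s)"
  shows "mellin_kernel \<nu> t * (\<Sum>m<N. \<bar>A m (y / t)\<bar> * R ^ m) \<le> C * \<bar>y\<bar> powr (- s) * (mellin_kernel \<nu> t * t powr s)"
proof (cases "t > 0")
  case True
  have "mellin_kernel \<nu> t * (\<Sum>m<N. \<bar>A m (y / t)\<bar> * R ^ m) \<le> mellin_kernel \<nu> t * (C * \<bar>y / t\<bar> powr (- s))"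
    using assms(3)[of "y / t" N] assms(1) True by (intro mult_left_mono mellin_kernel_nonneg) simp_all
  also have "\<bar>y / t\<bar> powr (- s) = \<bar>y\<bar> powr (- s) * t powr s"
    using assms(1) True by (simp add: abs_divide powr_divide powr_minus field_simps)
  finally show ?thesis by (simp add: mult_ac)
qed (simp add: mellin_kernel_def)

lemma mellin_integrable:
  assumes "rapid A" "y \<noteq> 0"
  shows "integrable lborel (\<lambda>t. mellin_kernel \<nu> t * A m (y / t))"
proof -
  obtain C where C: "C > 0" "\<And>z N. z \<noteq> 0 \<Longrightarrow> (\<Sum>m<N. \<bar>A m z\<bar> * 1 ^ m) \<le> C * \<bar>z\<bar> powr (- 1)"
    using rapidE[OF assms(1), of 1 1] by auto
  have [measurable]: "A m \<in> borel_measurable borel" by (rule rapid_measurable[OF assms(1)])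
  have "integrable lborel (\<lambda>t. C * \<bar>y\<bar> powr (- 1) * (mellin_kernel \<nu> t * t powr 1))"
    using mellin_kernel_powr[of 1 \<nu>] by (intro integrable_mult_right) (auto simp: has_bochner_integral_iff)
  then show ?thesis
  proof (rule Bochner_Integration.integrable_bound)
    show "AE t in lborel. norm (mellin_kernel \<nu> t * A m (y / t)) \<le> norm (C * \<bar>y\<bar> powr (- 1) * (mellin_kernel \<nu> t * t powr 1))"
    proof (intro AE_I2)
      fix t
      have "\<bar>A m (y / t)\<bar> \<le> (\<Sum>m<Suc m. \<bar>A m (y / t)\<bar> * 1 ^ m)"
        by (simp add: sum_nonneg)
      then have "norm (mellin_kernel \<nu> t * A m (y / t)) \<le> mellin_kernel \<nu> t * (\<Sum>m<Suc m. \<bar>A m (y / t)\<bar> * 1 ^ m)"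
        unfolding norm_mult using mellin_kernel_nonneg[of \<nu> t] by (auto intro!: mult_left_mono)
      also have "\<dots> \<le> C * \<bar>y\<bar> powr (- 1) * (mellin_kernel \<nu> t * t powr 1)"
        by (rule mellin_kernel_rapid_bound[OF assms(2) C])
      also have "\<dots> \<le> norm (C * \<bar>y\<bar> powr (- 1) * (mellin_kernel \<nu> t * t powr 1))"
        unfolding real_norm_def by (rule abs_ge_self)
      finally show "norm (mellin_kernel \<nu> t * A m (y / t)) \<le> norm (C * \<bar>y\<bar> powr (- 1) * (mellin_kernel \<nu> t * t powr 1))" .
    qed
  qed measurable
qed

text \<open>The convolution preserves each exponent \<open>s\<close> and only multiplies the
  constant by \<open>Gamma (\<nu> + s)\<close>; so the class can be iterated \<open>M\<close>
  times.\<close>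

lemma rapid_mellin:
  assumes "rapid A"
  shows "rapid (\<lambda>m. mellin \<nu> (A m))"
  unfolding rapid_def
proof (intro conjI allI impI)
  show "mellin \<nu> (A m) \<in> borel_measurable borel" for m
    by (rule mellin_measurable[OF rapid_measurable[OF assms]])
next
  fix R s :: real assume "R > 0" "s > 0"
  obtain C where C: "C > 0" "\<And>z N. z \<noteq> 0 \<Longrightarrow> (\<Sum>m<N. \<bar>A m z\<bar> * R ^ m) \<le> C * \<bar>z\<bar> powr (- s)"
    using rapidE[OF assms \<open>R > 0\<close> \<open>s > 0\<close>] by metis
  have "(\<Sum>m<N. \<bar>mellin \<nu> (A m) y\<bar> * R ^ m) \<le> C * Gamma (\<nu> + s) * \<bar>y\<bar> powr (- s)" if "y \<noteq> 0" for y N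
  proof -
    have int: "integrable lborel (\<lambda>t. mellin_kernel \<nu> t * \<bar>A m (y / t)\<bar> * R ^ m)" for m
      using integrable_norm[OF mellin_integrable[OF assms that, of \<nu> m]] mellin_kernel_nonneg
      by (simp add: abs_mult)
    have "(\<Sum>m<N. \<bar>mellin \<nu> (A m) y\<bar> * R ^ m) \<le> (\<Sum>m<N. LINT t|lborel. mellin_kernel \<nu> t * \<bar>A m (y / t)\<bar> * R ^ m)"
    proof (intro sum_mono)
      fix m
      have "\<bar>mellin \<nu> (A m) y\<bar> \<le> (LINT t|lborel. mellin_kernel \<nu> t * \<bar>A m (y / t)\<bar>)"
        using integral_norm_bound[of lborel "\<lambda>t. mellin_kernel \<nu> t * A m (y / t)"] mellin_kernel_nonneg
        unfolding mellin_def by (simp add: abs_mult)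
      then show "\<bar>mellin \<nu> (A m) y\<bar> * R ^ m \<le> (LINT t|lborel. mellin_kernel \<nu> t * \<bar>A m (y / t)\<bar> * R ^ m)"
        using \<open>R > 0\<close> by simp
    qed
    also have "\<dots> = (LINT t|lborel. mellin_kernel \<nu> t * (\<Sum>m<N. \<bar>A m (y / t)\<bar> * R ^ m))"
      using int by (simp add: sum_distrib_left mult.assoc)
    also have "\<dots> \<le> (LINT t|lborel. C * \<bar>y\<bar> powr (- s) * (mellin_kernel \<nu> t * t powr s))"
    proof (rule integral_mono)
      show "integrable lborel (\<lambda>t. mellin_kernel \<nu> t * (\<Sum>m<N. \<bar>A m (y / t)\<bar> * R ^ m))"
        using int unfolding sum_distrib_left by (intro Bochner_Integration.integrable_sum) (simp add: mult.assoc)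
      show "integrable lborel (\<lambda>t. C * \<bar>y\<bar> powr (- s) * (mellin_kernel \<nu> t * t powr s))"
        using mellin_kernel_powr[OF \<open>s > 0\<close>, of \<nu>] by (intro integrable_mult_right) (auto simp: has_bochner_integral_iff)
    qed (rule mellin_kernel_rapid_bound[OF that C])
    also have "\<dots> = C * Gamma (\<nu> + s) * \<bar>y\<bar> powr (- s)"
      using mellin_kernel_powr[OF \<open>s > 0\<close>, of \<nu>] by (simp add: has_bochner_integral_iff)
    finally show ?thesis .
  qed
  then show "\<exists>C. \<forall>z N. z \<noteq> 0 \<longrightarrow> (\<Sum>m<N. \<bar>mellin \<nu> (A m) z\<bar> * R ^ m) \<le> C * \<bar>z\<bar> powr (- s)"
    by blast
qed

lemma norm_partial_sum_le:
  assumes "\<And>m. norm (d m) \<le> B * R ^ m" "B \<ge> 0"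
  shows "norm (\<Sum>m<N. complex_of_real (a m) * d m) \<le> B * (\<Sum>m<N. \<bar>a m\<bar> * R ^ m)"
  unfolding sum_distrib_left
proof (rule sum_norm_le)
  fix m
  have "norm (complex_of_real (a m) * d m) \<le> \<bar>a m\<bar> * (B * R ^ m)"
    unfolding norm_mult norm_of_real by (intro mult_left_mono assms) auto
  then show "norm (complex_of_real (a m) * d m) \<le> B * (\<bar>a m\<bar> * R ^ m)" by (simp add: mult_ac)
qed

text \<open>Termwise integration, dominated by the case \<open>s = 1\<close> of \<open>rapid\<close>
  at a radius larger than \<open>norm v\<close>; the added 1 keeps the radius positive at
  \<open>v = 0\<close>.\<close>

lemma mellin_series:
  assumes "rapid A" "y \<noteq> 0"
  shows "(LINT t|lborel. of_real (mellin_kernel \<nu> t) * (\<Sum>m. complex_of_real (A m (y / t)) * v ^ m)) =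
    (\<Sum>m. of_real (mellin \<nu> (A m) y) * v ^ m)"
proof -
  let ?R = "norm v + 1"
  have "?R > 0" by (simp add: add_nonneg_pos)
  obtain C where C: "C > 0" "\<And>z N. z \<noteq> 0 \<Longrightarrow> (\<Sum>m<N. \<bar>A m z\<bar> * ?R ^ m) \<le> C * \<bar>z\<bar> powr (- 1)"
    using rapidE[OF assms(1) \<open>?R > 0\<close>, of 1] by auto
  let ?s = "\<lambda>N t. of_real (mellin_kernel \<nu> t) * (\<Sum>m<N. complex_of_real (A m (y / t)) * v ^ m)"
  let ?l = "\<lambda>t. of_real (mellin_kernel \<nu> t) * (\<Sum>m. complex_of_real (A m (y / t)) * v ^ m)"
  let ?w = "\<lambda>t. C * \<bar>y\<bar> powr (- 1) * (mellin_kernel \<nu> t * t powr 1)"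
  have [measurable]: "A m \<in> borel_measurable borel" for m by (rule rapid_measurable[OF assms(1)])
  have int: "integrable lborel (\<lambda>t. complex_of_real (mellin_kernel \<nu> t) * (of_real (A m (y / t)) * v ^ m))" for m
    using integrable_mult_left[OF integrable_of_real[OF mellin_integrable[OF assms, of \<nu> m], where ?'a = complex], of "v ^ m"]
    by (simp add: mult.assoc)
  have lim: "(\<lambda>N. ?s N t) \<longlonglongrightarrow>
      ?l t" for t
  proof (cases "t > 0")
    case True
    then have "y / t \<noteq> 0" using assms(2) by simp
    from entire_coeffs_sums[OF rapid_entire_coeffs[OF assms(1) this], of v]
    show ?thesis unfolding sums_def by (rule tendsto_mult_left)
  qed (simp add: mellin_kernel_def)
  have "(\<lambda>N. LINT t|lborel. ?s N t) \<longlonglongrightarrow>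
      (LINT t|lborel. ?l t)"
  proof (rule integral_dominated_convergence[where w = ?w])
    show m: "(?s N) \<in> borel_measurable lborel" for N
      by measurable
    show "?l \<in> borel_measurable lborel"
      by (rule borel_measurable_LIMSEQ_metric[OF m lim])
    show "integrable lborel ?w"
      using mellin_kernel_powr[of 1 \<nu>] by (intro integrable_mult_right) (auto simp: has_bochner_integral_iff)
    show "AE t in lborel. norm (?s N t) \<le>
        ?w t" for N
    proof (intro AE_I2)
      fix t
      have "norm (\<Sum>m<N. complex_of_real (A m (y / t)) * v ^ m) \<le> 1 * (\<Sum>m<N. \<bar>A m (y / t)\<bar> * ?R ^ m)"
        by (rule norm_partial_sum_le) (auto simp: norm_power intro!: power_mono)
      then have "norm (?s N t) \<le>
          mellin_kernel \<nu> t * (\<Sum>m<N. \<bar>A m (y / t)\<bar> * ?R ^ m)"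
        unfolding norm_mult norm_of_real using mellin_kernel_nonneg[of \<nu> t] by (auto intro!: mult_left_mono)
      also have "\<dots> \<le> ?w t"
        by (rule mellin_kernel_rapid_bound[OF assms(2) C])
      finally show "norm (?s N t) \<le>
          ?w t" .
    qed
  qed (use lim in auto)
  moreover have "(LINT t|lborel. ?s N t) =
      (\<Sum>m<N. of_real (mellin \<nu> (A m) y) * v ^ m)" for N
  proof -
    have "(LINT t|lborel. complex_of_real (mellin_kernel \<nu> t) * (of_real (A m (y / t)) * v ^ m)) = of_real (mellin \<nu> (A m) y) * v ^ m" for m
    proof -
      have "(LINT t|lborel. complex_of_real (mellin_kernel \<nu> t) * (of_real (A m (y / t)) * v ^ m)) =
          (LINT t|lborel. complex_of_real (mellin_kernel \<nu> t * A m (y / t)) * v ^ m)"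
        by (simp add: mult.assoc)
      also have "\<dots> = (LINT t|lborel. complex_of_real (mellin_kernel \<nu> t * A m (y / t))) * v ^ m"
        by (rule integral_mult_left_zero)
      finally show ?thesis unfolding integral_complex_of_real mellin_def .
    qed
    then show ?thesis
      unfolding sum_distrib_left using int by simp
  qed
  ultimately show ?thesis
    using entire_coeffs_sums[OF rapid_entire_coeffs[OF rapid_mellin[OF assms(1)] assms(2)], of \<nu> v]
    unfolding sums_def by (auto dest: LIMSEQ_unique)
qed

section \<open>Moments of series with rapidly decaying coefficients\<close>

lemma powr_dominating_integrable:
  "integrable lborel (\<lambda>y::real. indicator {-1..1} y * \<bar>y\<bar> powr (- 1/2) + indicator (- {-1..1}) y * \<bar>y\<bar> powr (- 2))"
proof -
  have even: "integrable lborel (\<lambda>y::real. h \<bar>y\<bar>)"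
    if h: "h \<in> borel_measurable borel" "(h has_integral I) {0..}" "\<And>y. h y \<ge> 0" for h :: "real \<Rightarrow> real" and I
  proof -
    have [measurable]: "h \<in> borel_measurable borel" by fact
    have "(\<integral>\<^sup>+t. ennreal (indicator {0..} t * h t) \<partial>lborel) = ennreal I"
      by (rule nn_integral_has_integral_lebesgue[OF _ h(2)]) (rule h(3))
    also have "(\<integral>\<^sup>+t. ennreal (indicator {0..} t * h t) \<partial>lborel) = (\<integral>\<^sup>+t. ennreal (indicator {0..} t *\<^sub>R h \<bar>t\<bar>) \<partial>lborel)"
      by (intro nn_integral_cong) (auto simp: indicator_def)
    finally have "has_bochner_integral lborel (\<lambda>t. indicator {0..} t *\<^sub>R h \<bar>t\<bar>) I"
      using h(3) has_integral_nonneg[OF h(2)] by (intro has_bochner_integral_nn_integral) auto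
    from has_bochner_integral_even_function[OF this] show ?thesis
      by (auto simp: has_bochner_integral_iff)
  qed
  have "integrable lborel (\<lambda>y::real. (\<lambda>y. indicator {0<..1} y * y powr (- 1/2)) \<bar>y\<bar>)"
  proof (rule even)
    have "((\<lambda>y::real. y powr (- 1/2)) has_integral (1 powr (- 1/2 + 1) / (- 1/2 + 1))) {0..1}"
      by (rule has_integral_powr_from_0) auto
    then have "((\<lambda>y::real. if y \<in> {0..1} then y powr (- 1/2) else 0) has_integral (1 powr (- 1/2 + 1) / (- 1/2 + 1))) {0..}"
      by (subst has_integral_restrict) auto
    then show "((\<lambda>y::real. indicator {0<..1} y * y powr (- 1/2)) has_integral (1 powr (- 1/2 + 1) / (- 1/2 + 1))) {0..}"
      by (rule has_integral_eq[rotated]) (auto simp: indicator_def)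
  qed auto
  moreover have "integrable lborel (\<lambda>y::real. (\<lambda>y. indicator {1<..} y * y powr (- 2)) \<bar>y\<bar>)"
  proof (rule even)
    have "((\<lambda>y::real. y powr (- 2)) has_integral (- (1 powr (- 2 + 1)) / (- 2 + 1))) {1..}"
      by (rule has_integral_powr_to_inf) auto
    then have "((\<lambda>y::real. if y \<in> {1..} then y powr (- 2) else 0) has_integral (- (1 powr (- 2 + 1)) / (- 2 + 1))) {0..}"
      by (subst has_integral_restrict) auto
    then show "((\<lambda>y::real. indicator {1<..} y * y powr (- 2)) has_integral (- (1 powr (- 2 + 1)) / (- 2 + 1))) {0..}"
      by (rule has_integral_spike[of "{1}", rotated 2]) (auto simp: indicator_def)
  qed auto
  ultimately have "integrable lborel (\<lambda>y::real. indicator {0<..1} \<bar>y\<bar> * \<bar>y\<bar> powr (- 1/2) + indicator {1<..} \<bar>y\<bar> * \<bar>y\<bar> powr (- 2))"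
    by (rule Bochner_Integration.integrable_add)
  then show ?thesis
    by (rule Bochner_Integration.integrable_cong[THEN iffD1, rotated 2]) (auto simp: indicator_def)
qed

text \<open>Two instances of \<open>rapid\<close> are glued at \<open>\<bar>y\<bar> = 1\<close>:
  \<open>s = 1/2\<close> is integrable at 0, where \<open>\<bar>y\<bar> ^ k <= 1\<close>, and
  \<open>s = k + 2\<close> leaves \<open>\<bar>y\<bar> powr (- 2)\<close> at infinity.\<close>

lemma rapid_moment_dominated:
  assumes "rapid A" "R > 0"
  obtains w where "integrable lborel w" "\<And>y N. y \<noteq> 0 \<Longrightarrow> \<bar>y\<bar> ^ k * (\<Sum>m<N. \<bar>A m y\<bar> * R ^ m) \<le> w y"
proof -
  obtain C where C: "C > 0" "\<And>z N. z \<noteq> 0 \<Longrightarrow> (\<Sum>m<N. \<bar>A m z\<bar> * R ^ m) \<le> C * \<bar>z\<bar> powr (- (1/2))"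
    using rapidE[OF assms, of "1/2"] by auto
  obtain D where D: "D > 0" "\<And>z N. z \<noteq> 0 \<Longrightarrow> (\<Sum>m<N. \<bar>A m z\<bar> * R ^ m) \<le> D * \<bar>z\<bar> powr (- real (k + 2))"
    using rapidE[OF assms, of "real (k + 2)"] by auto
  define w where "w y = (C + D) * (indicator {-1..1} y * \<bar>y\<bar> powr (- 1/2) + indicator (- {-1..1}) y * \<bar>y\<bar> powr (- 2))" for y :: real
  have "integrable lborel w"
    unfolding w_def by (intro integrable_mult_right powr_dominating_integrable)
  moreover have "\<bar>y\<bar> ^ k * (\<Sum>m<N. \<bar>A m y\<bar> * R ^ m) \<le> w y" if "y \<noteq> 0" for y N
  proof (cases "\<bar>y\<bar> \<le> 1")
    case True
    have "\<bar>y\<bar> ^ k * (\<Sum>m<N. \<bar>A m y\<bar> * R ^ m) \<le> 1 * (C * \<bar>y\<bar> powr (- (1/2)))"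
      using True C(2)[OF that] assms(2) by (intro mult_mono power_le_one sum_nonneg) auto
    also have "\<dots> \<le> (C + D) * \<bar>y\<bar> powr (- (1/2))" using D(1) by (simp add: mult_right_mono)
    also have "\<dots> = w y" using True by (auto simp: w_def indicator_def)
    finally show ?thesis .
  next
    case False
    have "\<bar>y\<bar> ^ k * (\<Sum>m<N. \<bar>A m y\<bar> * R ^ m) \<le> \<bar>y\<bar> ^ k * (D * \<bar>y\<bar> powr (- real (k + 2)))"
      using D(2)[OF that] by (intro mult_left_mono) auto
    also have "\<dots> = D * \<bar>y\<bar> powr (- 2)"
      using that by (simp add: powr_realpow[symmetric] powr_add[symmetric] mult.left_commute)
    also have "\<dots> \<le> (C + D) * \<bar>y\<bar> powr (- 2)" using C(1) by (simp add: mult_right_mono)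
    also have "\<dots> = w y" using False by (auto simp: w_def indicator_def)
    finally show ?thesis .
  qed
  ultimately show ?thesis by (rule that)
qed

lemma rapid_moment_integrable:
  assumes "rapid A"
  shows "integrable lborel (\<lambda>y. y ^ k * A m y)"
proof -
  obtain w where w: "integrable lborel w" "\<And>y N. y \<noteq> 0 \<Longrightarrow> \<bar>y\<bar> ^ k * (\<Sum>m<N. \<bar>A m y\<bar> * 1 ^ m) \<le> w y"
    using rapid_moment_dominated[OF assms, of 1] by auto
  have [measurable]: "A m \<in> borel_measurable borel" by (rule rapid_measurable[OF assms])
  have "norm (y ^ k * A m y) \<le> norm (w y)" if "y \<noteq> 0" for y
  proof -
    have "norm (y ^ k * A m y) \<le> \<bar>y\<bar> ^ k * (\<Sum>m<Suc m. \<bar>A m y\<bar> * 1 ^ m)"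
      by (auto simp: abs_mult power_abs sum_nonneg intro!: mult_left_mono)
    also have "\<dots> \<le> w y" by (rule w(2)[OF that])
    finally show ?thesis by simp
  qed
  then have "AE y in lborel. norm (y ^ k * A m y) \<le> norm (w y)"
    using AE_lborel_singleton[of 0] by (auto elim: eventually_mono)
  then show ?thesis
    by (rule Bochner_Integration.integrable_bound[OF w(1), rotated]) measurable
qed

text \<open>The powers of \<open>v\<close> are replaced by numbers \<open>d m\<close> of at most
  geometric growth, as produced by any functional given by a contour integral. At the origin, a null
  set about which \<open>rapid\<close> is silent, \<open>q\<close> gets the value 0.\<close>

lemma rapid_series_moment:
  assumes A: "rapid A" and R: "R > 0" and d: "\<And>m. norm (d m) \<le> B * R ^ m"
  defines "q \<equiv> \<lambda>y. if y = 0 then 0 else (\<Sum>m. complex_of_real (A m y) * d m)"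
  shows "integrable lborel (\<lambda>y. of_real y ^ k * q y)"
    and "(\<lambda>m. of_real (LINT y|lborel. y ^ k * A m y) * d m) sums (LINT y|lborel. of_real y ^ k * q y)"
proof -
  have "B \<ge> 0" using d[of 0] norm_ge_zero[of "d 0"] by (simp del: norm_ge_zero)
  obtain w where w: "integrable lborel w" "\<And>y N. y \<noteq> 0 \<Longrightarrow> \<bar>y\<bar> ^ k * (\<Sum>m<N. \<bar>A m y\<bar> * R ^ m) \<le> w y"
    using rapid_moment_dominated[OF A R] by metis
  have [measurable]: "A m \<in> borel_measurable borel" for m by (rule rapid_measurable[OF A])
  define S where "S N y = (if y = 0 then 0 else of_real y ^ k * (\<Sum>m<N. complex_of_real (A m y) * d m))" for N y
  have lim: "(\<lambda>N. S N y) \<longlonglongrightarrow> of_real y ^ k * q y" for y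
  proof (cases "y = 0")
    case False
    have "summable (\<lambda>m. norm (complex_of_real (A m y) * d m))"
    proof (rule summable_comparison_test'[of "\<lambda>m. B * (norm (complex_of_real (A m y)) * R ^ m)" 0])
      show "summable (\<lambda>m. B * (norm (complex_of_real (A m y)) * R ^ m))"
        using rapid_entire_coeffs[OF A False] R unfolding entire_coeffs_def by (intro summable_mult) auto
      show "norm (norm (complex_of_real (A m y) * d m)) \<le> B * (norm (complex_of_real (A m y)) * R ^ m)" for m
        using mult_left_mono[OF d[of m], of "\<bar>A m y\<bar>"] by (simp add: norm_mult mult_ac)
    qed
    then have "(\<lambda>m. complex_of_real (A m y) * d m) sums (\<Sum>m. complex_of_real (A m y) * d m)"
      by (rule summable_sums[OF summable_norm_cancel])
    then show ?thesis
      using False unfolding S_def q_def sums_def by (auto intro!: tendsto_mult_left)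
  qed (simp add: S_def q_def)
  have bound: "AE y in lborel. norm (S N y) \<le> B * w y" for N
  proof -
    have "norm (S N y) \<le> B * w y" if "y \<noteq> 0" for y
    proof -
      have "norm (S N y) = \<bar>y\<bar> ^ k * norm (\<Sum>m<N. complex_of_real (A m y) * d m)"
        using that by (simp add: S_def norm_mult norm_power)
      also have "\<dots> \<le> \<bar>y\<bar> ^ k * (B * (\<Sum>m<N. \<bar>A m y\<bar> * R ^ m))"
        by (intro mult_left_mono norm_partial_sum_le d \<open>B \<ge> 0\<close>) auto
      also have "\<dots> \<le> B * w y"
        using mult_left_mono[OF w(2)[OF that] \<open>B \<ge> 0\<close>] by (simp add: mult_ac)
      finally show ?thesis .
    qed
    then show ?thesis using AE_lborel_singleton[of 0] by (auto elim: eventually_mono)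
  qed
  have Sm: "S N \<in> borel_measurable lborel" for N
    unfolding S_def by measurable
  have qm: "(\<lambda>y. of_real y ^ k * q y) \<in> borel_measurable lborel"
    by (rule borel_measurable_LIMSEQ_metric[OF Sm lim])
  have Bw: "integrable lborel (\<lambda>y. B * w y)" using w(1) by simp
  show "integrable lborel (\<lambda>y. of_real y ^ k * q y)"
    by (rule integrable_dominated_convergence[where s = S, OF qm Sm Bw]) (use lim bound in auto)
  have "(\<lambda>N. LINT y|lborel. S N y) \<longlonglongrightarrow> (LINT y|lborel. of_real y ^ k * q y)"
    by (rule integral_dominated_convergence[where s = S, OF qm Sm Bw]) (use lim bound in auto)
  moreover have "(LINT y|lborel. S N y) = (\<Sum>m<N. of_real (LINT y|lborel. y ^ k * A m y) * d m)" for N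
  proof -
    have "(LINT y|lborel. S N y) = (LINT y|lborel. (\<Sum>m<N. of_real (y ^ k * A m y) * d m))"
    proof (rule integral_cong_AE)
      have "S N y = (\<Sum>m<N. of_real (y ^ k * A m y) * d m)" if "y \<noteq> 0" for y
        using that by (simp add: S_def sum_distrib_left mult_ac)
      then show "AE y in lborel. S N y = (\<Sum>m<N. of_real (y ^ k * A m y) * d m)"
        using AE_lborel_singleton[of 0] by (auto elim: eventually_mono)
    qed (use Sm in measurable)
    also have "\<dots> = (\<Sum>m<N. (LINT y|lborel. of_real (y ^ k * A m y) * d m))"
      by (intro Bochner_Integration.integral_sum integrable_mult_left integrable_of_real rapid_moment_integrable A)
    also have "\<dots> = (\<Sum>m<N. of_real (LINT y|lborel. y ^ k * A m y) * d m)"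
      by (simp only: integral_mult_left_zero integral_complex_of_real)
    finally show ?thesis .
  qed
  ultimately show "(\<lambda>m. of_real (LINT y|lborel. y ^ k * A m y) * d m) sums (LINT y|lborel. of_real y ^ k * q y)"
    unfolding sums_def by simp
qed

section \<open>Series expansion of \<open>g_fun\<close>\<close>

definition gaussian_coeff :: "nat \<Rightarrow> real \<Rightarrow> real" where
  "gaussian_coeff m z = 2 ^ m / fact m * (z ^ m * exp (- z\<^sup>2))"

lemma gaussian_coeff_sums:
  "(\<lambda>m. complex_of_real (gaussian_coeff m z) * v ^ m) sums exp (- (of_real z)\<^sup>2 + 2 * of_real z * v)"
proof -
  have "(\<lambda>m. exp (- (of_real z)\<^sup>2) * ((2 * of_real z * v) ^ m /\<^sub>R fact m)) sums
      (exp (- (of_real z)\<^sup>2) * exp (2 * of_real z * v))"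
    by (intro sums_mult exp_converges)
  also have "(\<lambda>m. exp (- (complex_of_real z)\<^sup>2) * ((2 * of_real z * v) ^ m /\<^sub>R fact m)) =
      (\<lambda>m. complex_of_real (gaussian_coeff m z) * v ^ m)"
    by (auto simp: gaussian_coeff_def scaleR_conv_of_real power_mult_distrib field_simps simp flip: exp_of_real)
  finally show ?thesis by (simp add: mult_exp_exp)
qed

lemma rapid_gaussian_coeff: "rapid gaussian_coeff"
  unfolding rapid_def
proof (intro conjI allI impI)
  show "gaussian_coeff m \<in> borel_measurable borel" for m
    unfolding gaussian_coeff_def by measurable
next
  fix R s :: real assume "R > 0" "s > 0"
  \<comment> \<open>By \<open>\<bar>z\<bar> powr s <= exp (s * \<bar>z\<bar>)\<close> the power
    becomes one more exponential, and the constant is the maximum of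
    \<open>exp ((2 * R + s) * \<bar>z\<bar> - z^2)\<close>.\<close>
  have "(\<Sum>m<N. \<bar>gaussian_coeff m z\<bar> * R ^ m) \<le> exp ((2 * R + s)\<^sup>2 / 4) * \<bar>z\<bar> powr (- s)" if "z \<noteq> 0" for z N
  proof -
    have sums: "(\<lambda>m. exp (- z\<^sup>2) * ((2 * \<bar>z\<bar> * R) ^ m /\<^sub>R fact m)) sums (exp (- z\<^sup>2) * exp (2 * \<bar>z\<bar> * R))"
      by (intro sums_mult exp_converges)
    have eq: "\<bar>gaussian_coeff m z\<bar> * R ^ m = exp (- z\<^sup>2) * ((2 * \<bar>z\<bar> * R) ^ m /\<^sub>R fact m)" for m
      by (simp add: gaussian_coeff_def abs_mult power_abs power_mult_distrib field_simps)
    have "(\<Sum>m<N. \<bar>gaussian_coeff m z\<bar> * R ^ m) \<le> exp (- z\<^sup>2) * exp (2 * \<bar>z\<bar> * R)"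
      unfolding eq sums_unique[OF sums] using \<open>R > 0\<close>
      by (intro sum_le_suminf sums_summable[OF sums]) auto
    also have "\<dots> = exp (- z\<^sup>2) * exp (2 * \<bar>z\<bar> * R) * \<bar>z\<bar> powr s * \<bar>z\<bar> powr (- s)"
      using that by (simp add: powr_minus field_simps)
    also have "exp (- z\<^sup>2) * exp (2 * \<bar>z\<bar> * R) * \<bar>z\<bar> powr s \<le> exp ((2 * R + s)\<^sup>2 / 4)"
    proof -
      have "\<bar>z\<bar> \<le> exp \<bar>z\<bar>" using exp_ge_add_one_self[of "\<bar>z\<bar>"] by linarith
      then have "\<bar>z\<bar> powr s \<le> exp \<bar>z\<bar> powr s" using \<open>s > 0\<close> by (intro powr_mono2) auto
      also have "\<dots> = exp (s * \<bar>z\<bar>)" by (simp add: powr_def)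
      finally have "exp (- z\<^sup>2) * exp (2 * \<bar>z\<bar> * R) * \<bar>z\<bar> powr s \<le> exp (- z\<^sup>2) * exp (2 * \<bar>z\<bar> * R) * exp (s * \<bar>z\<bar>)"
        by (intro mult_left_mono) auto
      also have "\<dots> = exp ((2 * R + s) * \<bar>z\<bar> - z\<^sup>2)"
        unfolding mult_exp_exp by (simp add: algebra_simps)
      also have "\<dots> \<le> exp ((2 * R + s)\<^sup>2 / 4)"
      proof -
        have "0 \<le> (\<bar>z\<bar> - (2 * R + s) / 2)\<^sup>2" by simp
        also have "\<dots> = z\<^sup>2 - (2 * R + s) * \<bar>z\<bar> + (2 * R + s)\<^sup>2 / 4"
          by (simp add: power2_diff power_divide algebra_simps)
        finally show ?thesis by simp
      qed
      finally show ?thesis .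
    qed
    finally show ?thesis by (simp add: mult_right_mono)
  qed
  then show "\<exists>C. \<forall>z N. z \<noteq> 0 \<longrightarrow> (\<Sum>m<N. \<bar>gaussian_coeff m z\<bar> * R ^ m) \<le> C * \<bar>z\<bar> powr (- s)"
    by blast
qed

text \<open>The convolution with the last parameter acts first, matching
  \<open>iterated_integral\<close>, whose last variable is innermost.\<close>

primrec iter_mellin :: "(nat \<Rightarrow> nat) \<Rightarrow> nat \<Rightarrow> (nat \<Rightarrow> real \<Rightarrow> real) \<Rightarrow> nat \<Rightarrow> real \<Rightarrow> real" where
  "iter_mellin \<nu> 0 A = A"
| "iter_mellin \<nu> (Suc M) A = iter_mellin \<nu> M (\<lambda>m. mellin (\<nu> M) (A m))"

lemma rapid_iter_mellin: "rapid A \<Longrightarrow> rapid (iter_mellin \<nu> M A)"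
  by (induction M arbitrary: A) (auto intro: rapid_mellin)

lemma iter_mellin_moment:
  assumes "rapid A"
  shows "(LINT y|lborel. y ^ k * iter_mellin \<nu> M A m y) = gamma_weight M \<nu> k * (LINT z|lborel. z ^ k * A m z)"
  using assms
proof (induction M arbitrary: A)
  case (Suc M)
  have "(LINT z|lborel. z ^ k * mellin (\<nu> M) (A m) z) = fact (\<nu> M + k) * (LINT z|lborel. z ^ k * A m z)"
    using mellin_moment[OF rapid_measurable rapid_moment_integrable, OF Suc.prems Suc.prems]
    by (rule has_bochner_integral_integral_eq)
  then show ?case
    using Suc.IH[OF rapid_mellin[OF Suc.prems]] by (simp add: gamma_weight_def)
qed (simp add: gamma_weight_def)

primrec iter_integral_op :: "(nat \<Rightarrow> nat) \<Rightarrow> nat \<Rightarrow> (real \<Rightarrow> complex) \<Rightarrow> real \<Rightarrow> complex" where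
  "iter_integral_op \<nu> 0 \<phi> = \<phi>"
| "iter_integral_op \<nu> (Suc M) \<phi> =
     iter_integral_op \<nu> M (\<lambda>y. LINT t|lborel. of_real (mellin_kernel (\<nu> M) t) * \<phi> (y / t))"

text \<open>For \<open>y \<noteq> 0\<close> and \<open>t > 0\<close> the argument
  \<open>y / t\<close> avoids 0, so the operator never looks at the origin. This matters because the
  series are controlled only away from it.\<close>

lemma iter_integral_op_cong:
  assumes "\<And>z. z \<noteq> 0 \<Longrightarrow> \<phi> z = \<psi> z" "y \<noteq> 0"
  shows "iter_integral_op \<nu> M \<phi> y = iter_integral_op \<nu> M \<psi> y"
  using assms(1)
proof (induction M arbitrary: \<phi> \<psi>)
  case 0
  then show ?case using assms(2) by simp
next
  case (Suc M)
  have "(LINT t|lborel. of_real (mellin_kernel (\<nu> M) t) * \<phi> (z / t)) =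
      (LINT t|lborel. of_real (mellin_kernel (\<nu> M) t) * \<psi> (z / t))" if "z \<noteq> 0" for z
  proof (intro Bochner_Integration.integral_cong refl)
    fix t
    show "of_real (mellin_kernel (\<nu> M) t) * \<phi> (z / t) = of_real (mellin_kernel (\<nu> M) t) * \<psi> (z / t)"
      using that Suc.prems[of "z / t"] by (cases "t > 0") (auto simp: mellin_kernel_def)
  qed
  then show ?case unfolding iter_integral_op.simps by (rule Suc.IH)
qed

lemma iter_integral_op_series:
  assumes "rapid A" "y \<noteq> 0"
  shows "iter_integral_op \<nu> M (\<lambda>z. \<Sum>m. complex_of_real (A m z) * v ^ m) y =
    (\<Sum>m. of_real (iter_mellin \<nu> M A m y) * v ^ m)"
  using assms(1)
proof (induction M arbitrary: A)
  case (Suc M)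
  have "iter_integral_op \<nu> (Suc M) (\<lambda>z. \<Sum>m. complex_of_real (A m z) * v ^ m) y =
      iter_integral_op \<nu> M (\<lambda>z. \<Sum>m. complex_of_real (mellin (\<nu> M) (A m) z) * v ^ m) y"
    unfolding iter_integral_op.simps
    by (rule iter_integral_op_cong[OF _ assms(2)]) (rule mellin_series[OF Suc.prems])
  also have "\<dots> = (\<Sum>m. of_real (iter_mellin \<nu> (Suc M) A m y) * v ^ m)"
    unfolding iter_mellin.simps by (rule Suc.IH[OF rapid_mellin[OF Suc.prems]])
  finally show ?case .
qed simp

lemma iterated_integral_eq_op:
  "iterated_integral (\<lambda>h. LBINT t:{0<..}. h t / of_real t) M
     (\<lambda>t. (\<Prod>l<M. of_real (t l ^ \<nu> l * exp (- t l))) * \<phi> (y / (\<Prod>l<M. t l))) t0 =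
   iter_integral_op \<nu> M \<phi> y"
proof (induction M arbitrary: \<phi>)
  case (Suc M)
  let ?I = "\<lambda>h. LBINT t:{0<..}. h t / complex_of_real t"
  have lin: "?I (\<lambda>a. c * h a) = c * ?I h" for c h
  proof -
    have "?I (\<lambda>a. c * h a) = (LBINT t:{0<..}. c * (h t / complex_of_real t))" by simp
    then show ?thesis by (simp only: set_integral_mult_right)
  qed
  have ker: "?I (\<lambda>a. of_real (a ^ \<nu> M * exp (- a)) * \<phi> (z / a)) =
      (LINT t|lborel. of_real (mellin_kernel (\<nu> M) t) * \<phi> (z / t))" for z
    unfolding set_lebesgue_integral_def
    by (intro Bochner_Integration.integral_cong refl) (auto simp: mellin_kernel_def indicator_def)
  have "iterated_integral ?I (Suc M)
     (\<lambda>t. (\<Prod>l<Suc M. of_real (t l ^ \<nu> l * exp (- t l))) * \<phi> (y / (\<Prod>l<Suc M. t l))) t0 =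
     iterated_integral ?I M (\<lambda>t. (\<Prod>l<M. of_real (t l ^ \<nu> l * exp (- t l))) *
       (LINT a|lborel. of_real (mellin_kernel (\<nu> M) a) * \<phi> (y / (\<Prod>l<M. t l) / a))) t0"
    using iterated_integral_Suc_product[of ?I M "\<lambda>l t. of_real (t ^ \<nu> l * exp (- t))" \<phi> y "\<lambda>t. t" t0, OF lin]
    unfolding ker .
  also have "\<dots> = iter_integral_op \<nu> (Suc M) \<phi> y"
    unfolding iter_integral_op.simps by (rule Suc.IH)
  finally show ?case .
qed simp

definition g_coeff :: "nat \<Rightarrow> (nat \<Rightarrow> nat) \<Rightarrow> nat \<Rightarrow> real \<Rightarrow> real" where
  "g_coeff M \<nu> = iter_mellin \<nu> M gaussian_coeff"

lemma rapid_g_coeff: "rapid (g_coeff M \<nu>)"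
  unfolding g_coeff_def by (rule rapid_iter_mellin[OF rapid_gaussian_coeff])

lemma g_fun_eq_series:
  assumes "y \<noteq> 0"
  shows "g_fun M \<nu> y v = (\<Sum>m. of_real (g_coeff M \<nu> m y) * v ^ m)"
proof -
  have "g_fun M \<nu> y v = iterated_integral (\<lambda>h. LBINT t:{0<..}. h t / of_real t) M
     (\<lambda>t. (\<Prod>l<M. of_real (t l ^ \<nu> l * exp (- t l))) *
       (\<lambda>z. exp (- (of_real z)\<^sup>2 + 2 * of_real z * v)) (y / (\<Prod>l<M. t l))) (\<lambda>_. 0)"
    unfolding g_fun_def by (simp add: power_divide)
  also have "\<dots> = iter_integral_op \<nu> M (\<lambda>z. exp (- (of_real z)\<^sup>2 + 2 * of_real z * v)) y"
    by (rule iterated_integral_eq_op)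
  also have "\<dots> = (\<Sum>m. of_real (g_coeff M \<nu> m y) * v ^ m)"
    unfolding sums_unique[OF gaussian_coeff_sums] g_coeff_def
    by (rule iter_integral_op_series[OF rapid_gaussian_coeff assms])
  finally show ?thesis .
qed

lemma g_fun_holomorphic: "y \<noteq> 0 \<Longrightarrow> g_fun M \<nu> y holomorphic_on S"
  using entire_coeffs_holomorphic[OF rapid_entire_coeffs[OF rapid_g_coeff]]
  by (simp add: g_fun_eq_series cong: holomorphic_cong)

section \<open>Gaussian moments and the orthogonality of Hermite polynomials\<close>

definition gaussian_moment :: "nat \<Rightarrow> real" where
  "gaussian_moment q = (LINT z|lborel. exp (- z\<^sup>2) * z ^ q)"

lemma gaussian_moment_eq: "gaussian_moment q = sqrt pi * fact q / 2 ^ q * sq_exp_coeff q"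
proof (cases "even q")
  case True
  then obtain j where q: "q = 2 * j" by (auto elim: evenE)
  show ?thesis
    unfolding gaussian_moment_def q
    using has_bochner_integral_integral_eq[OF has_bochner_integral_even_function[OF gaussian_moment_even_pos[of j]]]
    by (simp add: sq_exp_coeff_def)
next
  case False
  then obtain j where q: "q = 2 * j + 1" by (auto elim: oddE)
  show ?thesis
    unfolding gaussian_moment_def q
    using has_bochner_integral_integral_eq[OF has_bochner_integral_odd_function[OF gaussian_moment_odd_pos[of j]]]
    by (simp add: sq_exp_coeff_def)
qed

text \<open>Integration by parts, read off from the closed form. At \<open>q = 0\<close> the factor
  \<open>q\<close> hides the truncated subtraction.\<close>

lemma gaussian_moment_Suc: "gaussian_moment (Suc q) = real q / 2 * gaussian_moment (q - 1)"
proof (cases q)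
  case 0
  then show ?thesis by (simp add: gaussian_moment_eq sq_exp_coeff_def)
next
  case (Suc p)
  have "real (Suc (Suc p)) * sq_exp_coeff (Suc (Suc p)) = 2 * sq_exp_coeff p"
    using sq_exp_coeff_Suc[of "Suc p", where ?'a = real] by simp
  then have "fact (Suc (Suc p)) * sq_exp_coeff (Suc (Suc p)) = real (Suc p) * fact p * (2 * sq_exp_coeff p :: real)"
    by (simp only: fact_Suc of_nat_mult mult_ac)
  then show ?thesis
    unfolding gaussian_moment_eq Suc by (simp add: field_simps del: fact_Suc of_nat_Suc)
qed

text \<open>With the monic Hermite polynomial \<open>h_j\<close>, Rodrigues' formula makes
  \<open>h_j * exp (- z^2)\<close> equal to \<open>(- 1/2)^j\<close> times the \<open>j\<close>-th
  derivative of \<open>exp (- z^2)\<close>; integrating by parts \<open>j\<close> times against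
  \<open>z ^ m\<close> kills all \<open>m < j\<close>. Each induction step is one such integration
  by parts, carried out on the moments.\<close>

lemma herm_pairing_gaussian_moment:
  "(\<Sum>k\<le>j. herm_pairing j k * gaussian_moment (k + m)) =
    (if j \<le> m then sqrt pi * fact m / 2 ^ m * sq_exp_coeff (m - j) else 0)"
proof (induction j arbitrary: m)
  case 0
  then show ?case by (simp add: gaussian_moment_eq)
next
  case (Suc j)
  \<comment> \<open>The factor \<open>k\<close> makes \<open>g 0\<close> vanish and
    \<open>herm_pairing\<close> vanishes beyond \<open>j\<close>, so the index shift below loses
    nothing.\<close>
  define g where "g k = real k / 2 * herm_pairing j k * gaussian_moment (k - 1 + m)" for k
  have "(\<Sum>k\<le>Suc j. herm_pairing (Suc j) k * gaussian_moment (k + m)) =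
      (\<Sum>k\<le>Suc j. (if k = 0 then 0 else herm_pairing j (k - 1)) * gaussian_moment (k + m)) - (\<Sum>k\<le>Suc j. g (Suc k))"
    unfolding sum_subtractf[symmetric] by (intro sum.cong) (auto simp: g_def algebra_simps)
  also have "(\<Sum>k\<le>Suc j. (if k = 0 then 0 else herm_pairing j (k - 1)) * gaussian_moment (k + m)) =
      (\<Sum>k\<le>j. herm_pairing j k * gaussian_moment (Suc (k + m)))"
    by (subst sum.atMost_Suc_shift) simp
  also have "(\<Sum>k\<le>Suc j. g (Suc k)) = (\<Sum>k\<le>j. g k)"
  proof -
    have "(\<Sum>k\<le>Suc (Suc j). g k) = (\<Sum>k\<le>Suc j. g (Suc k))"
      by (subst sum.atMost_Suc_shift) (simp add: g_def)
    moreover have "(\<Sum>k\<le>Suc (Suc j). g k) = (\<Sum>k\<le>j. g k)"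
      by (simp add: g_def herm_pairing_eq_0)
    ultimately show ?thesis by simp
  qed
  also have "(\<Sum>k\<le>j. herm_pairing j k * gaussian_moment (Suc (k + m))) - (\<Sum>k\<le>j. g k) =
      real m / 2 * (\<Sum>k\<le>j. herm_pairing j k * gaussian_moment (k + (m - 1)))"
    unfolding sum_subtractf[symmetric] sum_distrib_left
  proof (intro sum.cong refl)
    fix k :: nat
    \<comment> \<open>Truncated subtraction disturbs the index identities when \<open>k\<close> or
      \<open>m\<close> is 0; there the factor \<open>k\<close> in \<open>g\<close> or the factor
      \<open>m\<close> on the right is 0 as well.\<close>
    consider "k = 0" | "m = 0" "k > 0" | "m > 0" "k > 0" by (cases k; cases m) auto
    then show "herm_pairing j k * gaussian_moment (Suc (k + m)) - g k =
        real m / 2 * (herm_pairing j k * gaussian_moment (k + (m - 1)))"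
    proof cases
      case 3
      then have "k + m - 1 = k + (m - 1)" "k - 1 + m = k + (m - 1)" by auto
      then show ?thesis unfolding g_def gaussian_moment_Suc by (simp add: field_simps)
    qed (auto simp: g_def gaussian_moment_Suc)
  qed
  also have "\<dots> = (if Suc j \<le> m then sqrt pi * fact m / 2 ^ m * sq_exp_coeff (m - Suc j) else 0)"
    unfolding Suc.IH by (cases m) (auto simp: field_simps)
  finally show ?case .
qed

text \<open>The \<open>gamma_weight\<close> from the loops cancels the one from the moments, and
  \<open>M\<close> disappears. The right-hand side is the coefficient of \<open>v ^ m\<close> in
  \<open>sqrt pi * v ^ j * exp (v^2)\<close>.\<close>

lemma herm_pairing_g_coeff:
  "(\<Sum>k\<le>j. herm_pairing j k / gamma_weight M \<nu> k * (LINT y|lborel. y ^ k * g_coeff M \<nu> m y)) =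
    (if j \<le> m then sqrt pi * sq_exp_coeff (m - j) else 0)"
proof -
  have "(LINT z|lborel. z ^ k * gaussian_coeff m z) = 2 ^ m / fact m * gaussian_moment (k + m)" for k
  proof -
    have "(\<lambda>z. z ^ k * gaussian_coeff m z) = (\<lambda>z. 2 ^ m / fact m * (exp (- z\<^sup>2) * z ^ (k + m)))"
      by (auto simp: gaussian_coeff_def power_add)
    then show ?thesis unfolding gaussian_moment_def by simp
  qed
  then have "(\<Sum>k\<le>j. herm_pairing j k / gamma_weight M \<nu> k * (LINT y|lborel. y ^ k * g_coeff M \<nu> m y)) =
      (\<Sum>k\<le>j. 2 ^ m / fact m * (herm_pairing j k * gaussian_moment (k + m)))"
    using gamma_weight_pos[of M \<nu>] unfolding g_coeff_def iter_mellin_moment[OF rapid_gaussian_coeff]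
    by (intro sum.cong) (auto simp: field_simps less_imp_neq[symmetric])
  also have "\<dots> = (if j \<le> m then sqrt pi * sq_exp_coeff (m - j) else 0)"
    unfolding sum_distrib_left[symmetric] herm_pairing_gaussian_moment by simp
  finally show ?thesis .
qed

text \<open>The family \<open>d\<close> will be \<open>m \<mapsto> \<Lambda> (\<lambda>v. v ^ m * exp (- v\<^sup>2))\<close> for a linear functional \<open>\<Lambda>\<close>; then
  \<open>q y = \<Lambda> (\<lambda>v. g_fun M \<nu> y v * exp (- v\<^sup>2))\<close>, and the right-hand side is \<open>sqrt pi * \<Lambda> (\<lambda>v. v ^ j)\<close>.\<close>

lemma f_fun_pairing_sums:
  fixes M :: nat and \<nu> :: "nat \<Rightarrow> nat"
  assumes C: "encircles_anticlockwise C {0}" and R: "R > 0" and d: "\<And>m. norm (d m) \<le> B * R ^ m"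
  defines "q \<equiv> \<lambda>y. if y = 0 then 0 else (\<Sum>m. complex_of_real (g_coeff M \<nu> m y) * d m)"
  shows "integrable lborel (\<lambda>y. gauss_mean (\<lambda>u. f_fun C M \<nu> y u * u ^ j) * q y)"
    and "(\<lambda>m. of_real (if j \<le> m then sqrt pi * sq_exp_coeff (m - j) else 0) * d m) sums
      (LINT y|lborel. gauss_mean (\<lambda>u. f_fun C M \<nu> y u * u ^ j) * q y)"
proof -
  have M: "integrable lborel (\<lambda>y. of_real y ^ k * q y)"
      "(\<lambda>m. of_real (LINT y|lborel. y ^ k * g_coeff M \<nu> m y) * d m) sums (LINT y|lborel. of_real y ^ k * q y)" for k
    unfolding q_def by (rule rapid_series_moment[OF rapid_g_coeff R d])+
  let ?c = "\<lambda>k. complex_of_real (herm_pairing j k / gamma_weight M \<nu> k)"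
  have eq: "(\<lambda>y. gauss_mean (\<lambda>u. f_fun C M \<nu> y u * u ^ j) * q y) =
      (\<lambda>y. \<Sum>k\<le>j. ?c k * (of_real y ^ k * q y))"
    unfolding gauss_mean_f_fun_power[OF C] by (simp add: sum_distrib_right mult.assoc)
  show "integrable lborel (\<lambda>y. gauss_mean (\<lambda>u. f_fun C M \<nu> y u * u ^ j) * q y)"
    unfolding eq by (intro Bochner_Integration.integrable_sum integrable_mult_right M(1))
  have int: "(LINT y|lborel. gauss_mean (\<lambda>u. f_fun C M \<nu> y u * u ^ j) * q y) =
      (\<Sum>k\<le>j. ?c k * (LINT y|lborel. of_real y ^ k * q y))"
    unfolding eq
    by (subst Bochner_Integration.integral_sum) (auto intro!: integrable_mult_right M(1))
  have "(\<lambda>m. \<Sum>k\<le>j. ?c k * (of_real (LINT y|lborel. y ^ k * g_coeff M \<nu> m y) * d m)) sums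
      (\<Sum>k\<le>j. ?c k * (LINT y|lborel. of_real y ^ k * q y))"
    by (intro sums_sum sums_mult M(2))
  also have "(\<lambda>m. \<Sum>k\<le>j. ?c k * (of_real (LINT y|lborel. y ^ k * g_coeff M \<nu> m y) * d m)) =
      (\<lambda>m. of_real (if j \<le> m then sqrt pi * sq_exp_coeff (m - j) else 0) * d m)"
    unfolding herm_pairing_g_coeff[of j M \<nu>, symmetric] by (simp add: sum_distrib_right mult.assoc)
  finally show "(\<lambda>m. of_real (if j \<le> m then sqrt pi * sq_exp_coeff (m - j) else 0) * d m) sums
      (LINT y|lborel. gauss_mean (\<lambda>u. f_fun C M \<nu> y u * u ^ j) * q y)"
    unfolding int .
qed

section \<open>Divided differences\<close>

definition node_poly :: "(nat \<Rightarrow> real) \<Rightarrow> nat \<Rightarrow> complex \<Rightarrow> complex" where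
  "node_poly b j u = (\<Prod>l<j. (u - of_real (b l)))"

lemma node_poly_0 [simp]: "node_poly b 0 u = 1"
  by (simp add: node_poly_def)

lemma node_poly_Suc: "node_poly b (Suc j) u = node_poly b j u * (u - of_real (b j))"
  by (simp add: node_poly_def)

lemma node_poly_eq_0_iff: "node_poly b j u = 0 \<longleftrightarrow> (\<exists>l<j. u = of_real (b l))"
  by (auto simp: node_poly_def)

lemma node_poly_holomorphic [holomorphic_intros]: "node_poly b j holomorphic_on S"
  unfolding node_poly_def by (intro holomorphic_intros)

lemma node_poly_continuous [continuous_intros]: "continuous_on S (node_poly b j)"
  unfolding node_poly_def by (intro continuous_intros)

lemma node_poly_telescope:
  assumes "u \<noteq> v" "node_poly b n v \<noteq> 0"
  shows "(\<Sum>j<n. node_poly b j u / node_poly b (Suc j) v) = (1 - node_poly b n u / node_poly b n v) / (v - u)"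
  using assms(2)
proof (induction n)
  case (Suc n)
  have nz: "node_poly b n v \<noteq> 0" "v - of_real (b n) \<noteq> 0"
    using Suc.prems by (auto simp: node_poly_Suc)
  have "(\<Sum>j<Suc n. node_poly b j u / node_poly b (Suc j) v) =
      (1 - node_poly b n u / node_poly b n v) / (v - u) + node_poly b n u / node_poly b (Suc n) v"
    using Suc.IH nz by simp
  also have "\<dots> = (1 - node_poly b (Suc n) u / node_poly b (Suc n) v) / (v - u)"
    using nz assms(1) by (simp add: node_poly_Suc divide_simps) (simp add: algebra_simps)
  finally show ?case .
qed simp

text \<open>For an entire function \<open>h\<close> this is the divided difference of \<open>h\<close> at \<open>b 0, \<dots>, b j\<close>, repeated
  nodes being allowed.\<close>

definition divdiff :: "real \<Rightarrow> (nat \<Rightarrow> real) \<Rightarrow> nat \<Rightarrow> (complex \<Rightarrow> complex) \<Rightarrow> complex" where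
  "divdiff R b j h = contour_integral (circlepath 0 R) (\<lambda>v. h v / node_poly b (Suc j) v) / (2 * pi * \<i>)"

lemma contour_integral_sum_cmult:
  assumes "finite I" "\<And>i. i \<in> I \<Longrightarrow> G i contour_integrable_on \<gamma>"
  shows "contour_integral \<gamma> (\<lambda>v. \<Sum>i\<in>I. c i * G i v) = (\<Sum>i\<in>I. c i * contour_integral \<gamma> (G i))"
  using assms
  by (subst contour_integral_sum) (auto intro!: contour_integrable_lmul contour_integral_lmul sum.cong)

text \<open>A fixed circle about 0 instead of a contour adapted to the nodes: it serves all node
  vectors close to \<open>b\<close> at once, as the passage to coinciding nodes requires, and
  \<open>v ^ m\<close> has the constant modulus \<open>R ^ m\<close> on it.\<close>

locale nodes_in_disc =
  fixes R :: real and b :: "nat \<Rightarrow> real" and n :: nat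
  assumes R_pos: "R > 0" and nodes: "\<And>l. l < n \<Longrightarrow> \<bar>b l\<bar> < R"
begin

lemma node_poly_nz: "j \<le> n \<Longrightarrow> v \<in> sphere 0 R \<Longrightarrow> node_poly b j v \<noteq> 0"
  by (auto simp: node_poly_eq_0_iff dest: nodes[OF less_le_trans])

lemma divdiff_integrable:
  assumes "j < n" "continuous_on (sphere 0 R) h"
  shows "(\<lambda>v. h v / node_poly b (Suc j) v) contour_integrable_on circlepath 0 R"
  using assms R_pos node_poly_nz[of "Suc j"]
  by (intro contour_integrable_continuous_circlepath continuous_intros) auto

lemma divdiff_cmult: "divdiff R b j (\<lambda>v. c * h v) = c * divdiff R b j h"
  unfolding divdiff_def contour_integral_integral by (simp add: mult.assoc flip: times_divide_eq_right)

lemma divdiff_add: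
  assumes "j < n" "continuous_on (sphere 0 R) h" "continuous_on (sphere 0 R) h'"
  shows "divdiff R b j (\<lambda>v. h v + h' v) = divdiff R b j h + divdiff R b j h'"
  unfolding divdiff_def add_divide_distrib using assms
  by (subst contour_integral_add) (auto intro: divdiff_integrable simp: add_divide_distrib)

lemma divdiff_sum:
  assumes "j < n" "\<And>i. i \<in> I \<Longrightarrow> continuous_on (sphere 0 R) (h i)"
  shows "divdiff R b j (\<lambda>v. \<Sum>i\<in>I. h i v) = (\<Sum>i\<in>I. divdiff R b j (h i))"
  using assms(2)
proof (induction I rule: infinite_finite_induct)
  case (insert x F)
  then show ?case using assms(1) by (simp add: divdiff_add continuous_on_sum)
qed (simp_all add: divdiff_def)

text \<open>For \<open>j = 0\<close> this is Cauchy's formula. For \<open>j > 0\<close> all poles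
  lie inside the circle and the integrand is of order \<open>r ^ (- 2)\<close> or smaller, so
  enlarging the radius \<open>r\<close> shows that the integral is 0.\<close>

lemma divdiff_one: "j < n \<Longrightarrow> divdiff R b j (\<lambda>_. 1) = (if j = 0 then 1 else 0)"
proof (cases "j = 0")
  case True
  assume "j < n"
  have "((\<lambda>v. 1 / (v - of_real (b 0))) has_contour_integral (2 * pi * \<i> * 1)) (circlepath 0 R)"
    using Cauchy_integral_circlepath[of 0 R "\<lambda>_. 1" "of_real (b 0)"] nodes[of 0] \<open>j < n\<close> True by simp
  then show ?thesis
    using True unfolding divdiff_def by (simp add: node_poly_def contour_integral_unique)
next
  case False
  assume "j < n"
  let ?f = "\<lambda>v. 1 / node_poly b (Suc j) v" and ?A = "(\<lambda>l. complex_of_real (b l)) ` {..<Suc j}"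
  define I where "I = contour_integral (circlepath 0 R) ?f"
  \<comment> \<open>On the circle of radius \<open>r >= 2 * R\<close> each factor of the node
    polynomial is at least \<open>r / 2\<close>. There are at least two of them, and
    \<open>r / 2 >= 1\<close> allows the others to be dropped; then \<open>4 / r^2\<close> times the
    length \<open>2 * pi * r\<close>.\<close>
  have bound: "norm I \<le> 8 * pi / r" if r: "r \<ge> 2 * R" "r \<ge> 2" for r
  proof -
    have "r > R" using r R_pos by linarith
    have "\<bar>b l\<bar> < R" if "l < Suc j" for l using nodes[of l] that \<open>j < n\<close> by linarith
    then have A: "?A \<subseteq> ball 0 R" by (auto simp: dist_norm)
    have hol: "?f holomorphic_on - ?A"
      by (intro holomorphic_intros) (auto simp: node_poly_eq_0_iff)
    have "I = contour_integral (circlepath 0 r) ?f"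
      unfolding I_def using A \<open>r > R\<close> R_pos
      by (intro contour_integral_encircles_eq[OF _ _ _ hol] encircles_circlepath) auto
    moreover have "?f contour_integrable_on circlepath 0 r"
      using A \<open>r > R\<close> R_pos
      by (intro contour_integrable_continuous_circlepath holomorphic_on_imp_continuous_on[OF holomorphic_on_subset[OF hol]])
        auto
    ultimately have I: "(?f has_contour_integral I) (circlepath 0 r)"
      by (simp add: has_contour_integral_integral)
    have "norm I \<le> 4 / r\<^sup>2 * (2 * pi * r)"
    proof (rule has_contour_integral_bound_circlepath[OF I])
      fix v :: complex assume v: "norm (v - 0) = r"
      have l: "r / 2 \<le> norm (v - of_real (b l))" if "l \<le> j" for l
      proof -
        have "\<bar>b l\<bar> < R" using nodes that \<open>j < n\<close> by simp
        moreover have "norm v - norm (complex_of_real (b l)) \<le> norm (v - of_real (b l))"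
          by (rule norm_triangle_ineq2)
        ultimately show ?thesis using v r by simp
      qed
      have "(r / 2) ^ 2 \<le> (r / 2) ^ Suc j"
        using r False by (intro power_increasing) auto
      also have "\<dots> = (\<Prod>l<Suc j. r / 2)" by simp
      also have "\<dots> \<le> (\<Prod>l<Suc j. norm (v - of_real (b l)))"
        using r l by (intro prod_mono) auto
      also have "\<dots> = norm (node_poly b (Suc j) v)"
        unfolding node_poly_def prod_norm ..
      finally have "r\<^sup>2 / 4 \<le> norm (node_poly b (Suc j) v)" by (simp add: power_divide)
      moreover have "r\<^sup>2 / 4 > 0" using r by simp
      ultimately have "1 / norm (node_poly b (Suc j) v) \<le> 1 / (r\<^sup>2 / 4)"
        by (intro divide_left_mono mult_pos_pos) auto
      then show "norm (?f v) \<le> 4 / r\<^sup>2" by (simp add: norm_divide)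
    qed (use r in auto)
    also have "\<dots> = 8 * pi / r" using r by (simp add: power2_eq_square)
    finally show ?thesis .
  qed
  have "((\<lambda>r::real. 8 * pi / r) \<longlongrightarrow> 0) at_top" by real_asymp
  moreover have "eventually (\<lambda>r. norm I \<le> 8 * pi / r) at_top"
    using eventually_ge_at_top[of "2 * R"] eventually_ge_at_top[of 2]
    by eventually_elim (rule bound)
  ultimately have "norm I \<le> 0" by (intro tendsto_lowerbound[of _ 0 at_top]) auto
  then show ?thesis using False unfolding divdiff_def I_def[symmetric] by simp
qed

lemma divdiff_mult_node:
  assumes "Suc j < n" "continuous_on (sphere 0 R) h"
  shows "divdiff R b (Suc j) (\<lambda>v. (v - of_real (b (Suc j))) * h v) = divdiff R b j h"
proof -
  have "contour_integral (circlepath 0 R) (\<lambda>v. (v - of_real (b (Suc j))) * h v / node_poly b (Suc (Suc j)) v) =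
      contour_integral (circlepath 0 R) (\<lambda>v. h v / node_poly b (Suc j) v)"
  proof (intro contour_integral_eq)
    fix v assume "v \<in> path_image (circlepath 0 R)"
    then have "node_poly b (Suc (Suc j)) v \<noteq> 0"
      using node_poly_nz[of "Suc (Suc j)" v] assms(1) R_pos by (simp add: path_image_circlepath)
    then show "(v - of_real (b (Suc j))) * h v / node_poly b (Suc (Suc j)) v = h v / node_poly b (Suc j) v"
      by (simp add: node_poly_Suc)
  qed
  then show ?thesis unfolding divdiff_def by simp
qed

lemma divdiff_power: "k \<le> j \<Longrightarrow> j < n \<Longrightarrow> divdiff R b j (\<lambda>v. v ^ k) = (if j = k then 1 else 0)"
proof (induction k arbitrary: j)
  case 0
  then show ?case using divdiff_one by simp
next
  case (Suc k)
  then obtain i where i: "j = Suc i" by (cases j) auto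
  \<comment> \<open>Splitting off \<open>v - b j\<close> cancels the last node, which lowers the
    order and the exponent together; the remainder has a lower exponent only and vanishes.\<close>
  have "divdiff R b j (\<lambda>v. v ^ Suc k) =
      divdiff R b j (\<lambda>v. (v - of_real (b j)) * v ^ k + of_real (b j) * v ^ k)"
    by (simp add: algebra_simps)
  also have "\<dots> = divdiff R b i (\<lambda>v. v ^ k) + of_real (b j) * divdiff R b j (\<lambda>v. v ^ k)"
    using Suc.prems unfolding i
    by (subst divdiff_add) (auto intro!: continuous_intros simp: divdiff_mult_node divdiff_cmult continuous_intros)
  also have "\<dots> = (if j = Suc k then 1 else 0)"
    using Suc i by auto
  finally show ?case .
qed

text \<open>Cauchy's formula with \<open>1 / (v - b k)\<close> expanded by
  \<open>node_poly_telescope\<close>. The interpolation is exact because the remainder contains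
  \<open>node_poly b n\<close>, which is 0 at each node.\<close>

lemma divdiff_newton:
  assumes "h holomorphic_on UNIV" "k < n"
  shows "h (of_real (b k)) = (\<Sum>j<n. node_poly b j (of_real (b k)) * divdiff R b j h)"
proof -
  have cont: "continuous_on S h" for S
    using assms(1) by (meson holomorphic_on_imp_continuous_on holomorphic_on_subset subset_UNIV)
  have "((\<lambda>v. h v / (v - of_real (b k))) has_contour_integral (2 * pi * \<i> * h (of_real (b k)))) (circlepath 0 R)"
    using Cauchy_integral_circlepath[OF cont holomorphic_on_subset[OF assms(1) subset_UNIV], of "of_real (b k)" 0 R]
      nodes[OF assms(2)] by simp
  then have "2 * pi * \<i> * h (of_real (b k)) = contour_integral (circlepath 0 R) (\<lambda>v. h v / (v - of_real (b k)))"
    by (simp add: contour_integral_unique)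
  also have "\<dots> = contour_integral (circlepath 0 R) (\<lambda>v. \<Sum>j<n. node_poly b j (of_real (b k)) * (h v / node_poly b (Suc j) v))"
  proof (intro contour_integral_eq)
    fix v assume v: "v \<in> path_image (circlepath 0 R)"
    then have v': "v \<in> sphere 0 R" using R_pos by (simp add: path_image_circlepath)
    then have "of_real (b k) \<noteq> v" using nodes[OF assms(2)] by auto
    moreover have "node_poly b n (of_real (b k)) = 0" using assms(2) by (auto simp: node_poly_eq_0_iff)
    ultimately have "(\<Sum>j<n. node_poly b j (of_real (b k)) / node_poly b (Suc j) v) = 1 / (v - of_real (b k))"
      using node_poly_telescope[of "of_real (b k)" v b n] node_poly_nz[OF order_refl v'] by simp
    then have "h v / (v - of_real (b k)) = h v * (\<Sum>j<n. node_poly b j (of_real (b k)) / node_poly b (Suc j) v)"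
      by simp
    then show "h v / (v - of_real (b k)) = (\<Sum>j<n. node_poly b j (of_real (b k)) * (h v / node_poly b (Suc j) v))"
      by (simp add: sum_distrib_left mult_ac)
  qed
  also have "\<dots> = (\<Sum>j<n. node_poly b j (of_real (b k)) * contour_integral (circlepath 0 R) (\<lambda>v. h v / node_poly b (Suc j) v))"
    by (intro contour_integral_sum_cmult divdiff_integrable cont) auto
  finally show ?thesis
    unfolding divdiff_def by (simp add: sum_divide_distrib[symmetric] field_simps)
qed

text \<open>Newton's formula factors the matrix of values through a triangular matrix. The
  determinant of the latter, the Vandermonde factor, isolates what is lost when nodes merge.\<close>

lemma det_values_eq_det_divdiff:
  assumes "\<And>i. i < n \<Longrightarrow> h i holomorphic_on UNIV"
  shows "Determinant.det (mat n n (\<lambda>(i, k). h i (of_real (b k)))) =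
    Determinant.det (mat n n (\<lambda>(i, j). divdiff R b j (h i))) * of_real (vandermonde n b)"
proof -
  let ?H = "mat n n (\<lambda>(i, k). h i (of_real (b k)))" and ?D = "mat n n (\<lambda>(i, j). divdiff R b j (h i))"
  let ?N = "mat n n (\<lambda>(j, k). node_poly b j (of_real (b k)))"
  have "?H = ?D * ?N"
    by (rule eq_matI) (auto simp: scalar_prod_def divdiff_newton[OF assms] lessThan_atLeast0 mult.commute intro!: sum.cong)
  then have "Determinant.det ?H = Determinant.det ?D * Determinant.det ?N"
    by (simp add: det_mult[of _ n])
  also have "Determinant.det ?N = prod_list (diag_mat ?N)"
    by (rule det_upper_triangular[of _ n]) (auto simp: upper_triangular_def node_poly_eq_0_iff)
  also have "\<dots> = (\<Prod>j<n. node_poly b j (of_real (b j)))"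
    unfolding prod_list_diag_prod by (auto simp: lessThan_atLeast0 intro!: prod.cong)
  also have "\<dots> = of_real (vandermonde n b)"
    by (simp add: vandermonde_def node_poly_def)
  finally show ?thesis .
qed

lemma divdiff_series:
  assumes "entire_coeffs a" "j < n" "continuous_on (sphere 0 R) w"
  shows "(\<lambda>m. a m * divdiff R b j (\<lambda>v. v ^ m * w v)) sums divdiff R b j (\<lambda>v. (\<Sum>m. a m * v ^ m) * w v)"
proof -
  let ?p = "\<lambda>m v. v ^ m * w v / node_poly b (Suc j) v"
  let ?W = "\<lambda>v. w v / node_poly b (Suc j) v"
  have contW: "continuous_on (sphere 0 R) ?W"
    using node_poly_nz[of "Suc j"] assms
    by (intro continuous_intros) auto
  then have "bounded (?W ` sphere 0 R)"
    by (intro compact_imp_bounded compact_continuous_image) auto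
  then obtain B where B: "\<And>v. v \<in> sphere 0 R \<Longrightarrow> norm (?W v) \<le> B"
    unfolding bounded_iff by blast
  have int: "(?p m) contour_integrable_on circlepath 0 R" for m
    by (intro divdiff_integrable assms continuous_intros)
  have ul: "uniform_limit (sphere 0 R) (\<lambda>N v. \<Sum>m<N. a m * ?p m v)
      (\<lambda>v. \<Sum>m. a m * ?p m v) sequentially"
  proof (rule Weierstrass_m_test)
    show "norm (a m * ?p m v) \<le> norm (a m) * R ^ m * B" if v: "v \<in> sphere 0 R" for m v
    proof -
      have "norm (a m * ?p m v) = norm (a m) * R ^ m * norm (?W v)"
        using v by (simp add: norm_mult norm_power norm_divide)
      also have "\<dots> \<le> norm (a m) * R ^ m * B"
        using B[OF v] R_pos by (intro mult_left_mono) auto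
      finally show ?thesis .
    qed
    show "summable (\<lambda>m. norm (a m) * R ^ m * B)"
      using assms(1) R_pos unfolding entire_coeffs_def by (intro summable_mult2) auto
  qed
  have "\<forall>\<^sub>F N in sequentially. (\<lambda>v. \<Sum>m<N. a m * ?p m v) contour_integrable_on circlepath 0 R"
    by (intro always_eventually allI contour_integrable_sum finite_lessThan contour_integrable_lmul int)
  from contour_integral_uniform_limit_circlepath(2)[OF this ul sequentially_bot R_pos]
  have "(\<lambda>N. contour_integral (circlepath 0 R) (\<lambda>v. \<Sum>m<N. a m * ?p m v)) \<longlonglongrightarrow>
      contour_integral (circlepath 0 R) (\<lambda>v. \<Sum>m. a m * ?p m v)" .
  also have "(\<lambda>v. \<Sum>m. a m * ?p m v) =
      (\<lambda>v. (\<Sum>m. a m * v ^ m) * w v / node_poly b (Suc j) v)"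
  proof
    fix v
    have "(\<lambda>m. a m * v ^ m * (w v / node_poly b (Suc j) v)) sums ((\<Sum>m. a m * v ^ m) * (w v / node_poly b (Suc j) v))"
      by (intro sums_mult2 entire_coeffs_sums assms)
    then show "(\<Sum>m. a m * ?p m v) = (\<Sum>m. a m * v ^ m) * w v / node_poly b (Suc j) v"
      by (simp add: sums_iff mult.assoc)
  qed
  also have "(\<lambda>N. contour_integral (circlepath 0 R) (\<lambda>v. \<Sum>m<N. a m * ?p m v)) =
      (\<lambda>N. \<Sum>m<N. a m * contour_integral (circlepath 0 R) (?p m))"
    by (intro ext contour_integral_sum_cmult int finite_lessThan)
  finally have "(\<lambda>m. a m * contour_integral (circlepath 0 R) (?p m)) sums
      contour_integral (circlepath 0 R) (\<lambda>v. (\<Sum>m. a m * v ^ m) * w v / node_poly b (Suc j) v)"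
    unfolding sums_def .
  from sums_divide[OF this, of "2 * pi * \<i>"] show ?thesis
    unfolding divdiff_def by simp
qed

lemma divdiff_power_bound:
  assumes "j < n" "continuous_on (sphere 0 R) w"
  obtains B where "\<And>m. norm (divdiff R b j (\<lambda>v. v ^ m * w v)) \<le> B * R ^ m"
proof -
  let ?W = "\<lambda>v. w v / node_poly b (Suc j) v"
  have contW: "continuous_on (sphere 0 R) ?W"
    using node_poly_nz[of "Suc j"] assms
    by (intro continuous_intros) auto
  then have "bounded (?W ` sphere 0 R)"
    by (intro compact_imp_bounded compact_continuous_image) auto
  then obtain B where B: "B > 0" "\<And>v. v \<in> sphere 0 R \<Longrightarrow> norm (?W v) \<le> B"
    by (auto simp: bounded_pos)
  have "norm (divdiff R b j (\<lambda>v. v ^ m * w v)) \<le> B * R * R ^ m" for m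
  proof -
    have int: "(\<lambda>v. v ^ m * w v / node_poly b (Suc j) v) contour_integrable_on circlepath 0 R"
      by (intro divdiff_integrable assms continuous_intros)
    have "norm (contour_integral (circlepath 0 R) (\<lambda>v. v ^ m * w v / node_poly b (Suc j) v)) \<le> R ^ m * B * (2 * pi * R)"
    proof (rule has_contour_integral_bound_circlepath[OF has_contour_integral_integral[OF int]])
      fix v :: complex assume "norm (v - 0) = R"
      then have v: "v \<in> sphere 0 R" "norm v = R" by auto
      have "norm (v ^ m * w v / node_poly b (Suc j) v) = R ^ m * norm (?W v)"
        using v by (simp add: norm_mult norm_power norm_divide)
      also have "\<dots> \<le> R ^ m * B" using B v R_pos by (intro mult_left_mono) auto
      finally show "norm (v ^ m * w v / node_poly b (Suc j) v) \<le> R ^ m * B" .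
    qed (use B R_pos in auto)
    then show ?thesis
      unfolding divdiff_def norm_divide using pi_gt_zero by (simp add: norm_mult divide_le_eq mult_ac)
  qed
  then show ?thesis by (rule that)
qed

end

text \<open>Common factors cancel. If \<open>i <= j\<close>, the divided difference of 1 at the
  remaining nodes is left; otherwise a polynomial, whose integral over the circle is 0.\<close>

lemma divdiff_node_poly:
  assumes "nodes_in_disc R b n" "i < n" "j < n"
  shows "divdiff R b j (node_poly b i) = (if i = j then 1 else 0)"
proof -
  interpret nodes_in_disc R b n by fact
  have shift: "node_poly b (i + d) v = node_poly b i v * node_poly (\<lambda>l. b (i + l)) d v" for i d v
    by (induction d) (auto simp: node_poly_Suc)
  show ?thesis
  proof (cases "i \<le> j")
    case True
    interpret shifted: nodes_in_disc R "\<lambda>l. b (i + l)" "n - i"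
      using R_pos nodes by unfold_locales auto
    have "contour_integral (circlepath 0 R) (\<lambda>v. node_poly b i v / node_poly b (Suc j) v) =
        contour_integral (circlepath 0 R) (\<lambda>v. 1 / node_poly (\<lambda>l. b (i + l)) (Suc (j - i)) v)"
    proof (rule contour_integral_eq)
      fix v assume "v \<in> path_image (circlepath 0 R)"
      then have "node_poly b i v \<noteq> 0"
        using node_poly_nz[of i v] assms(2) R_pos by (simp add: path_image_circlepath)
      moreover have "node_poly b (Suc j) v = node_poly b i v * node_poly (\<lambda>l. b (i + l)) (Suc (j - i)) v"
        using shift[of i "Suc (j - i)" v] True by simp
      ultimately show "node_poly b i v / node_poly b (Suc j) v = 1 / node_poly (\<lambda>l. b (i + l)) (Suc (j - i)) v"
        by simp
    qed
    then show ?thesis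
      using shifted.divdiff_one[of "j - i"] True assms unfolding divdiff_def by auto
  next
    case False
    have "contour_integral (circlepath 0 R) (\<lambda>v. node_poly b i v / node_poly b (Suc j) v) =
        contour_integral (circlepath 0 R) (node_poly (\<lambda>l. b (Suc j + l)) (i - Suc j))"
    proof (intro contour_integral_eq)
      fix v assume "v \<in> path_image (circlepath 0 R)"
      then have "node_poly b (Suc j) v \<noteq> 0"
        using node_poly_nz[of "Suc j" v] assms R_pos by (simp add: path_image_circlepath)
      then show "node_poly b i v / node_poly b (Suc j) v = node_poly (\<lambda>l. b (Suc j + l)) (i - Suc j) v"
        using shift[of "Suc j" "i - Suc j" v] False by simp
    qed
    also have "\<dots> = 0"
      by (intro contour_integral_unique Cauchy_theorem_convex_simple[of _ UNIV]) (auto intro!: holomorphic_intros)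
    finally show ?thesis using False unfolding divdiff_def by simp
  qed
qed

section \<open>Continuity in the nodes\<close>

lemma uniform_limit_node_poly:
  assumes "\<And>l. l < k \<Longrightarrow> ((\<lambda>x. \<beta> x l) \<longlongrightarrow> b l) F" "compact S"
  shows "uniform_limit S (\<lambda>x. node_poly (\<beta> x) k) (node_poly b k) F"
  using assms(1)
proof (induction k)
  case (Suc k)
  have lin: "uniform_limit S (\<lambda>x v. v - of_real (\<beta> x k)) (\<lambda>v. v - complex_of_real (b k)) F"
  proof (rule uniform_limitI)
    fix e :: real assume "e > 0"
    then have "eventually (\<lambda>x. dist (\<beta> x k) (b k) < e) F"
      using Suc.prems[of k] tendstoD by blast
    then show "\<forall>\<^sub>F x in F. \<forall>v\<in>S. dist (v - complex_of_real (\<beta> x k)) (v - of_real (b k)) < e"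
    proof eventually_elim
      case (elim x)
      have "dist (v - complex_of_real (\<beta> x k)) (v - of_real (b k)) = dist (\<beta> x k) (b k)" for v
        by (simp add: dist_norm norm_minus_commute flip: of_real_diff)
      with elim show ?case by simp
    qed
  qed
  have "uniform_limit S (\<lambda>x v. node_poly (\<beta> x) k v * (v - of_real (\<beta> x k))) (\<lambda>v. node_poly b k v * (v - of_real (b k))) F"
    using Suc lin assms(2)
    by (intro uniform_lim_mult compact_imp_bounded compact_continuous_image
        holomorphic_on_imp_continuous_on holomorphic_intros) auto
  then show ?case by (simp add: node_poly_Suc[abs_def])
qed (simp add: node_poly_def[abs_def] uniform_limit_const)

text \<open>The nodes may merge inside the disc: on the circle itself the denominators converge
  uniformly, and their limit is bounded away from 0 by compactness.\<close>

lemma divdiff_tendsto: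
  assumes "nodes_in_disc R b n" "\<And>l. l < n \<Longrightarrow> ((\<lambda>x. \<beta> x l) \<longlongrightarrow> b l) F" "F \<noteq> bot" "j < n"
    and h: "continuous_on (sphere 0 R) h"
  shows "((\<lambda>x. divdiff R (\<beta> x) j h) \<longlongrightarrow> divdiff R b j h) F"
proof -
  interpret nodes_in_disc R b n by fact
  have ev: "eventually (\<lambda>x. \<forall>l\<in>{..<n}. \<bar>\<beta> x l\<bar> < R) F"
  proof (intro eventually_ball_finite ballI)
    fix l assume "l \<in> {..<n}"
    then show "eventually (\<lambda>x. \<bar>\<beta> x l\<bar> < R) F"
      using order_tendstoD(2)[OF tendsto_rabs[OF assms(2)]] nodes by auto
  qed auto
  have contN: "continuous_on (sphere 0 R) (node_poly b (Suc j))"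
    by (intro holomorphic_on_imp_continuous_on node_poly_holomorphic)
  have "compact (node_poly b (Suc j) ` sphere 0 R)"
    by (intro compact_continuous_image contN) auto
  moreover have "0 \<notin> node_poly b (Suc j) ` sphere 0 R"
    using node_poly_nz[of "Suc j"] \<open>j < n\<close> by auto
  ultimately obtain c where c: "c > 0" "\<And>w. w \<in> node_poly b (Suc j) ` sphere 0 R \<Longrightarrow> c \<le> dist 0 w"
    using separate_point_closed[of "node_poly b (Suc j) ` sphere 0 R" 0] compact_imp_closed by blast
  have "uniform_limit (sphere 0 R) (\<lambda>x v. h v / node_poly (\<beta> x) (Suc j) v) (\<lambda>v. h v / node_poly b (Suc j) v) F"
  proof (rule uniform_lim_divide[where b = c])
    show "uniform_limit (sphere 0 R) (\<lambda>x. node_poly (\<beta> x) (Suc j)) (node_poly b (Suc j)) F"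
      using assms by (intro uniform_limit_node_poly) auto
    show "bounded (h ` sphere 0 R)"
      by (intro compact_imp_bounded compact_continuous_image h) auto
  qed (use c in \<open>auto simp: uniform_limit_const\<close>)
  then have "((\<lambda>x. contour_integral (circlepath 0 R) (\<lambda>v. h v / node_poly (\<beta> x) (Suc j) v)) \<longlongrightarrow>
      contour_integral (circlepath 0 R) (\<lambda>v. h v / node_poly b (Suc j) v)) F"
  proof (intro contour_integral_uniform_limit_circlepath)
    show "\<forall>\<^sub>F x in F. (\<lambda>v. h v / node_poly (\<beta> x) (Suc j) v) contour_integrable_on circlepath 0 R"
      using ev
    proof eventually_elim
      case (elim x)
      then interpret x: nodes_in_disc R "\<beta> x" n using R_pos by unfold_locales auto
      show ?case by (rule x.divdiff_integrable[OF \<open>j < n\<close> h])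
    qed
  qed (use assms R_pos in auto)
  then show ?thesis unfolding divdiff_def by (intro tendsto_divide tendsto_const) auto
qed

text \<open>Taking the points \<open>x\<close> as nodes, divided differences of order above the
  degree vanish and those of order equal to the degree give the leading coefficient. The matrix of
  divided differences is therefore triangular with diagonal \<open>c j j\<close>.\<close>

lemma det_polynomial_values:
  fixes P :: "nat \<Rightarrow> real \<Rightarrow> complex"
  assumes "\<And>j x. P j x = (\<Sum>k\<le>j. c j k * of_real x ^ k)"
  shows "Determinant.det (mat n n (\<lambda>(i, j). P j (x i))) = (\<Prod>j<n. c j j) * of_real (vandermonde n x)"
proof -
  define R where "R = 1 + (\<Sum>l<n. \<bar>x l\<bar>)"
  have "\<bar>x l\<bar> < R" if "l < n" for l
    using member_le_sum[of l "{..<n}" "\<lambda>l. \<bar>x l\<bar>"] that unfolding R_def by auto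
  moreover have "R > 0" unfolding R_def by (simp add: add_pos_nonneg sum_nonneg)
  ultimately interpret nodes_in_disc R x n by unfold_locales
  define h where "h j v = (\<Sum>k\<le>j. c j k * v ^ k)" for j and v :: complex
  let ?D = "mat n n (\<lambda>(i, j). divdiff R x j (h i))"
  have D: "divdiff R x j (h i) = (if i = j then c i i else 0)" if "i \<le> j" "j < n" for i j
  proof -
    have "divdiff R x j (h i) = (\<Sum>k\<le>i. c i k * divdiff R x j (\<lambda>v. v ^ k))"
      unfolding h_def by (subst divdiff_sum) (auto intro!: continuous_intros simp: divdiff_cmult that)
    also have "\<dots> = (\<Sum>k\<le>i. if k = j then c i k else 0)"
      using that by (intro sum.cong) (auto simp: divdiff_power)
    also have "\<dots> = (if i = j then c i i else 0)"
      using that by (simp add: sum.delta)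
    finally show ?thesis .
  qed
  have "Determinant.det (mat n n (\<lambda>(i, j). P j (x i))) = Determinant.det (transpose_mat (mat n n (\<lambda>(i, j). P j (x i))))"
    by (rule Determinant.det_transpose[of _ n, symmetric]) simp
  also have "transpose_mat (mat n n (\<lambda>(i, j). P j (x i))) = mat n n (\<lambda>(i, k). h i (of_real (x k)))"
    by (rule eq_matI) (auto simp: h_def assms)
  also have "Determinant.det (mat n n (\<lambda>(i, k). h i (of_real (x k)))) = Determinant.det ?D * of_real (vandermonde n x)"
    by (rule det_values_eq_det_divdiff) (auto simp: h_def intro!: holomorphic_intros)
  also have "Determinant.det ?D = prod_list (diag_mat ?D)"
    by (rule det_lower_triangular[of n]) (auto simp: D)
  also have "\<dots> = (\<Prod>j<n. c j j)"
    unfolding prod_list_diag_prod by (auto simp: lessThan_atLeast0 D intro!: prod.cong)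
  finally show ?thesis .
qed

section \<open>Determinantal correlations of a biorthogonal system\<close>

locale biorthogonal_system = sigma_finite_measure N for N :: "'a measure" +
  fixes n :: nat and P Q :: "nat \<Rightarrow> 'a \<Rightarrow> complex"
  assumes biorthogonal:
    "i < n \<Longrightarrow> j < n \<Longrightarrow> has_bochner_integral N (\<lambda>x. P i x * Q j x) (if i = j then 1 else 0)"
begin

definition kernel :: "'a \<Rightarrow> 'a \<Rightarrow> complex" where
  "kernel x y = (\<Sum>j<n. P j x * Q j y)"

definition kernel_det :: "nat \<Rightarrow> (nat \<Rightarrow> 'a) \<Rightarrow> complex" where
  "kernel_det m x = Determinant.det (mat m m (\<lambda>(i, j). kernel (x i) (x j)))"

lemma kernel_det_eq:
  "kernel_det m x = (\<Sum>p | p permutes {0..<m}. of_int (sign p) * (\<Prod>i=0..<m. kernel (x i) (x (p i))))"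
proof -
  let ?A = "mat m m (\<lambda>(i, j). kernel (x i) (x j))"
  have "kernel_det m x = (\<Sum>p | p permutes {0..<m}. of_int (sign p) * (\<Prod>i=0..<m. ?A $$ (i, p i)))"
    unfolding kernel_det_def by (rule det_def') simp
  moreover have "(\<Prod>i=0..<m. ?A $$ (i, p i)) = (\<Prod>i=0..<m. kernel (x i) (x (p i)))" if "p permutes {0..<m}" for p
    by (rule prod.cong) (use permutes_in_image[OF that] in auto)
  ultimately show ?thesis by simp
qed

lemma kernel_det_cong: "(\<And>i. i < m \<Longrightarrow> x i = y i) \<Longrightarrow> kernel_det m x = kernel_det m y"
proof -
  assume "\<And>i. i < m \<Longrightarrow> x i = y i"
  then have "mat m m (\<lambda>(i, j). kernel (x i) (x j)) = mat m m (\<lambda>(i, j). kernel (y i) (y j))"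
    by (intro eq_matI) auto
  then show ?thesis by (simp add: kernel_det_def)
qed

lemma kernel_reproducing: "has_bochner_integral N (\<lambda>z. kernel x z * kernel z y) (kernel x y)"
proof -
  have "has_bochner_integral N (\<lambda>z. \<Sum>j<n. \<Sum>k<n. P j x * Q k y * (P k z * Q j z))
      (\<Sum>j<n. \<Sum>k<n. P j x * Q k y * (if k = j then 1 else 0))"
    by (intro has_bochner_integral_sum has_bochner_integral_mult_right biorthogonal) auto
  also have "(\<lambda>z. \<Sum>j<n. \<Sum>k<n. P j x * Q k y * (P k z * Q j z)) = (\<lambda>z. kernel x z * kernel z y)"
    unfolding kernel_def sum_product by (auto intro!: ext sum.cong)
  also have "(\<Sum>j<n. \<Sum>k<n. P j x * Q k y * (if k = j then 1 else 0)) = kernel x y"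
    unfolding kernel_def by (intro sum.cong refl) (simp add: if_distrib cong: if_cong)
  finally show ?thesis .
qed

lemma kernel_trace: "has_bochner_integral N (\<lambda>z. kernel z z) (of_nat n)"
proof -
  have "has_bochner_integral N (\<lambda>z. kernel z z) (\<Sum>j<n. if j = j then 1 else 0)"
    unfolding kernel_def by (intro has_bochner_integral_sum biorthogonal) auto
  then show ?thesis by simp
qed

text \<open>A permutation of \<open>{0..<Suc m}\<close> is a permutation \<open>q\<close> of
  \<open>{0..<m}\<close> followed by the transposition of \<open>m\<close> with some
  \<open>b\<close>. For \<open>b = m\<close> the last point is fixed and contributes the trace
  \<open>n\<close>. For each of the \<open>m\<close> other values of \<open>b\<close> the last point
  sits inside a cycle of \<open>q\<close>; reproducing removes it and leaves the term of
  \<open>q\<close> with the opposite sign.\<close>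

lemma kernel_det_integral_last:
  "has_bochner_integral N (\<lambda>z. kernel_det (Suc m) (x(m := z))) ((of_nat n - of_nat m) * kernel_det m x)"
proof -
  let ?\<tau> = "Transposition.transpose m"
  let ?S = "{0..<m}"
  let ?T = "\<lambda>b q z. of_int (sign (?\<tau> b \<circ> q)) *
    (\<Prod>i=0..<Suc m. kernel ((x(m := z)) i) ((x(m := z)) ((?\<tau> b \<circ> q) i)))"
  let ?\<pi> = "\<lambda>q. of_int (sign q) * (\<Prod>i\<in>?S. kernel (x i) (x (q i)))"
  have diag: "has_bochner_integral N (?T m q) (of_nat n * ?\<pi> q)" if q: "q permutes ?S" for q
  proof -
    have "(x(m := z)) (q i) = x (q i)" if "i \<in> ?S" for i z
      using permutes_in_image[OF q, of i] that by auto
    moreover have "q m = m" using permutes_not_in[OF q] by simp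
    ultimately have "?T m q = (\<lambda>z. ?\<pi> q * kernel z z)"
      by (auto intro!: ext prod.cong)
    then show ?thesis
      using has_bochner_integral_mult_right[OF kernel_trace, of "?\<pi> q"] by (simp add: mult.commute)
  qed
  have offdiag: "has_bochner_integral N (?T b q) (- ?\<pi> q)" if q: "q permutes ?S" and b: "b \<in> ?S" for q b
  proof -
    \<comment> \<open>The composite maps \<open>c\<close> to \<open>m\<close> and \<open>m\<close>
      to \<open>b\<close>, so the integrated variable enters through
      \<open>kernel (x c) z * kernel z (x b)\<close> only.\<close>
    define c where "c = inv_into UNIV q b"
    have c: "c \<in> ?S" "q c = b"
      using permutes_in_image[OF permutes_inv[OF q], of b] b permutes_inverses[OF q] by (auto simp: c_def)
    have "m \<noteq> b" using b by auto
    have sgn: "sign (?\<tau> b \<circ> q) = - sign q"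
      using \<open>m \<noteq> b\<close> permutes_imp_permutation[OF _ q]
      by (simp add: sign_compose permutation_swap_id sign_swap_id)
    let ?R = "\<Prod>i\<in>?S - {c}. kernel (x i) (x (q i))"
    have rest: "kernel ((x(m := z)) i) ((x(m := z)) ((?\<tau> b \<circ> q) i)) = kernel (x i) (x (q i))"
      if "i \<in> ?S - {c}" for i z
    proof -
      have "q i \<in> ?S" using permutes_in_image[OF q, of i] that by auto
      moreover have "q i \<noteq> b" using that c(2) permutes_inj[OF q] by (auto dest: injD)
      ultimately show ?thesis using that by (auto simp: Transposition.transpose_def)
    qed
    have last: "(?\<tau> b \<circ> q) m = b" using permutes_not_in[OF q, of m] by simp
    have at_c: "(?\<tau> b \<circ> q) c = m" using c by simp
    have "(\<Prod>i=0..<Suc m. kernel ((x(m := z)) i) ((x(m := z)) ((?\<tau> b \<circ> q) i))) =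
        ?R * (kernel (x c) z * kernel z (x b))" for z
    proof -
      let ?g = "\<lambda>i. kernel ((x(m := z)) i) ((x(m := z)) ((?\<tau> b \<circ> q) i))"
      have "(\<Prod>i=0..<Suc m. ?g i) = (\<Prod>i\<in>?S. ?g i) * ?g m"
        by (simp only: prod.atLeast0_lessThan_Suc)
      also have "(\<Prod>i\<in>?S. ?g i) = ?g c * (\<Prod>i\<in>?S - {c}. ?g i)"
        using c by (intro prod.remove) auto
      also have "(\<Prod>i\<in>?S - {c}. ?g i) = ?R" by (intro prod.cong refl rest)
      also have "?g m = kernel z (x b)" using last \<open>m \<noteq> b\<close> by simp
      also have "?g c = kernel (x c) z" using at_c c by simp
      finally show ?thesis by (simp add: mult_ac)
    qed
    then have T_eq: "?T b q = (\<lambda>z. - of_int (sign q) * ?R * (kernel (x c) z * kernel z (x b)))"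
      unfolding sgn by (simp add: mult.assoc)
    have val_eq: "- of_int (sign q) * ?R * kernel (x c) (x b) = - ?\<pi> q"
      using c by (subst prod.remove[of ?S c]) auto
    show ?thesis
      using has_bochner_integral_mult_right[OF kernel_reproducing, of "- of_int (sign q) * ?R" "x c" "x b"]
      unfolding T_eq val_eq .
  qed
  have expand: "kernel_det (Suc m) (x(m := z)) = (\<Sum>b\<in>insert m ?S. \<Sum>q | q permutes ?S. ?T b q z)" for z
  proof -
    have "{0..<Suc m} = insert m ?S" by auto
    then show ?thesis
      unfolding kernel_det_eq by (simp only: sum_over_permutations_insert[of ?S m] finite_atLeastLessThan atLeastLessThan_iff less_irrefl simp_thms)
  qed
  have eq: "(\<lambda>z. kernel_det (Suc m) (x(m := z))) =
      (\<lambda>z. (\<Sum>q | q permutes ?S. ?T m q z) + (\<Sum>b\<in>?S. \<Sum>q | q permutes ?S. ?T b q z))"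
    by (rule ext, unfold expand, rule sum.insert) auto
  have "has_bochner_integral N (\<lambda>z. kernel_det (Suc m) (x(m := z)))
      ((\<Sum>q | q permutes ?S. of_nat n * ?\<pi> q) + (\<Sum>b\<in>?S. \<Sum>q | q permutes ?S. - ?\<pi> q))"
    unfolding eq
    by (intro has_bochner_integral_add has_bochner_integral_sum diag offdiag) auto
  also have "(\<Sum>q | q permutes ?S. of_nat n * ?\<pi> q) + (\<Sum>b\<in>?S. \<Sum>q | q permutes ?S. - ?\<pi> q) =
      (of_nat n - of_nat m) * kernel_det m x"
    unfolding kernel_det_eq by (simp add: sum_negf sum_distrib_left[symmetric] left_diff_distrib)
  finally show ?thesis .
qed

text \<open>Integrating out one point at a time uses Fubini on the product space. Joint
  integrability follows by expanding the kernels as well: finitely many products of one-variable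
  functions remain.\<close>

lemma kernel_det_integrable:
  assumes "k \<le> m"
  shows "integrable (PiM {k..<m} (\<lambda>_. N)) (\<lambda>z. kernel_det m (merge {..<k} {k..<m} (x, z)))"
proof -
  let ?G = "PiE {0..<m} (\<lambda>_. {..<n})"
  interpret product_sigma_finite "\<lambda>_::nat. N" ..
  have eq: "kernel_det m w = (\<Sum>p | p permutes {0..<m}. \<Sum>g\<in>?G.
      of_int (sign p) * (\<Prod>i=0..<m. P (g i) (w i) * Q (g (inv_into UNIV p i)) (w i)))" for w
    unfolding kernel_det_eq
  proof (intro sum.cong refl)
    fix p assume "p \<in> {p. p permutes {0..<m}}"
    then have p: "p permutes {0..<m}" by simp
    have "(\<Prod>i=0..<m. kernel (w i) (w (p i))) =
        (\<Sum>g\<in>?G. \<Prod>i=0..<m. P (g i) (w i) * Q (g i) (w (p i)))"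
      unfolding kernel_def by (rule prod_sum_PiE) auto
    also have "\<dots> = (\<Sum>g\<in>?G. \<Prod>i=0..<m. P (g i) (w i) * Q (g (inv_into UNIV p i)) (w i))"
    proof (intro sum.cong refl)
      fix g
      \<comment> \<open>Reindexing by \<open>p\<close> collects the two factors in the variable
        \<open>w i\<close>. Their indices may differ, and \<open>biorthogonal\<close> gives
        integrability in that case too.\<close>
      have "(\<Prod>i=0..<m. Q (g i) (w (p i))) = (\<Prod>i=0..<m. Q (g (inv_into UNIV p (p i))) (w (p i)))"
        using permutes_inverses[OF p] by simp
      also have "\<dots> = (\<Prod>i=0..<m. Q (g (inv_into UNIV p i)) (w i))"
        by (rule prod.reindex_bij_betw[OF permutes_imp_bij[OF p]])
      finally show "(\<Prod>i=0..<m. P (g i) (w i) * Q (g i) (w (p i))) = (\<Prod>i=0..<m. P (g i) (w i) * Q (g (inv_into UNIV p i)) (w i))"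
        by (simp add: prod.distrib)
    qed
    finally show "of_int (sign p) * (\<Prod>i=0..<m. kernel (w i) (w (p i))) =
        (\<Sum>g\<in>?G. of_int (sign p) * (\<Prod>i=0..<m. P (g i) (w i) * Q (g (inv_into UNIV p i)) (w i)))"
      by (simp add: sum_distrib_left)
  qed
  show ?thesis
    unfolding eq
  proof (intro Bochner_Integration.integrable_sum integrable_mult_right)
    fix p g assume "p \<in> {p. p permutes {0..<m}}" and g: "g \<in> ?G"
    then have p: "inv_into UNIV p permutes {0..<m}" by (simp add: permutes_inv)
    let ?F = "\<lambda>i y. P (g i) y * Q (g (inv_into UNIV p i)) y"
    have decomp: "{0..<m} = {..<k} \<union> {k..<m}" using assms by auto
    have "(\<lambda>z. \<Prod>i=0..<m. ?F i (merge {..<k} {k..<m} (x, z) i)) =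
        (\<lambda>z. (\<Prod>i<k. ?F i (x i)) * (\<Prod>i=k..<m. ?F i (z i)))"
      unfolding decomp by (subst prod.union_disjoint) (auto simp: merge_def intro!: ext arg_cong2[where f = "(*)"] prod.cong)
    moreover have "integrable (PiM {k..<m} (\<lambda>_. N)) (\<lambda>z. \<Prod>i=k..<m. ?F i (z i))"
    proof (rule product_integrable_prod)
      fix i assume "i \<in> {k..<m}"
      then have "i \<in> {0..<m}" by simp
      moreover from this have "inv_into UNIV p i \<in> {0..<m}" using permutes_in_image[OF p] by blast
      ultimately have "g i < n" "g (inv_into UNIV p i) < n"
        using PiE_mem[OF g] by (simp_all only: lessThan_iff)
      then show "integrable N (?F i)"
        using biorthogonal by (auto simp: has_bochner_integral_iff)
    qed simp
    ultimately show "integrable (PiM {k..<m} (\<lambda>_. N)) (\<lambda>z. \<Prod>i=0..<m. ?F i (merge {..<k} {k..<m} (x, z) i))"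
      by simp
  qed
qed

text \<open>The size \<open>m\<close> of the determinant is kept apart from the number
  \<open>n\<close> of functions, so that the induction can remove one point at a time.\<close>

lemma kernel_det_integral:
  assumes "k \<le> m"
  shows "(LINT z|PiM {k..<m} (\<lambda>_. N). kernel_det m (merge {..<k} {k..<m} (x, z))) =
    (\<Prod>q=k..<m. of_nat n - of_nat q) * kernel_det k x"
  using assms
proof (induction m rule: dec_induct)
  case base
  interpret product_sigma_finite "\<lambda>_::nat. N" ..
  have "kernel_det k (merge {..<k} {k..<k} (x, z)) = kernel_det k x" for z
    by (rule kernel_det_cong) (simp add: merge_def)
  then show ?case by (simp add: PiM_empty lebesgue_integral_count_space_finite)
next
  case (step m)
  interpret product_sigma_finite "\<lambda>_::nat. N" ..
  have set: "{k..<Suc m} = insert m {k..<m}" using step by auto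
  have "(LINT z|PiM {k..<Suc m} (\<lambda>_. N). kernel_det (Suc m) (merge {..<k} {k..<Suc m} (x, z))) =
      (LINT z|PiM {k..<m} (\<lambda>_. N). LINT y|N. kernel_det (Suc m) (merge {..<k} {k..<Suc m} (x, z(m := y))))"
    using kernel_det_integrable[of k "Suc m" x] step unfolding set
    by (subst product_integral_insert) auto
  also have "\<dots> = (LINT z|PiM {k..<m} (\<lambda>_. N). (of_nat n - of_nat m) * kernel_det m (merge {..<k} {k..<m} (x, z)))"
  proof (intro Bochner_Integration.integral_cong refl)
    fix z
    have "kernel_det (Suc m) (merge {..<k} {k..<Suc m} (x, z(m := y))) = kernel_det (Suc m) ((merge {..<k} {k..<m} (x, z))(m := y))" for y
      using step by (intro kernel_det_cong) (auto simp: merge_def)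
    then show "(LINT y|N. kernel_det (Suc m) (merge {..<k} {k..<Suc m} (x, z(m := y)))) =
        (of_nat n - of_nat m) * kernel_det m (merge {..<k} {k..<m} (x, z))"
      using has_bochner_integral_integral_eq[OF kernel_det_integral_last] by simp
  qed
  also have "\<dots> = (\<Prod>q=k..<Suc m. of_nat n - of_nat q) * kernel_det k x"
    using step by (simp add: mult_ac)
  finally show ?case .
qed

lemma kernel_det_integral_all:
  assumes "k \<le> n"
  shows "(LINT z|PiM {k..<n} (\<lambda>_. N). kernel_det n (merge {..<k} {k..<n} (x, z))) = fact (n - k) * kernel_det k x"
proof -
  have "(\<Prod>q=k..<n. of_nat n - of_nat q) = (of_nat (\<Prod>q=k..<n. n - q) :: complex)"
    unfolding of_nat_prod by (intro prod.cong) (auto simp: of_nat_diff)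
  also have "(\<Prod>q=k..<n. n - q) = fact (n - k)"
    unfolding fact_prod of_nat_id
    by (rule prod.reindex_bij_witness[of _ "\<lambda>i. n - i" "\<lambda>q. n - q"]) (use assms in auto)
  finally show ?thesis using kernel_det_integral[OF assms, of x] by simp
qed

lemma kernel_det_factor:
  "kernel_det n x = Determinant.det (mat n n (\<lambda>(i, j). P j (x i))) * Determinant.det (mat n n (\<lambda>(i, j). Q j (x i)))"
proof -
  have "mat n n (\<lambda>(i, j). kernel (x i) (x j)) =
      mat n n (\<lambda>(i, j). P j (x i)) * transpose_mat (mat n n (\<lambda>(i, j). Q j (x i)))"
    by (rule eq_matI) (auto simp: scalar_prod_def kernel_def lessThan_atLeast0)
  then show ?thesis
    unfolding kernel_det_def by (simp add: det_mult[of _ n] Determinant.det_transpose[of _ n])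
qed

end

section \<open>The product ensemble\<close>

lemma node_poly_coeffs:
  obtains c where "\<And>u. node_poly b i u = (\<Sum>k\<le>i. c k * u ^ k)" "c i = 1"
proof (induction i arbitrary: thesis)
  case 0
  show ?case by (rule 0[of "\<lambda>_. 1"]) auto
next
  case (Suc i)
  obtain c where c: "\<And>u. node_poly b i u = (\<Sum>k\<le>i. c k * u ^ k)" "c i = 1"
    using Suc.IH by blast
  define c' where "c' k = (if k = 0 then 0 else c (k - 1)) - of_real (b i) * (if k \<le> i then c k else 0)" for k
  show ?case
  proof (rule Suc.prems[of c'])
    fix u :: complex
    have "(\<Sum>k\<le>Suc i. c' k * u ^ k) =
        (\<Sum>k\<le>Suc i. (if k = 0 then 0 else c (k - 1)) * u ^ k) -
        (\<Sum>k\<le>Suc i. of_real (b i) * ((if k \<le> i then c k else 0) * u ^ k))"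
      unfolding c'_def sum_subtractf[symmetric] by (intro sum.cong refl) (simp only: left_diff_distrib mult.assoc)
    also have "(\<Sum>k\<le>Suc i. (if k = 0 then 0 else c (k - 1)) * u ^ k) = u * node_poly b i u"
      unfolding c(1) by (subst sum.atMost_Suc_shift) (simp add: sum_distrib_left mult_ac)
    also have "(\<Sum>k\<le>Suc i. of_real (b i) * ((if k \<le> i then c k else 0) * u ^ k)) = of_real (b i) * node_poly b i u"
      unfolding c(1) by (simp add: sum_distrib_left)
    finally show "node_poly b (Suc i) u = (\<Sum>k\<le>Suc i. c' k * u ^ k)"
      by (simp add: node_poly_Suc algebra_simps)
  qed (simp add: c'_def c(2))
qed

lemma sq_exp_coeff_shift_sums:
  fixes v :: "'a :: {real_normed_field,banach}"
  shows "(\<lambda>m. (if k \<le> m then sq_exp_coeff (m - k) else 0) * v ^ m) sums (v ^ k * exp (v\<^sup>2))"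
proof -
  have "(\<lambda>m. v ^ k * (sq_exp_coeff m * v ^ m)) sums (v ^ k * exp (v\<^sup>2))"
    by (intro sums_mult sq_exp_coeff_sums)
  then have "(\<lambda>m. (if k \<le> m + k then sq_exp_coeff (m + k - k) else 0) * v ^ (m + k)) sums (v ^ k * exp (v\<^sup>2))"
    by (simp add: power_add mult_ac)
  then show ?thesis by (subst (asm) sums_zero_iff_shift) auto
qed

lemma entire_coeffs_sq_exp_shift:
  "entire_coeffs (\<lambda>m. if k \<le> m then sq_exp_coeff (m - k) else 0)"
  unfolding entire_coeffs_def
proof (intro allI impI)
  fix r :: real
  have "norm (if k \<le> m then sq_exp_coeff (m - k) else 0 :: complex) = (if k \<le> m then sq_exp_coeff (m - k) else 0)" for m
    by (simp add: norm_sq_exp_coeff)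
  then show "summable (\<lambda>m. norm (if k \<le> m then sq_exp_coeff (m - k) else 0 :: complex) * r ^ m)"
    using sums_summable[OF sq_exp_coeff_shift_sums[of k r]] by simp
qed

lemma det_scale_columns:
  "Determinant.det (mat n n (\<lambda>(i, j). A i j * c j)) = Determinant.det (mat n n (\<lambda>(i, j). A i j)) * (\<Prod>j<n. c j :: complex)"
proof -
  let ?A = "mat n n (\<lambda>(i, j). A i j)" and ?B = "mat n n (\<lambda>(i, j). A i j * c j)"
  have "of_int (sign p) * (\<Prod>i=0..<n. ?B $$ (i, p i)) =
      of_int (sign p) * (\<Prod>i=0..<n. ?A $$ (i, p i)) * (\<Prod>j<n. c j)"
    if p: "p permutes {0..<n}" for p
  proof -
    have "(\<Prod>i=0..<n. ?B $$ (i, p i)) =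
        (\<Prod>i=0..<n. ?A $$ (i, p i) * c (p i))"
      using permutes_in_image[OF p] by (intro prod.cong) auto
    also have "\<dots> = (\<Prod>i=0..<n. ?A $$ (i, p i)) * (\<Prod>i=0..<n. c (p i))"
      by (rule prod.distrib)
    also have "(\<Prod>i=0..<n. c (p i)) = (\<Prod>j<n. c j)"
      unfolding lessThan_atLeast0 by (rule prod.reindex_bij_betw[OF permutes_imp_bij[OF p]])
    finally show ?thesis by (simp only: mult.assoc)
  qed
  then show ?thesis
    by (subst (1 2) det_def'[of _ n]) (auto simp: sum_distrib_right intro!: sum.cong)
qed

lemma path_between_imaginary_infinities_outside:
  assumes L: "path_between_imaginary_infinities L" and disj: "range L \<inter> S = {}" and "bounded S"
  shows "L t \<in> outside S"
proof -
  have "L piecewise_C1_differentiable_on {a..b}" for a b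
    using L unfolding path_between_imaginary_infinities_def by blast
  then have "continuous_on {a..b} L" for a b
    unfolding piecewise_C1_differentiable_on_def by blast
  then have "isCont L s" for s
    using continuous_on_interior[of "{s - 1..s + 1}" L s] by simp
  then have "continuous_on UNIV L" by (simp add: continuous_on_eq_continuous_at)
  then have conn: "connected (range L)" by (intro connected_continuous_image connected_UNIV)
  have "\<not> bounded (range L)"
  proof
    assume "bounded (range L)"
    then obtain B where B: "\<And>s. norm (L s) \<le> B" by (auto simp: bounded_iff)
    have "eventually (\<lambda>s. Im (L s) \<ge> B + 1) at_top"
      using L unfolding path_between_imaginary_infinities_def filterlim_at_top by blast
    then obtain s where "Im (L s) \<ge> B + 1" by (auto simp: eventually_at_top_linorder)
    then show False using B[of s] abs_Im_le_cmod[of "L s"] by linarith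
  qed
  moreover have "range L \<subseteq> connected_component_set (- S) (L t)"
    using disj conn by (intro connected_component_maximal) auto
  ultimately have "\<not> bounded (connected_component_set (- S) (L t))"
    using bounded_subset by blast
  then show ?thesis using disj by (auto simp: outside_def)
qed

text \<open>\<open>Lim\<close> has a definite meaning only for a nontrivial filter. Moving
  \<open>b\<close> along the direction \<open>(0, 1, 2, ...)\<close> separates the nodes, since two
  given indices collide for one value of \<open>\<epsilon>\<close> at most.\<close>

lemma at_within_inj_nontrivial:
  fixes b :: "nat \<Rightarrow> real"
  assumes "\<not> inj_on b {..<n}"
  shows "at b within {b'. inj_on b' {..<n}} \<noteq> bot"
proof -
  define \<beta> where "\<beta> (\<epsilon>::real) = (\<lambda>l. b l + \<epsilon> * real l)" for \<epsilon>
  have bad: "finite {\<epsilon>. \<not> inj_on (\<beta> \<epsilon>) {..<n}}"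
  proof (rule finite_subset)
    show "{\<epsilon>. \<not> inj_on (\<beta> \<epsilon>) {..<n}} \<subseteq> (\<lambda>(i, j). (b j - b i) / (real i - real j)) ` ({..<n} \<times> {..<n})"
    proof
      fix \<epsilon> assume "\<epsilon> \<in> {\<epsilon>. \<not> inj_on (\<beta> \<epsilon>) {..<n}}"
      then obtain i j where ij: "i < n" "j < n" "i \<noteq> j" "b i + \<epsilon> * real i = b j + \<epsilon> * real j"
        by (auto simp: inj_on_def \<beta>_def)
      then have "\<epsilon> * (real i - real j) = b j - b i" by (simp add: algebra_simps)
      then have "\<epsilon> = (b j - b i) / (real i - real j)" using ij by (simp add: field_simps)
      with ij show "\<epsilon> \<in> (\<lambda>(i, j). (b j - b i) / (real i - real j)) ` ({..<n} \<times> {..<n})"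
        by (auto intro!: image_eqI[of _ _ "(i, j)"])
    qed
  qed auto
  have "continuous_on UNIV \<beta>"
    by (rule continuous_on_coordinatewise_then_product) (auto simp: \<beta>_def intro!: continuous_intros)
  then have "isCont \<beta> 0" by (simp add: continuous_on_eq_continuous_at)
  moreover have "\<beta> 0 = b" by (simp add: \<beta>_def)
  ultimately have "(\<beta> \<longlongrightarrow> b) (at 0)" by (simp add: isCont_def)
  moreover have "eventually (\<lambda>\<epsilon>. \<beta> \<epsilon> \<in> {b'. inj_on b' {..<n}} \<and> \<beta> \<epsilon> \<noteq> b) (at 0)"
  proof -
    \<comment> \<open>\<open>0\<close> is itself a bad value, \<open>b\<close> having a repeated
      node; it is taken out of the bad set so that the complement is a neighbourhood of 0.\<close>
    have "open (- ({\<epsilon>. \<not> inj_on (\<beta> \<epsilon>) {..<n}} - {0}))"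
      using bad by (intro open_Compl finite_imp_closed) auto
    then have "eventually (\<lambda>\<epsilon>. \<epsilon> \<in> - ({\<epsilon>. \<not> inj_on (\<beta> \<epsilon>) {..<n}} - {0})) (at 0)"
      by (intro eventually_at_in_open' ) auto
    moreover have "eventually (\<lambda>\<epsilon>::real. \<epsilon> \<noteq> 0) (at 0)"
      by (simp add: eventually_at_filter)
    ultimately show ?thesis
      by eventually_elim (use assms in auto)
  qed
  ultimately have "filterlim \<beta> (at b within {b'. inj_on b' {..<n}}) (at 0)"
    by (auto simp: filterlim_at elim: eventually_mono)
  then show ?thesis
    using filterlim_def filtermap_bot_iff[of \<beta> "at 0"] at_neq_bot[of "0::real"] by (metis bot.extremum_uniqueI)
qed

section \<open>The biorthogonal functions of the ensemble and the contour integral kernel\<close>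

locale product_ensemble = nodes_in_disc R b n for R b n +
  fixes M :: nat and \<nu> :: "nat \<Rightarrow> nat" and C\<^sub>0 :: "real \<Rightarrow> complex"
  assumes encircles_0: "encircles_anticlockwise C\<^sub>0 {0}"
begin

definition P :: "nat \<Rightarrow> real \<Rightarrow> complex" where
  "P j x = gauss_mean (\<lambda>u. f_fun C\<^sub>0 M \<nu> x u * node_poly b j u)"

definition g_gauss :: "real \<Rightarrow> complex \<Rightarrow> complex" where
  "g_gauss y v = g_fun M \<nu> y v * exp (- v\<^sup>2)"

lemma g_gauss_holomorphic: "y \<noteq> 0 \<Longrightarrow> g_gauss y holomorphic_on S"
  unfolding g_gauss_def by (intro holomorphic_intros g_fun_holomorphic)

definition Q :: "nat \<Rightarrow> real \<Rightarrow> complex" where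
  "Q j y = divdiff R b j (g_gauss y) / of_real (sqrt pi)"

abbreviation punctured :: "real measure" where
  "punctured \<equiv> restrict_space lborel (- {0})"

lemma exp_type_f_fun_power: "exp_type (\<lambda>u. f_fun C\<^sub>0 M \<nu> x u * u ^ k)"
  by (intro exp_type_mult exp_type_f_fun encircles_0 exp_type_power)

lemma P_eq:
  assumes "\<And>u. node_poly b j u = (\<Sum>k\<le>j. c k * u ^ k)"
  shows "P j x = (\<Sum>k\<le>j. c k * gauss_mean (\<lambda>u. f_fun C\<^sub>0 M \<nu> x u * u ^ k))"
proof -
  have "P j x = gauss_mean (\<lambda>u. \<Sum>k\<le>j. c k * (f_fun C\<^sub>0 M \<nu> x u * u ^ k))"
    unfolding P_def assms by (simp add: sum_distrib_left mult_ac)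
  also have "\<dots> = (\<Sum>k\<le>j. c k * gauss_mean (\<lambda>u. f_fun C\<^sub>0 M \<nu> x u * u ^ k))"
    by (subst gauss_mean_sum)
      (auto intro!: exp_type_mult[OF exp_type_const] exp_type_f_fun_power simp only: gauss_mean_cmult)
  finally show ?thesis .
qed

lemma det_P:
  "Determinant.det (mat n n (\<lambda>(i, j). P j (x i))) =
    (\<Prod>j<n. 1 / of_real (gamma_weight M \<nu> j)) * of_real (vandermonde n x)"
proof -
  have "\<exists>c. (\<forall>u. node_poly b j u = (\<Sum>k\<le>j. c k * u ^ k)) \<and> c j = 1" for j
    using node_poly_coeffs by blast
  then obtain c where c: "\<And>j u. node_poly b j u = (\<Sum>k\<le>j. c j k * u ^ k)" "\<And>j. c j j = 1"
    by metis
  define a where "a j k = (\<Sum>q\<le>j. c j q * of_real (herm_pairing q k / gamma_weight M \<nu> k))" for j k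
  have "P j x = (\<Sum>k\<le>j. a j k * of_real x ^ k)" for j x
  proof -
    have "gauss_mean (\<lambda>u. f_fun C\<^sub>0 M \<nu> x u * u ^ q) =
        (\<Sum>k\<le>j. of_real (herm_pairing q k / gamma_weight M \<nu> k) * of_real x ^ k)" if "q \<le> j" for q
      unfolding gauss_mean_f_fun_power[OF encircles_0] using that
      by (intro sum.mono_neutral_left) (auto simp: herm_pairing_eq_0)
    then have "P j x = (\<Sum>q\<le>j. c j q * (\<Sum>k\<le>j. of_real (herm_pairing q k / gamma_weight M \<nu> k) * of_real x ^ k))"
      unfolding P_eq[OF c(1)] by (intro sum.cong) auto
    also have "\<dots> = (\<Sum>k\<le>j. a j k * of_real x ^ k)"
      unfolding a_def sum_distrib_left sum_distrib_right by (subst sum.swap) (simp only: mult.assoc)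
    finally show ?thesis .
  qed
  then have "Determinant.det (mat n n (\<lambda>(i, j). P j (x i))) = (\<Prod>j<n. a j j) * of_real (vandermonde n x)"
    by (rule det_polynomial_values)
  \<comment> \<open>Powers \<open>q < j\<close> contribute nothing to the coefficient of
    \<open>x ^ j\<close>, and the node polynomial is monic.\<close>
  moreover have "a j j = 1 / of_real (gamma_weight M \<nu> j)" for j
  proof -
    have "a j j = (\<Sum>q\<le>j. if q = j then 1 / of_real (gamma_weight M \<nu> j) else 0)"
      unfolding a_def by (intro sum.cong refl) (auto simp: herm_pairing_eq_0 herm_pairing_diag c)
    then show ?thesis by simp
  qed
  ultimately show ?thesis by simp
qed

text \<open>The pairing with \<open>u ^ k\<close> is a series in the numbers \<open>d m\<close> with
  the coefficients of \<open>v ^ k * exp (v^2)\<close>. Resummed inside the divided difference, it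
  cancels \<open>exp (- v^2)\<close>, and the power \<open>v ^ k\<close> is left; summing over
  \<open>k\<close> rebuilds \<open>node_poly b i\<close>.\<close>

lemma biorthogonal_P_Q:
  assumes "i < n" "j < n"
  shows "has_bochner_integral punctured (\<lambda>y. P i y * Q j y) (if i = j then 1 else 0)"
proof -
  let ?e = "\<lambda>v::complex. exp (- v\<^sup>2)"
  have cont_e: "continuous_on S ?e" for S by (intro continuous_intros)
  define d where "d m = divdiff R b j (\<lambda>v. v ^ m * ?e v)" for m
  obtain B where B: "\<And>m. norm (d m) \<le> B * R ^ m"
    unfolding d_def using divdiff_power_bound[OF assms(2) cont_e] by metis
  define q where "q y = (if y = 0 then 0 else (\<Sum>m. complex_of_real (g_coeff M \<nu> m y) * d m))" for y
  have Q: "Q j y = q y / of_real (sqrt pi)" if "y \<noteq> 0" for y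
    using divdiff_series[OF rapid_entire_coeffs[OF rapid_g_coeff that] assms(2) cont_e, of M \<nu>] that
    unfolding Q_def g_gauss_def[abs_def] q_def d_def by (simp add: sums_iff g_fun_eq_series)
  obtain c where c: "\<And>u. node_poly b i u = (\<Sum>k\<le>i. c k * u ^ k)"
    using node_poly_coeffs by metis
  let ?F = "\<lambda>k y. gauss_mean (\<lambda>u. f_fun C\<^sub>0 M \<nu> y u * u ^ k) * q y"
  have F: "has_bochner_integral lborel (?F k) (of_real (sqrt pi) * divdiff R b j (\<lambda>v. v ^ k))" for k
  proof -
    have pair: "integrable lborel (?F k)"
      "(\<lambda>m. of_real (if k \<le> m then sqrt pi * sq_exp_coeff (m - k) else 0) * d m) sums (LINT y|lborel. ?F k y)"
      unfolding q_def by (rule f_fun_pairing_sums[OF encircles_0 R_pos B])+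
    have "(\<lambda>m. (if k \<le> m then sq_exp_coeff (m - k) else 0) * d m) sums
        divdiff R b j (\<lambda>v. (\<Sum>m. (if k \<le> m then sq_exp_coeff (m - k) else 0) * v ^ m) * ?e v)"
      unfolding d_def by (rule divdiff_series[OF entire_coeffs_sq_exp_shift assms(2) cont_e])
    also have "(\<lambda>v::complex. (\<Sum>m. (if k \<le> m then sq_exp_coeff (m - k) else 0) * v ^ m) * ?e v) = (\<lambda>v. v ^ k)"
    proof
      fix v :: complex
      have "(\<Sum>m. (if k \<le> m then sq_exp_coeff (m - k) else 0) * v ^ m) = v ^ k * exp (v\<^sup>2)"
        by (rule sums_unique[OF sq_exp_coeff_shift_sums, symmetric])
      then show "(\<Sum>m. (if k \<le> m then sq_exp_coeff (m - k) else 0) * v ^ m) * ?e v = v ^ k"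
        by (simp add: mult.assoc mult_exp_exp)
    qed
    finally have "(\<lambda>m. of_real (sqrt pi) * ((if k \<le> m then sq_exp_coeff (m - k) else 0) * d m)) sums
        (of_real (sqrt pi) * divdiff R b j (\<lambda>v. v ^ k))"
      by (rule sums_mult)
    also have "(\<lambda>m. of_real (sqrt pi) * ((if k \<le> m then sq_exp_coeff (m - k) else 0) * d m)) =
        (\<lambda>m. of_real (if k \<le> m then sqrt pi * sq_exp_coeff (m - k) else 0) * d m)"
      by (auto simp: sq_exp_coeff_def)
    finally show ?thesis
      using pair by (simp add: has_bochner_integral_iff sums_unique2)
  qed
  have "has_bochner_integral lborel (\<lambda>y. \<Sum>k\<le>i. c k / of_real (sqrt pi) * ?F k y)
      (\<Sum>k\<le>i. c k / of_real (sqrt pi) * (of_real (sqrt pi) * divdiff R b j (\<lambda>v. v ^ k)))"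
    by (intro has_bochner_integral_sum has_bochner_integral_mult_right F)
  also have "(\<Sum>k\<le>i. c k / of_real (sqrt pi) * (of_real (sqrt pi) * divdiff R b j (\<lambda>v. v ^ k))) =
      (\<Sum>k\<le>i. divdiff R b j (\<lambda>v. c k * v ^ k))"
    by (intro sum.cong) (auto simp: divdiff_cmult)
  also have "\<dots> = divdiff R b j (node_poly b i)"
    unfolding c[abs_def] by (rule divdiff_sum[symmetric]) (auto intro!: continuous_intros assms)
  also have "\<dots> = (if i = j then 1 else 0)"
    using assms by (intro divdiff_node_poly) unfold_locales
  finally have "has_bochner_integral lborel (\<lambda>y. \<Sum>k\<le>i. c k / of_real (sqrt pi) * ?F k y) (if i = j then 1 else 0)" .
  \<comment> \<open>Since \<open>q 0 = 0\<close>, the integrand on the whole line is already the one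
    restricted to the punctured line.\<close>
  also have "(\<lambda>y. \<Sum>k\<le>i. c k / of_real (sqrt pi) * ?F k y) = (\<lambda>y. indicator (- {0}) y *\<^sub>R (P i y * Q j y))"
  proof
    fix y
    show "(\<Sum>k\<le>i. c k / of_real (sqrt pi) * ?F k y) = indicator (- {0}) y *\<^sub>R (P i y * Q j y)"
    proof (cases "y = 0")
      case False
      have "(\<Sum>k\<le>i. c k / of_real (sqrt pi) * ?F k y) =
          (\<Sum>k\<le>i. c k * gauss_mean (\<lambda>u. f_fun C\<^sub>0 M \<nu> y u * u ^ k)) * (q y / of_real (sqrt pi))"
        unfolding sum_distrib_right by (intro sum.cong refl) simp
      then show ?thesis using False by (simp add: P_eq[OF c] Q)
    qed (simp add: q_def)
  qed
  finally show ?thesis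
    by (simp add: has_bochner_integral_iff integrable_restrict_space integral_restrict_space)
qed

sublocale biorthogonal_system punctured n P Q
proof (intro biorthogonal_system.intro biorthogonal_system_axioms.intro biorthogonal_P_Q)
  show "sigma_finite_measure punctured"
    by (rule sigma_finite_measure_restrict_space[OF sigma_finite_lborel]) auto
qed

lemma K_kernel_eq:
  assumes Cb: "encircles_anticlockwise C\<^sub>b ((\<lambda>l. complex_of_real (b l)) ` {..<n})"
    and L: "path_between_imaginary_infinities L" and disj: "range L \<inter> path_image C\<^sub>b = {}"
    and "y \<noteq> 0"
  shows "K_kernel C\<^sub>0 C\<^sub>b L n M \<nu> b x y = kernel x y"
proof -
  let ?A = "(\<lambda>l. complex_of_real (b l)) ` {..<n}"
  let ?h = "g_gauss y"
  note hol_h = g_gauss_holomorphic[OF \<open>y \<noteq> 0\<close>]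
  let ?r = "\<lambda>u v. \<Prod>l<n. (u - complex_of_real (b l)) / (v - of_real (b l))"
  let ?k = "\<lambda>u v. f_fun C\<^sub>0 M \<nu> x u * g_fun M \<nu> y v * exp (u\<^sup>2 - v\<^sup>2) * (1 / (u - v)) * ?r u v"
  define D where "D j = 2 * pi * \<i> * divdiff R b j ?h" for j
  have valid: "valid_path C\<^sub>b" "pathfinish C\<^sub>b = pathstart C\<^sub>b" "path_image C\<^sub>b \<inter> ?A = {}"
    using Cb unfolding encircles_anticlockwise_def by auto
  have nz: "node_poly b j v \<noteq> 0" if "j \<le> n" "v \<notin> ?A" for j v
    using that by (auto simp: node_poly_eq_0_iff)
  have hol: "(\<lambda>v. ?h v / node_poly b (Suc j) v) holomorphic_on - ?A" if "j < n" for j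
    using that by (intro holomorphic_intros hol_h nz) auto
  have open_A: "open (- ?A)" by (intro open_Compl finite_imp_closed) auto
  have int: "(\<lambda>v. ?h v / node_poly b (Suc j) v) contour_integrable_on C\<^sub>b" if "j < n" for j
    by (rule contour_integrable_holomorphic_simple[OF hol[OF that] open_A]) (use valid in auto)
  have cint: "contour_integral C\<^sub>b (\<lambda>v. ?h v / node_poly b (Suc j) v) = D j" if "j < n" for j
  proof -
    have "?A \<subseteq> ball 0 R" using nodes by (auto simp: dist_norm)
    then have "contour_integral C\<^sub>b (\<lambda>v. ?h v / node_poly b (Suc j) v) =
        contour_integral (circlepath 0 R) (\<lambda>v. ?h v / node_poly b (Suc j) v)"
      using R_pos by (intro contour_integral_encircles_eq[OF Cb _ _ hol[OF that]] encircles_circlepath) auto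
    then show ?thesis unfolding D_def divdiff_def by simp
  qed
  have inner: "contour_integral C\<^sub>b (?k u) =
      exp (u\<^sup>2) * (\<Sum>j<n. D j * (f_fun C\<^sub>0 M \<nu> x u * node_poly b j u))" if u: "u \<in> range L" for u
  proof -
    let ?c = "f_fun C\<^sub>0 M \<nu> x u * exp (u\<^sup>2)"
    have "u \<in> outside (path_image C\<^sub>b)"
      using u path_between_imaginary_infinities_outside[OF L disj] valid(1)
      by (auto simp: compact_imp_bounded compact_valid_path_image)
    moreover have "u \<notin> path_image C\<^sub>b" using u disj by auto
    \<comment> \<open>The only singularity is at \<open>u\<close>, which lies outside the loop; so
      the global form of Cauchy's theorem applies to the term \<open>1 / (u - v)\<close>.\<close>
    moreover have "(\<lambda>v. ?h v / (v - u)) holomorphic_on - {u}"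
      by (intro holomorphic_intros hol_h) auto
    ultimately have zero: "((\<lambda>v. ?h v / (v - u)) has_contour_integral 0) C\<^sub>b"
      using valid by (intro Cauchy_theorem_global_outside[of "- {u}"]) auto
    have "contour_integral C\<^sub>b (?k u) =
        contour_integral C\<^sub>b (\<lambda>v. (\<Sum>j<n. (?c * node_poly b j u) * (?h v / node_poly b (Suc j) v)) - ?c * (?h v / (v - u)))"
    proof (rule contour_integral_eq)
      fix v assume v: "v \<in> path_image C\<^sub>b"
      then have uv: "u \<noteq> v" "v - u \<noteq> 0" "u - v \<noteq> 0" using u disj by auto
      have nv: "node_poly b n v \<noteq> 0" using nz[of n v] v valid by auto
      have "?r u v = node_poly b n u / node_poly b n v"
        by (simp add: node_poly_def prod_dividef)
      then have "1 / (u - v) * ?r u v =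
          (1 - node_poly b n u / node_poly b n v) / (v - u) - 1 / (v - u)"
        using uv nv by (simp add: divide_simps) (simp add: algebra_simps)
      also have "\<dots> = (\<Sum>j<n. node_poly b j u / node_poly b (Suc j) v) - 1 / (v - u)"
        using node_poly_telescope[OF uv(1) nv] by simp
      finally have *: "1 / (u - v) * ?r u v =
          (\<Sum>j<n. node_poly b j u / node_poly b (Suc j) v) - 1 / (v - u)" .
      have "?k u v =
          ?c * ?h v * (1 / (u - v) * ?r u v)"
        by (simp add: g_gauss_def exp_diff exp_minus divide_inverse mult_ac)
      also have "\<dots> = (\<Sum>j<n. (?c * node_poly b j u) * (?h v / node_poly b (Suc j) v)) - ?c * (?h v / (v - u))"
        unfolding * by (simp add: right_diff_distrib sum_distrib_left mult_ac)
      finally show "?k u v =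
          (\<Sum>j<n. (?c * node_poly b j u) * (?h v / node_poly b (Suc j) v)) - ?c * (?h v / (v - u))" .
    qed
    also have "\<dots> = contour_integral C\<^sub>b (\<lambda>v. \<Sum>j<n. (?c * node_poly b j u) * (?h v / node_poly b (Suc j) v)) -
        contour_integral C\<^sub>b (\<lambda>v. ?c * (?h v / (v - u)))"
      using int zero
      by (intro contour_integral_diff contour_integrable_sum contour_integrable_lmul)
        (auto simp only: contour_integrable_on_def finite_lessThan lessThan_iff)
    also have "contour_integral C\<^sub>b (\<lambda>v. ?c * (?h v / (v - u))) = 0"
      using has_contour_integral_lmul[OF zero, of ?c] by (simp only: mult_zero_right contour_integral_unique)
    also have "contour_integral C\<^sub>b (\<lambda>v. \<Sum>j<n. (?c * node_poly b j u) * (?h v / node_poly b (Suc j) v)) =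
        (\<Sum>j<n. (?c * node_poly b j u) * contour_integral C\<^sub>b (\<lambda>v. ?h v / node_poly b (Suc j) v))"
      by (rule contour_integral_sum_cmult) (auto intro: int)
    also have "(\<Sum>j<n. (?c * node_poly b j u) * contour_integral C\<^sub>b (\<lambda>v. ?h v / node_poly b (Suc j) v)) - 0 =
        exp (u\<^sup>2) * (\<Sum>j<n. D j * (f_fun C\<^sub>0 M \<nu> x u * node_poly b j u))"
      by (simp add: cint sum_distrib_left mult_ac)
    finally show ?thesis .
  qed
  have exp_t: "exp_type (\<lambda>u. D j * (f_fun C\<^sub>0 M \<nu> x u * node_poly b j u))" for j
    unfolding node_poly_def diff_conv_add_uminus
    by (intro exp_type_mult exp_type_const exp_type_f_fun encircles_0 exp_type_prod exp_type_add exp_type_id)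
  have "infinite_contour_integral L (\<lambda>u. contour_integral C\<^sub>b (?k u)) =
      \<i> * of_real (sqrt pi) * gauss_mean (\<lambda>u. \<Sum>j<n. D j * (f_fun C\<^sub>0 M \<nu> x u * node_poly b j u))"
    unfolding infinite_contour_integral_def inner[OF rangeI]
    by (intro integral_unique has_integral_gaussian_along_path[OF L] exp_type_sum exp_t)
  also have "gauss_mean (\<lambda>u. \<Sum>j<n. D j * (f_fun C\<^sub>0 M \<nu> x u * node_poly b j u)) = (\<Sum>j<n. D j * P j x)"
    by (subst gauss_mean_sum[OF exp_t]) (simp add: gauss_mean_cmult P_def)
  finally have "K_kernel C\<^sub>0 C\<^sub>b L n M \<nu> b x y =
      1 / (2 * (of_real pi * \<i>)\<^sup>2) * (\<i> * of_real (sqrt pi) * (\<Sum>j<n. D j * P j x))"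
    unfolding K_kernel_def by simp
  also have "\<dots> = (\<Sum>j<n. (1 / (2 * (of_real pi * \<i>)\<^sup>2) * (\<i> * of_real (sqrt pi)) * (2 * pi * \<i>)) * (P j x * divdiff R b j ?h))"
    unfolding D_def by (simp add: sum_distrib_left mult_ac)
  \<comment> \<open>The prefactor of the kernel, \<open>\<i> * sqrt pi\<close> from the path and
    \<open>2 * pi * \<i>\<close> from \<open>divdiff\<close> combine to the constant in
    \<open>Q\<close>.\<close>
  also have "1 / (2 * (of_real pi * \<i>)\<^sup>2) * (\<i> * of_real (sqrt pi)) * (2 * pi * \<i>) = 1 / complex_of_real (sqrt pi)"
  proof -
    have "complex_of_real (sqrt pi) * of_real (sqrt pi) = of_real pi"
      by (simp flip: of_real_mult)
    then show ?thesis by (simp add: power2_eq_square field_simps)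
  qed
  finally show ?thesis
    unfolding kernel_def Q_def by simp
qed

section \<open>The density as a multiple of the kernel determinant\<close>

lemma biorthogonal_weight_eq:
  assumes x: "\<And>i. i < n \<Longrightarrow> x i \<noteq> 0" and b': "nodes_in_disc R b' n"
  shows "biorthogonal_weight n M \<nu> b' x = of_real (vandermonde n b') * (of_real (vandermonde n x) *
    (\<Prod>j<n. exp ((of_real (b' j))\<^sup>2)) *
    Determinant.det (mat n n (\<lambda>(i, j). divdiff R b' j (g_gauss (x i)))))"
proof -
  interpret b': nodes_in_disc R b' n by fact
  \<comment> \<open>Passing to \<open>g_gauss\<close> scales column \<open>j\<close> by a factor
    free of \<open>x\<close>, and the rows become values of the function whose divided differences
    define \<open>Q\<close>.\<close>
  have "mat n n (\<lambda>(i, j). g_fun M \<nu> (x i) (of_real (b' j))) =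
      mat n n (\<lambda>(i, j). g_gauss (x i) (of_real (b' j)) * exp ((of_real (b' j))\<^sup>2))"
    by (intro eq_matI) (auto simp: g_gauss_def mult.assoc mult_exp_exp)
  then have "Determinant.det (mat n n (\<lambda>(i, j). g_fun M \<nu> (x i) (of_real (b' j)))) =
      Determinant.det (mat n n (\<lambda>(i, j). g_gauss (x i) (of_real (b' j)) * exp ((of_real (b' j))\<^sup>2)))"
    by (rule arg_cong)
  also have "\<dots> =
      Determinant.det (mat n n (\<lambda>(i, j). g_gauss (x i) (of_real (b' j)))) *
      (\<Prod>j<n. exp ((of_real (b' j))\<^sup>2))"
    by (rule det_scale_columns)
  also have "Determinant.det (mat n n (\<lambda>(i, j). g_gauss (x i) (of_real (b' j)))) =
      Determinant.det (mat n n (\<lambda>(i, j). divdiff R b' j (g_gauss (x i)))) * of_real (vandermonde n b')"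
    by (rule b'.det_values_eq_det_divdiff) (rule g_gauss_holomorphic[OF x])
  finally show ?thesis unfolding biorthogonal_weight_def by (simp add: mult_ac)
qed

lemma vandermonde_nonzero: "inj_on b' {..<n} \<Longrightarrow> vandermonde n b' \<noteq> 0"
  unfolding vandermonde_def by (force simp: inj_on_def)

text \<open>Dividing by \<open>vandermonde n b'\<close> removes the only factor that degenerates;
  what is left is continuous in the nodes, so distinct and coinciding nodes lead to the same
  expression \<open>W b x\<close>. The constant stays implicit until the total mass determines
  it.\<close>

lemma ensemble_weight_eq:
  "\<exists>\<kappa>. \<forall>x. (\<forall>i<n. x i \<noteq> 0) \<longrightarrow> ensemble_weight n M \<nu> b x = \<kappa> * kernel_det n x"
proof -
  define E where "E b' = (\<Prod>j<n. exp ((complex_of_real (b' j))\<^sup>2))" for b' :: "nat \<Rightarrow> real"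
  define W where "W b' x = of_real (vandermonde n x) * E b' *
    Determinant.det (mat n n (\<lambda>(i, j). divdiff R b' j (g_gauss (x i))))" for b' x
  have weight: "biorthogonal_weight n M \<nu> b' x = of_real (vandermonde n b') * W b' x"
    if "\<And>i. i < n \<Longrightarrow> x i \<noteq> 0" "nodes_in_disc R b' n" for b' x
    unfolding W_def E_def by (rule biorthogonal_weight_eq[OF that])
  have self: "nodes_in_disc R b n" by unfold_locales
  \<comment> \<open>For distinct nodes the weight is not divided by its Vandermonde factor in
    \<open>b\<close>, which then becomes part of the constant.\<close>
  define v where "v = (if inj_on b {..<n} then vandermonde n b else 1)"
  have ens: "ensemble_weight n M \<nu> b x = of_real v * W b x" if x: "\<And>i. i < n \<Longrightarrow> x i \<noteq> 0" for x
  proof (cases "inj_on b {..<n}")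
    case True
    then show ?thesis unfolding ensemble_weight_def v_def using weight[OF x self] by simp
  next
    case False
    let ?F = "at b within {b'. inj_on b' {..<n}}"
    have nontriv: "?F \<noteq> bot" by (rule at_within_inj_nontrivial[OF False])
    have comp: "((\<lambda>b'. b' l) \<longlongrightarrow> b l) ?F" for l
    proof -
      have "continuous_on UNIV (\<lambda>b' :: nat \<Rightarrow> real. b' l)"
        by (rule continuous_on_product_then_coordinatewise[OF continuous_on_id])
      then have "isCont (\<lambda>b' :: nat \<Rightarrow> real. b' l) b"
        using continuous_on_eq_continuous_at[OF open_UNIV] by blast
      then show ?thesis by (rule isCont_tendsto_compose) (rule tendsto_ident_at)
    qed
    have "eventually (\<lambda>b'. \<forall>l\<in>{..<n}. \<bar>b' l\<bar> < R) ?F"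
    proof (intro eventually_ball_finite ballI)
      fix l assume "l \<in> {..<n}"
      then show "eventually (\<lambda>b'. \<bar>b' l\<bar> < R) ?F"
        using order_tendstoD(2)[OF tendsto_rabs[OF comp]] nodes by auto
    qed auto
    moreover have "eventually (\<lambda>b'. inj_on b' {..<n}) ?F"
      by (simp add: eventually_at_filter)
    ultimately have ev: "eventually (\<lambda>b'. biorthogonal_weight n M \<nu> b' x / of_real (vandermonde n b') = W b' x) ?F"
    proof eventually_elim
      case (elim b')
      then have "nodes_in_disc R b' n" using R_pos by unfold_locales auto
      then show ?case using weight[OF x] vandermonde_nonzero[OF elim(2)] by simp
    qed
    have "((\<lambda>b'. W b' x) \<longlongrightarrow> W b x) ?F"
    proof -
      have D: "((\<lambda>b'. divdiff R b' j (g_gauss (x i))) \<longlongrightarrow>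
          divdiff R b j (g_gauss (x i))) ?F" if "i < n" "j < n" for i j
        by (rule divdiff_tendsto[OF self comp nontriv \<open>j < n\<close>])
          (intro holomorphic_on_imp_continuous_on g_gauss_holomorphic x that)
      have "((\<lambda>b'. Determinant.det (mat n n (\<lambda>(i, j). divdiff R b' j (g_gauss (x i))))) \<longlongrightarrow>
          Determinant.det (mat n n (\<lambda>(i, j). divdiff R b j (g_gauss (x i))))) ?F"
      proof -
        have "((\<lambda>b'. mat n n (\<lambda>(i, j). divdiff R b' j (g_gauss (x i))) $$ (i, p i)) \<longlongrightarrow>
            mat n n (\<lambda>(i, j). divdiff R b j (g_gauss (x i))) $$ (i, p i)) ?F"
          if "p permutes {0..<n}" "i \<in> {0..<n}" for p i
          using D[of i "p i"] permutes_in_image[OF that(1), of i] that(2) by simp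
        then show ?thesis
          by (subst (1 2) det_def'[of _ n]) (auto intro!: tendsto_sum tendsto_mult tendsto_prod)
      qed
      moreover have "(E \<longlongrightarrow> E b) ?F"
        unfolding E_def by (intro tendsto_prod tendsto_exp tendsto_power tendsto_of_real comp)
      ultimately show ?thesis unfolding W_def by (intro tendsto_mult tendsto_const)
    qed
    then have "((\<lambda>b'. biorthogonal_weight n M \<nu> b' x / of_real (vandermonde n b')) \<longlongrightarrow> W b x) ?F"
      using tendsto_cong[OF ev] by blast
    then show ?thesis
      unfolding ensemble_weight_def v_def using False tendsto_Lim[OF nontriv] by simp
  qed
  define \<gamma> where "\<gamma> = (\<Prod>j<n. 1 / complex_of_real (gamma_weight M \<nu> j)) * (\<Prod>j<n. 1 / complex_of_real (sqrt pi))"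
  have "\<gamma> \<noteq> 0" unfolding \<gamma>_def using gamma_weight_pos[of M \<nu>] by (auto simp: less_imp_neq[symmetric])
  have "E b * kernel_det n x = \<gamma> * W b x" for x
  proof -
    have "Determinant.det (mat n n (\<lambda>(i, j). Q j (x i))) =
        Determinant.det (mat n n (\<lambda>(i, j). divdiff R b j (g_gauss (x i)) * (1 / of_real (sqrt pi))))"
      unfolding Q_def by simp
    also have "\<dots> = Determinant.det (mat n n (\<lambda>(i, j). divdiff R b j (g_gauss (x i)))) *
        (\<Prod>j<n. 1 / of_real (sqrt pi))"
      by (rule det_scale_columns)
    finally show ?thesis
      unfolding kernel_det_factor det_P \<gamma>_def W_def by (simp only: mult_ac)
  qed
  then have "W b x = E b / \<gamma> * kernel_det n x" for x
    using \<open>\<gamma> \<noteq> 0\<close> by (simp add: field_simps)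
  then show ?thesis using ens by (intro exI[of _ "of_real v * (E b / \<gamma>)"]) (simp add: mult.assoc)
qed

text \<open>The unknown constants enter only through \<open>c * \<kappa>\<close>. The case
  \<open>k = 0\<close> of the integral formula is the total mass, whence
  \<open>c * \<kappa> * n! = 1\<close>, and this cancels the factorials in every correlation
  function.\<close>

lemma determinantal:
  assumes p: "joint_pdf n p"
    and weight: "\<forall>x\<in>space (punctured_lebesgue {..<n}). complex_of_real (p x) = c * ensemble_weight n M \<nu> b x"
    and K: "\<And>x y. y \<noteq> 0 \<Longrightarrow> K x y = kernel x y"
  shows "determinantal_with_kernel n p K"
proof -
  have space_eq: "space (punctured_lebesgue I) = PiE I (\<lambda>_. - {0})" for I
    by (simp add: punctured_lebesgue_def space_PiM space_restrict_space)
  obtain \<kappa> where \<kappa>: "\<And>x. (\<And>i. i < n \<Longrightarrow> x i \<noteq> 0) \<Longrightarrow> ensemble_weight n M \<nu> b x = \<kappa> * kernel_det n x"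
    using ensemble_weight_eq by blast
  have pk: "complex_of_real (p x) = c * \<kappa> * kernel_det n x" if "x \<in> space (punctured_lebesgue {..<n})" for x
  proof -
    have "x i \<noteq> 0" if "i < n" for i
      using \<open>x \<in> space _\<close> that unfolding space_eq by (auto dest!: PiE_mem[of _ _ _ i])
    then show ?thesis using weight \<open>x \<in> space _\<close> \<kappa> by simp
  qed
  have int: "complex_of_real (LINT z|punctured_lebesgue {k..<n}. p (merge {..<k} {k..<n} (x, z))) =
      c * \<kappa> * (fact (n - k) * kernel_det k x)"
    if "k \<le> n" "x \<in> space (punctured_lebesgue {..<k})" for k x
  proof -
    have "complex_of_real (LINT z|punctured_lebesgue {k..<n}. p (merge {..<k} {k..<n} (x, z))) =
        (LINT z|punctured_lebesgue {k..<n}. c * \<kappa> * kernel_det n (merge {..<k} {k..<n} (x, z)))"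
      unfolding integral_complex_of_real[symmetric]
    proof (intro Bochner_Integration.integral_cong refl pk)
      fix z assume "z \<in> space (punctured_lebesgue {k..<n})"
      moreover have "{..<k} \<union> {k..<n} = {..<n}" using that by auto
      ultimately show "merge {..<k} {k..<n} (x, z) \<in> space (punctured_lebesgue {..<n})"
        using that(2) unfolding space_eq by (auto simp: PiE_iff merge_def extensional_def split: if_splits)
    qed
    also have "\<dots> = c * \<kappa> * (LINT z|punctured_lebesgue {k..<n}. kernel_det n (merge {..<k} {k..<n} (x, z)))"
      by (rule integral_mult_right_zero)
    also have "(LINT z|punctured_lebesgue {k..<n}. kernel_det n (merge {..<k} {k..<n} (x, z))) = fact (n - k) * kernel_det k x"
      unfolding punctured_lebesgue_def by (rule kernel_det_integral_all[OF that(1)])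
    finally show ?thesis .
  qed
  have norm: "c * \<kappa> * fact n = 1"
  proof -
    have "(LINT z|punctured_lebesgue {..<n}. p z) = 1"
      using p unfolding joint_pdf_def
      by (subst integral_eq_nn_integral) auto
    moreover have "(LINT z|punctured_lebesgue {0..<n}. p (merge {..<0} {0..<n} (\<lambda>_. undefined, z))) =
        (LINT z|punctured_lebesgue {..<n}. p z)"
      unfolding lessThan_atLeast0
    proof (intro Bochner_Integration.integral_cong refl arg_cong[of _ _ p])
      fix z assume "z \<in> space (punctured_lebesgue {0..<n})"
      then show "merge {0..<0} {0..<n} (\<lambda>_. undefined, z) = z"
        unfolding space_eq by (auto simp: merge_def PiE_iff extensional_def)
    qed
    moreover have "kernel_det 0 x = 1" for x by (simp add: kernel_det_eq)
    ultimately show ?thesis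
      using int[of 0 "\<lambda>_. undefined"] by (simp add: space_eq)
  qed
  show ?thesis
    unfolding determinantal_with_kernel_def
  proof (intro ballI)
    fix k x assume k: "k \<in> {1..n}" and x: "x \<in> space (punctured_lebesgue {..<k})"
    have x0: "x i \<noteq> 0" if "i < k" for i
      using x that unfolding space_eq by (auto dest!: PiE_mem[of _ _ _ i])
    have "complex_of_real (correlation_function n p k x) =
        fact n / fact (n - k) * (c * \<kappa> * (fact (n - k) * kernel_det k x))"
      unfolding correlation_function_def using int[of k x] k x by simp
    also have "\<dots> = (c * \<kappa> * fact n) * kernel_det k x" by simp
    also have "\<dots> = kernel_det k x" unfolding norm by simp
    also have "\<dots> = Determinant.det (mat k k (\<lambda>(i, j). K (x i) (x j)))"
      unfolding kernel_det_def
      by (rule arg_cong[of _ _ Determinant.det], rule eq_matI) (auto simp: K x0)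
    finally show "complex_of_real (correlation_function n p k x) = Determinant.det (mat k k (\<lambda>(i, j). K (x i) (x j)))" .
  qed
qed

end

theorem theorem2:
  fixes n M :: nat and \<nu> :: "nat \<Rightarrow> nat" and b :: "nat \<Rightarrow> real"
    and p :: "(nat \<Rightarrow> real) \<Rightarrow> real"
    and C\<^sub>0 C\<^sub>b L :: "real \<Rightarrow> complex"
  assumes "n \<ge> 1"
    and "joint_pdf n p"
    and "\<exists>c::complex. \<forall>x\<in>space (punctured_lebesgue {..<n}).
           complex_of_real (p x) = c * ensemble_weight n M \<nu> b x"
    and "encircles_anticlockwise C\<^sub>0 {0}"
    and "encircles_anticlockwise C\<^sub>b ((\<lambda>l. complex_of_real (b l)) ` {..<n})"
    and "path_between_imaginary_infinities L"
    and "range L \<inter> path_image C\<^sub>b = {}"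
  shows "determinantal_with_kernel n p (K_kernel C\<^sub>0 C\<^sub>b L n M \<nu> b)"
proof -
  \<comment> \<open>The sum dominates every \<open>\<bar>b l\<bar>\<close>, and the added 1 makes
    the bound strict.\<close>
  define R where "R = 1 + (\<Sum>l<n. \<bar>b l\<bar>)"
  have "\<bar>b l\<bar> < R" if "l < n" for l
    using member_le_sum[of l "{..<n}" "\<lambda>l. \<bar>b l\<bar>"] that unfolding R_def by auto
  moreover have "R > 0" unfolding R_def by (simp add: add_pos_nonneg sum_nonneg)
  ultimately interpret product_ensemble R b n M \<nu> C\<^sub>0
    using assms(4) by unfold_locales
  obtain c where "\<forall>x\<in>space (punctured_lebesgue {..<n}).
      complex_of_real (p x) = c * ensemble_weight n M \<nu> b x"
    using assms(3) by blast
  with assms(2) show ?thesis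
    by (rule determinantal) (rule K_kernel_eq[OF assms(5-7)])
qed

end
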